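(* Let $\mathcal{C}$ be a category with kernels and cokernels, with pullback-stable normal epimorphisms and with enough normal-projectives. If $\mathrm{Ext}^1(Q,K)$ is small for all objects $Q$ and $K$ of $\mathcal{C}$, then $\mathrm{Ext}^n(Q,K)$ is small for all objects $Q$ and $K$ of $\mathcal{C}$ and each $n\geq 1$. Every semi-abelian variety of algebras satisfies these hypotheses; in particular, in any semi-abelian variety of algebras, $\mathrm{Ext}^n(Q,K)$ is small for all objects $Q$, $K$ and each $n\geq 1$.
   Context: Foundations: one works in ZFC with a fixed Grothendieck universe $\mathcal{U}$ (containing $\mathbb{N}$). The objects satisfying the ZFC axioms (including the Axiom of Choice) are called conglomerates; the elements of $\mathcal{U}$ are called sets, and the subconglomerates of $\mathcal{U}$ are called classes. A conglomerate is small when it admits a bijection to a set (an element of $\mathcal{U}$). Categories have classes of objects and arrows. The algebras of a variety have sets as underlying sets, and the signature of a variety is a set of finitary operations. A category with kernels and cokernels is a category with a zero object in which every morphism has a kernel and a cokernel. A normal monomorphism is a morphism which is a kernel of some morphism; a normal epimorphism is a morphism which is a cokernel of some morphism. Normal epimorphisms are pullback-stable when the pullback of a normal epimorphism along any morphism with the same codomain exists and is again a normal epimorphism. A short exact sequence $0\to K\xrightarrow{k} X\xrightarrow{q} Q\to 0$ is a pair $(k,q)$ with $k$ a kernel of $q$ and $q$ a cokernel of $k$. An object $P$ is normal-projective if for every normal epimorphism $e\colon X\to Y$ and every morphism $f\colon P\to Y$ there is a morphism $g\colon P\to X$ with $eg=f$. The category has enough normal-projectives when for every object $Q$ there is a normal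 epimorphism $P\to Q$ with $P$ normal-projective. For $n\geq 1$, an exact sequence of length $n$ from $K$ to $Q$ is a sequence of morphisms $0\to K\xrightarrow{f_{n+1}} X_n\xrightarrow{f_n}\cdots\xrightarrow{f_2} X_1\xrightarrow{f_1} Q\to 0$ such that each $f_i$ ($1\leq i\leq n+1$) factors as $f_i=m_ie_i$ with $e_i$ a normal epimorphism and $m_i$ a normal monomorphism ($e_{n+1}$ may be taken to be $1_K$, and $m_1$ to be $1_Q$), and each pair $(m_{i+1},e_i)$, $1\leq i\leq n$, is a short exact sequence. For $n=1$ this is a short exact sequence. The category $\mathsf{Ext}^n(Q,K)$ has these as objects; a morphism from $(X_i,f_i)$ to $(Y_i,g_i)$ is a tuple $(\alpha_n,\dots,\alpha_1)$ of morphisms $\alpha_i\colon X_i\to Y_i$ commuting with the given morphisms and with the identities $1_K$ and $1_Q$ at the ends. Then $\mathrm{Ext}^n(Q,K)=\pi_0(\mathsf{Ext}^n(Q,K))$ is the conglomerate of its connected components, called $n$-step extensions (two exact sequences are in the same component if and only if they are joined by a finite zigzag of morphisms). A category is semi-abelian when it is pointed, Barr exact, Bourn protomodular and has finite coproducts. A semi-abelian variety is a variety of algebras (in the sense of universal algebra) which is semi-abelian as a category. By a theorem of Bourn and Janelidze, a variety is semi-abelian if and only if its free algebra on the empty set is a singleton (so there is a unique constant $0$) and there exist an integer $\ell\geq 1$, binary operations $\alpha_1,\dots,\alpha_\ell$ satisfying $\alpha_i(x,x)=0$ for all $i$, and an $(\ell+1)$-ary operation $\beta$ satisfying $\beta(\alpha_1(x,y),\dots,\alpha_\ell(x,y),y)=x$.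 *)

theory Defs
  imports Main "HOL-Library.FuncSet"
begin

section \<open>Sets, classes and conglomerates\<close>

text \<open>
  The type \<open>'u\<close> is the universe \<open>\<U>\<close>, and \<open>mem\<close> is the membership relation between its elements.
  Conglomerates are rendered by arbitrary HOL sets over arbitrary types, so that quantification
  over \<open>A :: 'u set\<close> ranges over all subconglomerates of \<open>\<U>\<close>. Since \<open>\<U>\<close> is the whole type, its
  transitivity is built in.
\<close>

definition elems :: "('u \<Rightarrow> 'u \<Rightarrow> bool) \<Rightarrow> 'u \<Rightarrow> 'u set" where
  "elems mem u = {x. mem x u}"

text \<open>
  The clauses are: extensionality and foundation of membership; closure of \<open>\<U>\<close> under pairs; under
  power sets (every subconglomerate of a set is a set, and these form a set); under unions of
  families indexed by a set; and existence of an inductive set, i.e. the natural numbers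
  are a set.
\<close>

definition grothendieck_universe :: "('u \<Rightarrow> 'u \<Rightarrow> bool) \<Rightarrow> bool" where
  "grothendieck_universe mem \<longleftrightarrow>
     (\<forall>u v. elems mem u = elems mem v \<longrightarrow> u = v) \<and>
     wfP mem \<and>
     (\<forall>u v. \<exists>w. elems mem w = {u, v}) \<and>
     (\<forall>u. \<exists>p. elems mem p = {v. elems mem v \<subseteq> elems mem u} \<and>
              (\<forall>A \<subseteq> elems mem u. \<exists>v \<in> elems mem p. elems mem v = A)) \<and>
     (\<forall>u F. \<exists>w. elems mem w = (\<Union>i \<in> elems mem u. elems mem (F i))) \<and>
     (\<exists>w. (\<exists>z \<in> elems mem w. elems mem z = {}) \<and>
          (\<forall>x \<in> elems mem w. \<exists>y \<in> elems mem w. elems mem y = insert x (elems mem x)))"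

definition small :: "('u \<Rightarrow> 'u \<Rightarrow> bool) \<Rightarrow> 'b set \<Rightarrow> bool" where
  "small mem A \<longleftrightarrow> (\<exists>u f. bij_betw f A (elems mem u))"

text \<open>Being in bijection with a class, that is, with a subconglomerate of \<open>\<U>\<close>; the argument
  \<open>mem\<close> only serves to fix the type \<open>'u\<close>.\<close>

definition class_sized :: "('u \<Rightarrow> 'u \<Rightarrow> bool) \<Rightarrow> 'b set \<Rightarrow> bool" where
  "class_sized (mem :: 'u \<Rightarrow> 'u \<Rightarrow> bool) (A :: 'b set) \<longleftrightarrow> (\<exists>f :: 'b \<Rightarrow> 'u. inj_on f A)"


section \<open>Categories\<close>

text \<open>Only the values of the operations on actual objects, arrows and composable pairs matter.
  Composition is written in the usual order: \<open>g \<cdot> f\<close> is \<open>f\<close> followed by \<open>g\<close>.\<close>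

record ('o, 'a) category =
  Obj :: "'o set"
  Arr :: "'a set"
  Dom :: "'a \<Rightarrow> 'o"
  Cod :: "'a \<Rightarrow> 'o"
  Ide :: "'o \<Rightarrow> 'a"
  Comp :: "'a \<Rightarrow> 'a \<Rightarrow> 'a" (infixl "\<cdot>\<index>" 70)

definition Hom :: "('o, 'a) category \<Rightarrow> 'o \<Rightarrow> 'o \<Rightarrow> 'a set" where
  "Hom C x y = {f \<in> Arr C. Dom C f = x \<and> Cod C f = y}"

definition is_category :: "('o, 'a) category \<Rightarrow> bool" where
  "is_category C \<longleftrightarrow>
     (\<forall>f \<in> Arr C. Dom C f \<in> Obj C \<and> Cod C f \<in> Obj C) \<and>
     (\<forall>x \<in> Obj C. Ide C x \<in> Hom C x x) \<and>
     (\<forall>x \<in> Obj C. \<forall>y \<in> Obj C. \<forall>z \<in> Obj C. \<forall>f \<in> Hom C x y. \<forall>g \<in> Hom C y z.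
        g \<cdot>\<^bsub>C\<^esub> f \<in> Hom C x z) \<and>
     (\<forall>f \<in> Arr C. f \<cdot>\<^bsub>C\<^esub> Ide C (Dom C f) = f \<and> Ide C (Cod C f) \<cdot>\<^bsub>C\<^esub> f = f) \<and>
     (\<forall>f \<in> Arr C. \<forall>g \<in> Arr C. \<forall>h \<in> Arr C. Dom C g = Cod C f \<longrightarrow> Dom C h = Cod C g \<longrightarrow>
        h \<cdot>\<^bsub>C\<^esub> (g \<cdot>\<^bsub>C\<^esub> f) = (h \<cdot>\<^bsub>C\<^esub> g) \<cdot>\<^bsub>C\<^esub> f)"

definition category_in :: "('u \<Rightarrow> 'u \<Rightarrow> bool) \<Rightarrow> ('o, 'a) category \<Rightarrow> bool" where
  "category_in mem C \<longleftrightarrow>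
     is_category C \<and> class_sized mem (Obj C) \<and> class_sized mem (Arr C)"

definition is_iso :: "('o, 'a) category \<Rightarrow> 'a \<Rightarrow> bool" where
  "is_iso C f \<longleftrightarrow> f \<in> Arr C \<and>
     (\<exists>g \<in> Hom C (Cod C f) (Dom C f).
        g \<cdot>\<^bsub>C\<^esub> f = Ide C (Dom C f) \<and> f \<cdot>\<^bsub>C\<^esub> g = Ide C (Cod C f))"

definition is_initial :: "('o, 'a) category \<Rightarrow> 'o \<Rightarrow> bool" where
  "is_initial C z \<longleftrightarrow> z \<in> Obj C \<and> (\<forall>x \<in> Obj C. \<exists>!f. f \<in> Hom C z x)"

definition is_terminal :: "('o, 'a) category \<Rightarrow> 'o \<Rightarrow> bool" where
  "is_terminal C z \<longleftrightarrow> z \<in> Obj C \<and> (\<forall>x \<in> Obj C. \<exists>!f. f \<in> Hom C x z)"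

definition is_zero_object :: "('o, 'a) category \<Rightarrow> 'o \<Rightarrow> bool" where
  "is_zero_object C z \<longleftrightarrow> is_initial C z \<and> is_terminal C z"

definition pointed :: "('o, 'a) category \<Rightarrow> bool" where
  "pointed C \<longleftrightarrow> (\<exists>z. is_zero_object C z)"

definition is_zero_arrow :: "('o, 'a) category \<Rightarrow> 'a \<Rightarrow> bool" where
  "is_zero_arrow C f \<longleftrightarrow> f \<in> Arr C \<and>
     (\<exists>z. is_zero_object C z \<and>
        (\<exists>g \<in> Hom C (Dom C f) z. \<exists>h \<in> Hom C z (Cod C f). f = h \<cdot>\<^bsub>C\<^esub> g))"

definition is_pullback :: "('o, 'a) category \<Rightarrow> 'a \<Rightarrow> 'a \<Rightarrow> 'a \<Rightarrow> 'a \<Rightarrow> bool" where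
  \<comment> \<open>\<open>p\<close>, \<open>q\<close> are the projections of a pullback of \<open>f\<close> along \<open>g\<close>, with \<open>f \<cdot> p = g \<cdot> q\<close>\<close>
  "is_pullback C f g p q \<longleftrightarrow>
     f \<in> Arr C \<and> g \<in> Arr C \<and> p \<in> Arr C \<and> q \<in> Arr C \<and>
     Cod C f = Cod C g \<and> Dom C p = Dom C q \<and> Cod C p = Dom C f \<and> Cod C q = Dom C g \<and>
     f \<cdot>\<^bsub>C\<^esub> p = g \<cdot>\<^bsub>C\<^esub> q \<and>
     (\<forall>x \<in> Obj C. \<forall>a \<in> Hom C x (Dom C f). \<forall>b \<in> Hom C x (Dom C g).
        f \<cdot>\<^bsub>C\<^esub> a = g \<cdot>\<^bsub>C\<^esub> b \<longrightarrow>
        (\<exists>!u. u \<in> Hom C x (Dom C p) \<and> p \<cdot>\<^bsub>C\<^esub> u = a \<and> q \<cdot>\<^bsub>C\<^esub> u = b))"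


section \<open>Kernels, cokernels and normal-projectives\<close>

definition is_kernel :: "('o, 'a) category \<Rightarrow> 'a \<Rightarrow> 'a \<Rightarrow> bool" where
  \<comment> \<open>\<open>k\<close> is a kernel of \<open>f\<close>\<close>
  "is_kernel C k f \<longleftrightarrow>
     k \<in> Arr C \<and> f \<in> Arr C \<and> Cod C k = Dom C f \<and> is_zero_arrow C (f \<cdot>\<^bsub>C\<^esub> k) \<and>
     (\<forall>h \<in> Arr C. Cod C h = Dom C f \<longrightarrow> is_zero_arrow C (f \<cdot>\<^bsub>C\<^esub> h) \<longrightarrow>
        (\<exists>!u. u \<in> Hom C (Dom C h) (Dom C k) \<and> k \<cdot>\<^bsub>C\<^esub> u = h))"

definition is_cokernel :: "('o, 'a) category \<Rightarrow> 'a \<Rightarrow> 'a \<Rightarrow> bool" where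
  \<comment> \<open>\<open>q\<close> is a cokernel of \<open>f\<close>\<close>
  "is_cokernel C q f \<longleftrightarrow>
     q \<in> Arr C \<and> f \<in> Arr C \<and> Dom C q = Cod C f \<and> is_zero_arrow C (q \<cdot>\<^bsub>C\<^esub> f) \<and>
     (\<forall>h \<in> Arr C. Dom C h = Cod C f \<longrightarrow> is_zero_arrow C (h \<cdot>\<^bsub>C\<^esub> f) \<longrightarrow>
        (\<exists>!u. u \<in> Hom C (Cod C q) (Cod C h) \<and> u \<cdot>\<^bsub>C\<^esub> q = h))"

definition with_kernels_and_cokernels :: "('o, 'a) category \<Rightarrow> bool" where
  "with_kernels_and_cokernels C \<longleftrightarrow>
     pointed C \<and> (\<forall>f \<in> Arr C. (\<exists>k. is_kernel C k f) \<and> (\<exists>q. is_cokernel C q f))"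

definition normal_mono :: "('o, 'a) category \<Rightarrow> 'a \<Rightarrow> bool" where
  "normal_mono C m \<longleftrightarrow> (\<exists>f. is_kernel C m f)"

definition normal_epi :: "('o, 'a) category \<Rightarrow> 'a \<Rightarrow> bool" where
  "normal_epi C e \<longleftrightarrow> (\<exists>f. is_cokernel C e f)"

definition pullback_stable_normal_epis :: "('o, 'a) category \<Rightarrow> bool" where
  "pullback_stable_normal_epis C \<longleftrightarrow>
     (\<forall>e g. normal_epi C e \<longrightarrow> g \<in> Arr C \<longrightarrow> Cod C g = Cod C e \<longrightarrow>
        (\<exists>p q. is_pullback C e g p q) \<and>
        (\<forall>p q. is_pullback C e g p q \<longrightarrow> normal_epi C q))"

definition normal_projective :: "('o, 'a) category \<Rightarrow> 'o \<Rightarrow> bool" where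
  "normal_projective C P \<longleftrightarrow> P \<in> Obj C \<and>
     (\<forall>e f. normal_epi C e \<longrightarrow> f \<in> Hom C P (Cod C e) \<longrightarrow>
        (\<exists>g \<in> Hom C P (Dom C e). e \<cdot>\<^bsub>C\<^esub> g = f))"

definition enough_normal_projectives :: "('o, 'a) category \<Rightarrow> bool" where
  "enough_normal_projectives C \<longleftrightarrow>
     (\<forall>Q \<in> Obj C. \<exists>P. \<exists>e \<in> Hom C P Q. normal_projective C P \<and> normal_epi C e)"

definition short_exact :: "('o, 'a) category \<Rightarrow> 'a \<Rightarrow> 'a \<Rightarrow> bool" where
  "short_exact C k q \<longleftrightarrow> is_kernel C k q \<and> is_cokernel C q k"


section \<open>The categories of exact sequences and their connected components\<close>

text \<open>
  A sequence \<open>K \<rightarrow> X\<^sub>n \<rightarrow> \<dots> \<rightarrow> X\<^sub>1 \<rightarrow> Q\<close> is given by its arrows \<open>f (n+1), \<dots>, f 1\<close>, so that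
  \<open>X\<^sub>i\<close> is the domain of \<open>f i\<close>. The conditions on \<open>e (n+1)\<close> and \<open>m 1\<close> express exactness at
  \<open>K\<close> and \<open>Q\<close>.
\<close>

definition exact_sequence ::
    "('o, 'a) category \<Rightarrow> nat \<Rightarrow> 'o \<Rightarrow> 'o \<Rightarrow> (nat \<Rightarrow> 'a) \<Rightarrow> bool" where
  "exact_sequence C n Q K f \<longleftrightarrow>
     f \<in> {1..n+1} \<rightarrow>\<^sub>E Arr C \<and>
     Dom C (f (n+1)) = K \<and> Cod C (f 1) = Q \<and> (\<forall>i \<in> {1..n}. Cod C (f (i+1)) = Dom C (f i)) \<and>
     (\<exists>m e.
        (\<forall>i \<in> {1..n+1}. normal_epi C (e i) \<and> normal_mono C (m i) \<and>
           Cod C (e i) = Dom C (m i) \<and> f i = m i \<cdot>\<^bsub>C\<^esub> e i) \<and>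
        e (n+1) = Ide C K \<and> m 1 = Ide C Q \<and>
        (\<forall>i \<in> {1..n}. short_exact C (m (i+1)) (e i)))"

definition exact_sequence_morphism ::
    "('o, 'a) category \<Rightarrow> nat \<Rightarrow> (nat \<Rightarrow> 'a) \<Rightarrow> (nat \<Rightarrow> 'a) \<Rightarrow> (nat \<Rightarrow> 'a) \<Rightarrow> bool" where
  "exact_sequence_morphism C n f g \<alpha> \<longleftrightarrow>
     \<alpha> \<in> (\<Pi>\<^sub>E i \<in> {1..n}. Hom C (Dom C (f i)) (Dom C (g i))) \<and>
     \<alpha> n \<cdot>\<^bsub>C\<^esub> f (n+1) = g (n+1) \<and>
     (\<forall>i \<in> {1..<n}. \<alpha> i \<cdot>\<^bsub>C\<^esub> f (i+1) = g (i+1) \<cdot>\<^bsub>C\<^esub> \<alpha> (i+1)) \<and>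
     g 1 \<cdot>\<^bsub>C\<^esub> \<alpha> 1 = f 1"

definition Ext_category ::
    "('o, 'a) category \<Rightarrow> nat \<Rightarrow> 'o \<Rightarrow> 'o \<Rightarrow>
      (nat \<Rightarrow> 'a, (nat \<Rightarrow> 'a) \<times> (nat \<Rightarrow> 'a) \<times> (nat \<Rightarrow> 'a)) category" where
  "Ext_category C n Q K =
     \<lparr> Obj = {f. exact_sequence C n Q K f},
       Arr = {(f, \<alpha>, g). exact_sequence C n Q K f \<and> exact_sequence C n Q K g \<and>
                exact_sequence_morphism C n f g \<alpha>},
       Dom = (\<lambda>(f, \<alpha>, g). f),
       Cod = (\<lambda>(f, \<alpha>, g). g),
       Ide = (\<lambda>f. (f, \<lambda>i \<in> {1..n}. Ide C (Dom C (f i)), f)),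
       Comp = (\<lambda>(g, \<beta>, h) (f, \<alpha>, g'). (f, \<lambda>i \<in> {1..n}. \<beta> i \<cdot>\<^bsub>C\<^esub> \<alpha> i, h)) \<rparr>"

text \<open>Two objects lie in the same component iff they are joined by a finite zigzag of arrows.\<close>

definition pi0 :: "('o, 'a) category \<Rightarrow> 'o set set" where
  "pi0 C = (let S = {(Dom C a, Cod C a) | a. a \<in> Arr C} in Obj C // (S \<union> S\<inverse>)\<^sup>*)"

definition Ext :: "('o, 'a) category \<Rightarrow> nat \<Rightarrow> 'o \<Rightarrow> 'o \<Rightarrow> (nat \<Rightarrow> 'a) set set" where
  "Ext C n Q K = pi0 (Ext_category C n Q K)"


section \<open>Semi-abelian categories\<close>

text \<open>Finite limits and finite colimits of the required kind are expressed by the usual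
  generating shapes: terminal object and pullbacks, initial object and binary coproducts.\<close>

definition has_pullbacks :: "('o, 'a) category \<Rightarrow> bool" where
  "has_pullbacks C \<longleftrightarrow>
     (\<forall>f \<in> Arr C. \<forall>g \<in> Arr C. Cod C f = Cod C g \<longrightarrow> (\<exists>p q. is_pullback C f g p q))"

definition has_finite_limits :: "('o, 'a) category \<Rightarrow> bool" where
  "has_finite_limits C \<longleftrightarrow> (\<exists>z. is_terminal C z) \<and> has_pullbacks C"

definition is_coproduct :: "('o, 'a) category \<Rightarrow> 'o \<Rightarrow> 'o \<Rightarrow> 'a \<Rightarrow> 'a \<Rightarrow> bool" where
  "is_coproduct C x y i j \<longleftrightarrow>
     i \<in> Arr C \<and> j \<in> Arr C \<and> Dom C i = x \<and> Dom C j = y \<and> Cod C i = Cod C j \<and>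
     (\<forall>z \<in> Obj C. \<forall>f \<in> Hom C x z. \<forall>g \<in> Hom C y z.
        \<exists>!u. u \<in> Hom C (Cod C i) z \<and> u \<cdot>\<^bsub>C\<^esub> i = f \<and> u \<cdot>\<^bsub>C\<^esub> j = g)"

definition has_finite_coproducts :: "('o, 'a) category \<Rightarrow> bool" where
  "has_finite_coproducts C \<longleftrightarrow>
     (\<exists>z. is_initial C z) \<and> (\<forall>x \<in> Obj C. \<forall>y \<in> Obj C. \<exists>i j. is_coproduct C x y i j)"

definition is_coequalizer :: "('o, 'a) category \<Rightarrow> 'a \<Rightarrow> 'a \<Rightarrow> 'a \<Rightarrow> bool" where
  \<comment> \<open>\<open>q\<close> is a coequalizer of \<open>f\<close> and \<open>g\<close>\<close>
  "is_coequalizer C q f g \<longleftrightarrow>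
     f \<in> Arr C \<and> g \<in> Arr C \<and> q \<in> Arr C \<and>
     Dom C f = Dom C g \<and> Cod C f = Cod C g \<and> Dom C q = Cod C f \<and> q \<cdot>\<^bsub>C\<^esub> f = q \<cdot>\<^bsub>C\<^esub> g \<and>
     (\<forall>h \<in> Arr C. Dom C h = Cod C f \<longrightarrow> h \<cdot>\<^bsub>C\<^esub> f = h \<cdot>\<^bsub>C\<^esub> g \<longrightarrow>
        (\<exists>!u. u \<in> Hom C (Cod C q) (Cod C h) \<and> u \<cdot>\<^bsub>C\<^esub> q = h))"

definition regular_epi :: "('o, 'a) category \<Rightarrow> 'a \<Rightarrow> bool" where
  "regular_epi C q \<longleftrightarrow> (\<exists>f g. is_coequalizer C q f g)"

definition regular_category :: "('o, 'a) category \<Rightarrow> bool" where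
  "regular_category C \<longleftrightarrow>
     has_finite_limits C \<and>
     (\<forall>f p q. is_pullback C f f p q \<longrightarrow> (\<exists>c. is_coequalizer C c p q)) \<and>
     (\<forall>e g p q. regular_epi C e \<longrightarrow> is_pullback C e g p q \<longrightarrow> regular_epi C q)"

definition internal_equivalence :: "('o, 'a) category \<Rightarrow> 'a \<Rightarrow> 'a \<Rightarrow> bool" where
  \<comment> \<open>\<open>d\<close>, \<open>c\<close> are the projections of an internal equivalence relation: they are jointly monic,
      and the relation is reflexive, symmetric and transitive\<close>
  "internal_equivalence C d c \<longleftrightarrow>
     d \<in> Arr C \<and> c \<in> Arr C \<and> Dom C d = Dom C c \<and> Cod C d = Cod C c \<and>
     (\<forall>x \<in> Obj C. \<forall>u \<in> Hom C x (Dom C d). \<forall>v \<in> Hom C x (Dom C d).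
        d \<cdot>\<^bsub>C\<^esub> u = d \<cdot>\<^bsub>C\<^esub> v \<longrightarrow> c \<cdot>\<^bsub>C\<^esub> u = c \<cdot>\<^bsub>C\<^esub> v \<longrightarrow> u = v) \<and>
     (\<exists>r \<in> Hom C (Cod C d) (Dom C d).
        d \<cdot>\<^bsub>C\<^esub> r = Ide C (Cod C d) \<and> c \<cdot>\<^bsub>C\<^esub> r = Ide C (Cod C d)) \<and>
     (\<exists>s \<in> Hom C (Dom C d) (Dom C d). d \<cdot>\<^bsub>C\<^esub> s = c \<and> c \<cdot>\<^bsub>C\<^esub> s = d) \<and>
     (\<forall>p q. is_pullback C c d p q \<longrightarrow>
        (\<exists>t \<in> Hom C (Dom C p) (Dom C d).
           d \<cdot>\<^bsub>C\<^esub> t = d \<cdot>\<^bsub>C\<^esub> p \<and> c \<cdot>\<^bsub>C\<^esub> t = c \<cdot>\<^bsub>C\<^esub> q))"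

definition Barr_exact :: "('o, 'a) category \<Rightarrow> bool" where
  "Barr_exact C \<longleftrightarrow>
     regular_category C \<and>
     (\<forall>d c. internal_equivalence C d c \<longrightarrow> (\<exists>f. is_pullback C f f d c))"

definition point_over :: "('o, 'a) category \<Rightarrow> 'o \<Rightarrow> 'a \<Rightarrow> 'a \<Rightarrow> bool" where
  "point_over C B p s \<longleftrightarrow>
     p \<in> Arr C \<and> Cod C p = B \<and> s \<in> Hom C B (Dom C p) \<and> p \<cdot>\<^bsub>C\<^esub> s = Ide C B"

text \<open>
  Bourn protomodularity: for each \<open>v : E \<rightarrow> B\<close> the change-of-base functor from points over \<open>B\<close>
  to points over \<open>E\<close>, given by pullback along \<open>v\<close>, reflects isomorphisms. Below, \<open>f\<close> is a morphism
  of points \<open>(p, s) \<rightarrow> (p', s')\<close> over \<open>B\<close>, and \<open>g\<close> is the arrow it induces between the pullbacks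
  along \<open>v\<close>. A morphism of points is invertible as such iff its underlying arrow is, and the
  condition does not depend on the choice of pullbacks.
\<close>

definition protomodular :: "('o, 'a) category \<Rightarrow> bool" where
  "protomodular C \<longleftrightarrow>
     has_pullbacks C \<and>
     (\<forall>v \<in> Arr C. \<forall>p s p' s' f a b a' b' g.
        point_over C (Cod C v) p s \<longrightarrow> point_over C (Cod C v) p' s' \<longrightarrow>
        f \<in> Hom C (Dom C p) (Dom C p') \<longrightarrow> p' \<cdot>\<^bsub>C\<^esub> f = p \<longrightarrow> f \<cdot>\<^bsub>C\<^esub> s = s' \<longrightarrow>
        is_pullback C v p a b \<longrightarrow> is_pullback C v p' a' b' \<longrightarrow>
        g \<in> Hom C (Dom C a) (Dom C a') \<longrightarrow> a' \<cdot>\<^bsub>C\<^esub> g = a \<longrightarrow> b' \<cdot>\<^bsub>C\<^esub> g = f \<cdot>\<^bsub>C\<^esub> b \<longrightarrow>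
        is_iso C g \<longrightarrow> is_iso C f)"

definition semi_abelian :: "('o, 'a) category \<Rightarrow> bool" where
  "semi_abelian C \<longleftrightarrow>
     is_category C \<and> pointed C \<and> Barr_exact C \<and> protomodular C \<and> has_finite_coproducts C"


section \<open>Varieties of algebras\<close>

record 'f signature =
  ops :: "'f set"
  arity :: "'f \<Rightarrow> nat"

datatype 'f trm = Var nat | App 'f "'f trm list"

fun wf_trm :: "'f signature \<Rightarrow> 'f trm \<Rightarrow> bool" where
  "wf_trm S (Var x) \<longleftrightarrow> True"
| "wf_trm S (App f ts) \<longleftrightarrow> f \<in> ops S \<and> length ts = arity S f \<and> (\<forall>t \<in> set ts. wf_trm S t)"

record ('f, 'u) algebra =
  underlying :: 'u
  oper :: "'f \<Rightarrow> 'u list \<Rightarrow> 'u"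

text \<open>The underlying set is an element of \<open>\<U>\<close>. The operations are \<open>undefined\<close> outside
  their proper domain, so that equality of algebras is the intended one.\<close>

definition is_algebra ::
    "('u \<Rightarrow> 'u \<Rightarrow> bool) \<Rightarrow> 'f signature \<Rightarrow> ('f, 'u) algebra \<Rightarrow> bool" where
  "is_algebra mem S A \<longleftrightarrow>
     (\<forall>f xs. if f \<in> ops S \<and> length xs = arity S f \<and> set xs \<subseteq> elems mem (underlying A)
             then oper A f xs \<in> elems mem (underlying A)
             else oper A f xs = undefined)"

fun eval :: "('f, 'u) algebra \<Rightarrow> (nat \<Rightarrow> 'u) \<Rightarrow> 'f trm \<Rightarrow> 'u" where
  "eval A \<rho> (Var x) = \<rho> x"
| "eval A \<rho> (App f ts) = oper A f (map (eval A \<rho>) ts)"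

definition satisfies ::
    "('u \<Rightarrow> 'u \<Rightarrow> bool) \<Rightarrow> ('f, 'u) algebra \<Rightarrow> ('f trm \<times> 'f trm) set \<Rightarrow> bool" where
  "satisfies mem A E \<longleftrightarrow>
     (\<forall>(s, t) \<in> E. \<forall>\<rho>. range \<rho> \<subseteq> elems mem (underlying A) \<longrightarrow> eval A \<rho> s = eval A \<rho> t)"

definition homomorphism ::
    "('u \<Rightarrow> 'u \<Rightarrow> bool) \<Rightarrow> 'f signature \<Rightarrow> ('f, 'u) algebra \<Rightarrow> ('f, 'u) algebra \<Rightarrow> ('u \<Rightarrow> 'u) \<Rightarrow> bool"
  where
  "homomorphism mem S A B h \<longleftrightarrow>
     h \<in> elems mem (underlying A) \<rightarrow>\<^sub>E elems mem (underlying B) \<and>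
     (\<forall>f \<in> ops S. \<forall>xs. length xs = arity S f \<longrightarrow> set xs \<subseteq> elems mem (underlying A) \<longrightarrow>
        h (oper A f xs) = oper B f (map h xs))"

definition variety_category ::
    "('u \<Rightarrow> 'u \<Rightarrow> bool) \<Rightarrow> 'f signature \<Rightarrow> ('f trm \<times> 'f trm) set \<Rightarrow>
      (('f, 'u) algebra, ('f, 'u) algebra \<times> ('u \<Rightarrow> 'u) \<times> ('f, 'u) algebra) category" where
  "variety_category mem S E =
     (let Alg = {A. is_algebra mem S A \<and> satisfies mem A E} in
      \<lparr> Obj = Alg,
        Arr = {(A, h, B). A \<in> Alg \<and> B \<in> Alg \<and> homomorphism mem S A B h},
        Dom = (\<lambda>(A, h, B). A),
        Cod = (\<lambda>(A, h, B). B),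
        Ide = (\<lambda>A. (A, \<lambda>x \<in> elems mem (underlying A). x, A)),
        Comp = (\<lambda>(B, k, D) (A, h, B'). (A, compose (elems mem (underlying A)) k h, D)) \<rparr>)"

definition variety :: "('u \<Rightarrow> 'u \<Rightarrow> bool) \<Rightarrow> 'f signature \<Rightarrow> ('f trm \<times> 'f trm) set \<Rightarrow> bool" where
  "variety mem S E \<longleftrightarrow>
     small mem (ops S) \<and> (\<forall>(s, t) \<in> E. wf_trm S s \<and> wf_trm S t)"

definition semi_abelian_variety ::
    "('u \<Rightarrow> 'u \<Rightarrow> bool) \<Rightarrow> 'f signature \<Rightarrow> ('f trm \<times> 'f trm) set \<Rightarrow> bool" where
  "semi_abelian_variety mem S E \<longleftrightarrow>
     variety mem S E \<and> semi_abelian (variety_category mem S E)"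

end

theory Submission
  imports Defs
begin

text \<open>
  The first claim is by induction on the length, along the syzygies of \<open>Q\<close>. Let \<open>p : P \<rightarrow> Q\<close> be a
  normal-projective cover with kernel \<open>i : \<Omega> \<rightarrow> P\<close>, and take an exact sequence of length \<open>n + 1\<close> from
  \<open>K\<close> to \<open>Q\<close>, with \<open>M\<close> the kernel of its last arrow \<open>X\<^sub>1 \<rightarrow> Q\<close>. Projectivity lifts \<open>p\<close> to \<open>X\<^sub>1\<close>, and
  the lift restricts to an arrow \<open>\<Omega> \<rightarrow> M\<close>. The pullback of the remaining sequence of length \<open>n\<close>
  along this arrow is again exact, because normal epimorphisms are stable and a pullback does not
  change the kernel. Splicing it with \<open>\<Omega> \<rightarrow> P \<rightarrow> Q\<close> gives a sequence with a morphism to the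
  given one (\<open>joined_with_splice\<close>). So splicing induces a surjection from the components for
  \<open>(n, \<Omega>, K)\<close> onto those for \<open>(n + 1, Q, K)\<close>, and smallness is inherited (\<open>small_Ext\<close>).

  For a semi-abelian variety everything rests on one consequence of protomodularity, a short five
  lemma for subalgebras (\<open>short_five\<close>): a subalgebra of \<open>X\<close> that contains the kernel of a
  homomorphism \<open>q\<close> and meets every fibre of \<open>q\<close> is all of \<open>X\<close>. It makes every surjective
  homomorphism a cokernel of its kernel, so that the normal epimorphisms are the surjective
  homomorphisms; these are stable under pullback, and free algebras are projective with respect to
  them. It also shows that the middle algebra of an extension of \<open>Q\<close> by \<open>K\<close> is generated by \<open>K\<close>
  together with one preimage of each element of \<open>Q\<close>. It is therefore a quotient of the algebra of
  terms over the disjoint union of \<open>K\<close> and \<open>Q\<close>, and two extensions that give the same congruence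
  on terms are connected by a morphism; there is only a small conglomerate of such congruences.

  Algebras are constructed in one way throughout (\<open>separated_quotient\<close>): from a small structure on
  which the equations need not hold, by dividing by the kernel of a collection of homomorphisms to
  algebras of the variety.
\<close>

section \<open>Small conglomerates\<close>

locale universe =
  fixes mem :: "'u \<Rightarrow> 'u \<Rightarrow> bool"
  assumes universe: "grothendieck_universe mem"
begin

lemma elems_inject: "elems mem u = elems mem v \<Longrightarrow> u = v"
  using universe unfolding grothendieck_universe_def by (elim conjE) blast

lemma mem_irrefl: "\<not> mem x x"
proof -
  have "wfP mem"
    using universe unfolding grothendieck_universe_def by (elim conjE)
  then show ?thesis
    by (meson wfp_imp_irreflp irreflpD)
qed

lemma ex_doubleton: "\<exists>w. elems mem w = {u, v}"
  using universe unfolding grothendieck_universe_def by (elim conjE) blast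

lemma ex_powerset:
  "\<exists>p. elems mem p = {v. elems mem v \<subseteq> elems mem u} \<and>
       (\<forall>A \<subseteq> elems mem u. \<exists>v \<in> elems mem p. elems mem v = A)"
  using universe unfolding grothendieck_universe_def by (elim conjE) blast

lemma ex_union: "\<exists>w. elems mem w = (\<Union>i \<in> elems mem u. elems mem (F i))"
proof -
  have "\<forall>u F. \<exists>w. elems mem w = (\<Union>i \<in> elems mem u. elems mem (F i))"
    using universe unfolding grothendieck_universe_def by (elim conjE) assumption
  then show ?thesis
    by simp
qed

lemma ex_inductive:
  "\<exists>w. (\<exists>z \<in> elems mem w. elems mem z = {}) \<and>
       (\<forall>x \<in> elems mem w. \<exists>y \<in> elems mem w. elems mem y = insert x (elems mem x))"
  using universe unfolding grothendieck_universe_def by (elim conjE) assumption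

lemma replacement: "\<exists>w. elems mem w = g ` elems mem u"
proof -
  have "\<exists>w. elems mem w = {x}" for x
    using ex_doubleton[of x x] by simp
  then obtain s where s: "\<And>x. elems mem (s x) = {x}"
    by metis
  have "g ` elems mem u = (\<Union>i \<in> elems mem u. elems mem (s (g i)))"
    by (auto simp: s)
  then show ?thesis
    using ex_union[of "\<lambda>i. s (g i)" u] by simp
qed

text \<open>The universe contains every subconglomerate of each of its elements, so an embedding suffices
  for smallness.\<close>

lemma small_inj:
  assumes "inj_on f A" "f ` A \<subseteq> elems mem u"
  shows "small mem A"
proof -
  obtain v where "elems mem v = f ` A"
    using ex_powerset[of u] assms(2) by blast
  then show ?thesis
    unfolding small_def bij_betw_def using assms(1) by metis
qed

lemma small_elems: "small mem (elems mem u)"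
  by (rule small_inj[of id]) auto

lemma small_inj_on:
  assumes "inj_on f A" "f ` A \<subseteq> B" "small mem B"
  shows "small mem A"
proof -
  obtain u g where g: "bij_betw g B (elems mem u)"
    using assms(3) unfolding small_def by blast
  show ?thesis
  proof (rule small_inj)
    show "inj_on (g \<circ> f) A"
      using assms g by (meson bij_betw_def comp_inj_on inj_on_subset)
    show "(g \<circ> f) ` A \<subseteq> elems mem u"
      using assms(2) g by (auto simp: bij_betw_def)
  qed
qed

lemma small_subset: "A \<subseteq> B \<Longrightarrow> small mem B \<Longrightarrow> small mem A"
  by (rule small_inj_on[of id]) auto

lemma small_image: "small mem A \<Longrightarrow> small mem (f ` A)"
  by (rule small_inj_on[OF inj_on_inv_into]) (auto intro: inv_into_into)

text \<open>Witnessed by Kuratowski pairs. They code elements of a disjoint union by single elements of the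
  universe.\<close>

lemma ex_pairing: "\<exists>p :: 'u \<Rightarrow> 'u \<Rightarrow> 'u. \<forall>a b c d. p a b = p c d \<longrightarrow> a = c \<and> b = d"
proof -
  obtain s where s: "\<And>x y. elems mem (s x y) = {x, y}"
    using ex_doubleton by metis
  have s_eq: "s x y = s z w \<longleftrightarrow> {x, y} = {z, w}" for x y z w
    using s elems_inject by metis
  show ?thesis
    by (rule exI[of _ "\<lambda>a b. s (s a a) (s a b)"]) (simp only: s_eq doubleton_eq_iff, blast)
qed

lemma inj_on_Sigma_pairing:
  assumes p: "\<And>a b c d. p a b = p c d \<Longrightarrow> a = c \<and> b = d"
    and h: "inj_on h I" and g: "\<And>i. i \<in> I \<Longrightarrow> inj_on (g i) (A i)"
  shows "inj_on (\<lambda>(i, x). p (h i) (g i x)) (Sigma I A)"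
proof -
  have "i = j \<and> x = y"
    if "i \<in> I" "x \<in> A i" "j \<in> I" "y \<in> A j" "p (h i) (g i x) = p (h j) (g j y)" for i j x y
  proof -
    have eq: "h i = h j" "g i x = g j y"
      using p[OF that(5)] by auto
    then have "i = j"
      using h that(1,3) by (auto dest: inj_onD)
    then show ?thesis
      using eq that(2,4) inj_onD[OF g[OF that(1)]] by auto
  qed
  then show ?thesis
    by (auto intro!: inj_onI)
qed

lemma small_Sigma:
  assumes "small mem I" "\<And>i. i \<in> I \<Longrightarrow> small mem (A i)"
  shows "small mem (Sigma I A)"
proof -
  obtain u h where h: "bij_betw h I (elems mem u)"
    using assms(1) unfolding small_def by blast
  obtain p :: "'u \<Rightarrow> 'u \<Rightarrow> 'u" where p: "\<And>a b c d. p a b = p c d \<Longrightarrow> a = c \<and> b = d"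
    using ex_pairing by blast
  obtain w g where g: "\<And>i. i \<in> I \<Longrightarrow> bij_betw (g i) (A i) (elems mem (w i))"
    using assms(2) unfolding small_def by metis
  have "\<forall>j. \<exists>v. elems mem v = p j ` elems mem (w (inv_into I h j))"
    by (intro allI replacement)
  then obtain F where F: "\<And>j. elems mem (F j) = p j ` elems mem (w (inv_into I h j))"
    by metis
  obtain W where W: "elems mem W = (\<Union>j \<in> elems mem u. elems mem (F j))"
    using ex_union[of F u] by blast
  show ?thesis
  proof (rule small_inj)
    show "inj_on (\<lambda>(i, x). p (h i) (g i x)) (Sigma I A)"
      by (rule inj_on_Sigma_pairing[of p, OF p]) (use g h in \<open>auto simp: bij_betw_def\<close>)
    show "(\<lambda>(i, x). p (h i) (g i x)) ` Sigma I A \<subseteq> elems mem W"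
      using g h by (force simp: W F bij_betw_def)
  qed
qed

lemma small_UN:
  assumes "small mem I" "\<And>i. i \<in> I \<Longrightarrow> small mem (A i)"
  shows "small mem (\<Union>i\<in>I. A i)"
proof -
  have "(\<Union>i\<in>I. A i) = snd ` Sigma I A"
    by force
  then show ?thesis
    by (simp only: small_image[OF small_Sigma[OF assms]])
qed

lemma small_singleton: "small mem {x}"
proof -
  obtain w :: 'u where "elems mem w = {undefined}"
    using ex_doubleton by blast
  then show ?thesis
    by (intro small_inj[of "\<lambda>_. undefined" _ w]) auto
qed

lemma small_Pow:
  assumes "small mem A"
  shows "small mem (Pow A)"
proof -
  obtain u h where h: "bij_betw h A (elems mem u)"
    using assms unfolding small_def by blast
  obtain p where p: "\<And>B. B \<subseteq> elems mem u \<Longrightarrow> \<exists>v \<in> elems mem p. elems mem v = B"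
    using ex_powerset by blast
  then have "\<forall>B \<in> Pow A. \<exists>v. v \<in> elems mem p \<and> elems mem v = h ` B"
    using h by (metis Pow_iff bij_betw_def image_mono)
  then obtain c where c: "\<And>B. B \<subseteq> A \<Longrightarrow> c B \<in> elems mem p \<and> elems mem (c B) = h ` B"
    by (metis Pow_iff)
  show ?thesis
  proof (rule small_inj)
    show "inj_on c (Pow A)"
      using c h by (metis Pow_iff bij_betw_def inj_on_def inj_on_image_eq_iff)
    show "c ` Pow A \<subseteq> elems mem p"
      using c by blast
  qed
qed

text \<open>The natural numbers embed as the von Neumann numerals, which are pairwise distinct since
  no set is an element of itself.\<close>

lemma small_nat: "small mem (UNIV :: nat set)"
proof -
  obtain w z s where z: "z \<in> elems mem w" "elems mem z = {}"
    and s: "\<And>x. x \<in> elems mem w \<Longrightarrow> s x \<in> elems mem w \<and> elems mem (s x) = insert x (elems mem x)"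
    using ex_inductive by metis
  define c where "c n = (s ^^ n) z" for n
  have c_in: "c n \<in> elems mem w" for n
    by (induction n) (auto simp: c_def z s)
  have "elems mem (c n) = c ` {..<n}" for n
    by (induction n) (use c_in in \<open>auto simp: c_def z s lessThan_Suc\<close>)
  then have "mem (c m) (c n)" if "m < n" for m n
    using that by (auto simp: elems_def)
  then have "inj c"
    by (metis injI linorder_neqE_nat mem_irrefl)
  then show ?thesis
    using c_in by (intro small_inj[of c _ w]) auto
qed

lemma small_Un:
  assumes "small mem A" "small mem B"
  shows "small mem (A \<union> B)"
proof -
  have "small mem (\<Union>n \<in> (UNIV :: nat set). if n = 0 then A else B)"
    by (rule small_UN[OF small_nat]) (simp add: assms)
  then show ?thesis
    by (rule small_subset[rotated]) (auto split: if_splits)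
qed

text \<open>Length by length, lists are iterated products; there are only countably many lengths.\<close>

lemma small_lists:
  assumes "small mem A"
  shows "small mem {xs. set xs \<subseteq> A}"
proof -
  have "small mem {xs. length xs = n \<and> set xs \<subseteq> A}" for n
  proof (induction n)
    case 0
    show ?case
      by (rule small_subset[OF _ small_singleton[of "[]"]]) auto
  next
    case (Suc n)
    have "{xs. length xs = Suc n \<and> set xs \<subseteq> A} \<subseteq>
          (\<lambda>(x, xs). x # xs) ` (A \<times> {xs. length xs = n \<and> set xs \<subseteq> A})"
      by (force simp: length_Suc_conv)
    then show ?case
      by (rule small_subset[OF _ small_image[OF small_Sigma[OF assms Suc]]])
  qed
  then have "small mem (\<Union>n\<in>UNIV. {xs. length xs = n \<and> set xs \<subseteq> A})"
    by (intro small_UN small_nat)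
  then show ?thesis
    by (rule small_subset[rotated]) auto
qed

lemma small_PiE:
  assumes "small mem A" "small mem B"
  shows "small mem (A \<rightarrow>\<^sub>E B)"
proof (rule small_inj_on)
  show "inj_on (\<lambda>f. (\<lambda>x. (x, f x)) ` A) (A \<rightarrow>\<^sub>E B)"
    by (intro inj_onI PiE_ext[of _ A "\<lambda>_. B"]) auto
  show "(\<lambda>f. (\<lambda>x. (x, f x)) ` A) ` (A \<rightarrow>\<^sub>E B) \<subseteq> Pow (A \<times> B)"
    by auto
  show "small mem (Pow (A \<times> B))"
    by (intro small_Pow small_Sigma assms)
qed

lemma class_sized_inj_on:
  assumes "inj_on f A" "f ` A \<subseteq> B" "class_sized mem B"
  shows "class_sized mem A"
  using assms unfolding class_sized_def by (meson comp_inj_on inj_on_subset)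

lemma small_imp_class_sized: "small mem A \<Longrightarrow> class_sized mem A"
  unfolding small_def class_sized_def bij_betw_def by blast

lemma class_sized_Sigma:
  assumes "class_sized mem X" "\<And>x. x \<in> X \<Longrightarrow> class_sized mem (Y x)"
  shows "class_sized mem (Sigma X Y)"
proof -
  obtain h :: "_ \<Rightarrow> 'u" where h: "inj_on h X"
    using assms(1) unfolding class_sized_def by blast
  obtain p :: "'u \<Rightarrow> 'u \<Rightarrow> 'u" where p: "\<And>a b c d. p a b = p c d \<Longrightarrow> a = c \<and> b = d"
    using ex_pairing by blast
  have "\<forall>x \<in> X. \<exists>g :: _ \<Rightarrow> 'u. inj_on g (Y x)"
    using assms(2) unfolding class_sized_def by blast
  then obtain g :: "_ \<Rightarrow> _ \<Rightarrow> 'u" where g: "\<And>x. x \<in> X \<Longrightarrow> inj_on (g x) (Y x)"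
    by metis
  have "inj_on (\<lambda>(x, y). p (h x) (g x y)) (Sigma X Y)"
    by (rule inj_on_Sigma_pairing[of p, OF p h g])
  then show ?thesis
    unfolding class_sized_def by blast
qed

end

section \<open>Zero arrows, kernels and cokernels\<close>

locale cat =
  fixes C :: "('o, 'a) category" (structure)
  assumes category: "is_category C"
begin

lemma dom_in_Obj [simp]: "f \<in> Arr C \<Longrightarrow> Dom C f \<in> Obj C"
  and cod_in_Obj [simp]: "f \<in> Arr C \<Longrightarrow> Cod C f \<in> Obj C"
  using category unfolding is_category_def by auto

lemma ide_simps [simp]:
  assumes "x \<in> Obj C"
  shows "Ide C x \<in> Arr C" "Dom C (Ide C x) = x" "Cod C (Ide C x) = x"
  using category assms unfolding is_category_def Hom_def by auto

lemma comp_simps [simp]: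
  assumes "f \<in> Arr C" "g \<in> Arr C" "Cod C f = Dom C g"
  shows "g \<cdot> f \<in> Arr C" "Dom C (g \<cdot> f) = Dom C f" "Cod C (g \<cdot> f) = Cod C g"
proof -
  have "\<forall>x \<in> Obj C. \<forall>y \<in> Obj C. \<forall>z \<in> Obj C. \<forall>f \<in> Hom C x y. \<forall>g \<in> Hom C y z. g \<cdot> f \<in> Hom C x z"
    using category unfolding is_category_def by (elim conjE) assumption
  moreover have "f \<in> Hom C (Dom C f) (Dom C g)" "g \<in> Hom C (Dom C g) (Cod C g)"
    using assms by (auto simp: Hom_def)
  ultimately have "g \<cdot> f \<in> Hom C (Dom C f) (Cod C g)"
    using assms dom_in_Obj cod_in_Obj by blast
  then show "g \<cdot> f \<in> Arr C" "Dom C (g \<cdot> f) = Dom C f" "Cod C (g \<cdot> f) = Cod C g"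
    by (auto simp: Hom_def)
qed

lemma comp_ide [simp]:
  assumes "f \<in> Arr C"
  shows "Dom C f = x \<Longrightarrow> f \<cdot> Ide C x = f" "Cod C f = y \<Longrightarrow> Ide C y \<cdot> f = f"
  using category assms unfolding is_category_def by auto

lemma comp_assoc:
  assumes "f \<in> Arr C" "g \<in> Arr C" "h \<in> Arr C" "Cod C f = Dom C g" "Cod C g = Dom C h"
  shows "(h \<cdot> g) \<cdot> f = h \<cdot> (g \<cdot> f)"
  using category assms unfolding is_category_def by simp

lemma zero_arrowI:
  assumes "is_zero_object C z" "u \<in> Hom C x z" "v \<in> Hom C z y"
  shows "is_zero_arrow C (v \<cdot> u)"
proof -
  have "v \<cdot> u \<in> Hom C x y"
    using assms(2,3) by (auto simp: Hom_def)
  then show ?thesis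
    unfolding is_zero_arrow_def using assms by (auto simp: Hom_def)
qed

lemma zero_arrowE:
  assumes "is_zero_arrow C f"
  obtains z u v where "is_zero_object C z" "u \<in> Arr C" "v \<in> Arr C" "Cod C u = z" "Dom C v = z"
    "f = v \<cdot> u"
  using assms unfolding is_zero_arrow_def Hom_def by blast

lemma zero_comp:
  assumes "is_zero_arrow C f" "g \<in> Arr C" "Cod C f = Dom C g"
  shows "is_zero_arrow C (g \<cdot> f)"
proof -
  from assms(1) obtain z u v where z: "is_zero_object C z" and uv: "u \<in> Arr C" "v \<in> Arr C"
    "Cod C u = z" "Dom C v = z" and f: "f = v \<cdot> u"
    by (rule zero_arrowE)
  have "Cod C v = Dom C g"
    using assms(3) uv by (simp add: f)
  then have "is_zero_arrow C ((g \<cdot> v) \<cdot> u)"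
    using uv assms(2) by (intro zero_arrowI[OF z, of _ "Dom C u" _ "Cod C g"]) (auto simp: Hom_def)
  then show ?thesis
    using uv assms(2) \<open>Cod C v = Dom C g\<close> by (simp add: f comp_assoc)
qed

lemma comp_zero:
  assumes "is_zero_arrow C f" "g \<in> Arr C" "Dom C f = Cod C g"
  shows "is_zero_arrow C (f \<cdot> g)"
proof -
  from assms(1) obtain z u v where z: "is_zero_object C z" and uv: "u \<in> Arr C" "v \<in> Arr C"
    "Cod C u = z" "Dom C v = z" and f: "f = v \<cdot> u"
    by (rule zero_arrowE)
  have "Dom C u = Cod C g"
    using assms(3) uv by (simp add: f)
  then have "is_zero_arrow C (v \<cdot> (u \<cdot> g))"
    using uv assms(2) by (intro zero_arrowI[OF z, of _ "Dom C g" _ "Cod C v"]) (auto simp: Hom_def)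
  then show ?thesis
    using uv assms(2) \<open>Dom C u = Cod C g\<close> by (simp add: f comp_assoc)
qed

text \<open>The two arrows may factor through different zero objects; the arrow between these identifies
  the factorizations.\<close>

lemma zero_arrow_unique:
  assumes "is_zero_arrow C f" "is_zero_arrow C g" "Dom C f = Dom C g" "Cod C f = Cod C g"
  shows "f = g"
proof -
  from assms(1) obtain z u v where z: "is_zero_object C z" and uv: "u \<in> Arr C" "v \<in> Arr C"
    "Cod C u = z" "Dom C v = z" and f: "f = v \<cdot> u"
    by (rule zero_arrowE)
  from assms(2) obtain z' u' v' where z': "is_zero_object C z'" and uv': "u' \<in> Arr C" "v' \<in> Arr C"
    "Cod C u' = z'" "Dom C v' = z'" and g: "g = v' \<cdot> u'"
    by (rule zero_arrowE)
  have ends: "Dom C u = Dom C u'" "Cod C v = Cod C v'"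
    using assms(3,4) uv uv' by (simp_all add: f g)
  have "z' \<in> Obj C"
    using z' by (simp add: is_zero_object_def is_initial_def)
  then obtain t where "t \<in> Hom C z z'"
    using z unfolding is_zero_object_def is_initial_def by blast
  then have t: "t \<in> Arr C" "Dom C t = z" "Cod C t = z'"
    by (auto simp: Hom_def)
  have "\<exists>!w. w \<in> Hom C (Dom C u) z'"
    using z' uv unfolding is_zero_object_def is_terminal_def by simp
  moreover have "t \<cdot> u \<in> Hom C (Dom C u) z'" "u' \<in> Hom C (Dom C u) z'"
    using t uv uv' ends by (auto simp: Hom_def)
  ultimately have 1: "t \<cdot> u = u'"
    by blast
  have "\<exists>!w. w \<in> Hom C z (Cod C v)"
    using z uv unfolding is_zero_object_def is_initial_def by simp
  moreover have "v' \<cdot> t \<in> Hom C z (Cod C v)" "v \<in> Hom C z (Cod C v)"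
    using t uv uv' ends by (auto simp: Hom_def)
  ultimately have 2: "v' \<cdot> t = v"
    by blast
  show ?thesis
    using comp_assoc[of u t v'] t uv uv' by (simp add: f g 1 2)
qed

lemma ex_zero_arrow:
  assumes "pointed C" "x \<in> Obj C" "y \<in> Obj C"
  shows "\<exists>f \<in> Hom C x y. is_zero_arrow C f"
proof -
  obtain z u v where z: "is_zero_object C z" "u \<in> Hom C x z" "v \<in> Hom C z y"
    using assms unfolding pointed_def is_zero_object_def is_initial_def is_terminal_def by blast
  then have "v \<cdot> u \<in> Hom C x y"
    by (auto simp: Hom_def)
  then show ?thesis
    using zero_arrowI[OF z] by blast
qed

lemma kernel_cancel:
  assumes "is_kernel C k f" "u \<in> Arr C" "v \<in> Arr C" "Cod C u = Dom C k" "Cod C v = Dom C k"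
    "Dom C u = Dom C v" "k \<cdot> u = k \<cdot> v"
  shows "u = v"
proof -
  have k: "k \<in> Arr C" "f \<in> Arr C" "Cod C k = Dom C f" "is_zero_arrow C (f \<cdot> k)"
    using assms(1) by (auto simp: is_kernel_def)
  have "is_zero_arrow C (f \<cdot> (k \<cdot> u))"
    using zero_comp[of "f \<cdot> k"] comp_zero[OF k(4), of u] assms k by (simp add: comp_assoc)
  moreover have "k \<cdot> u \<in> Arr C" "Cod C (k \<cdot> u) = Dom C f" "Dom C (k \<cdot> u) = Dom C u"
    using assms k by auto
  ultimately have "\<exists>!w. w \<in> Hom C (Dom C u) (Dom C k) \<and> k \<cdot> w = k \<cdot> u"
    using assms(1) unfolding is_kernel_def by metis
  then show ?thesis
    using assms(2-7) by (auto simp: Hom_def)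
qed

text \<open>If \<open>e\<close> is a cokernel of \<open>g\<close>, then \<open>g\<close> factors through the kernel \<open>k\<close> of \<open>e\<close>, so whatever
  annihilates \<open>k\<close> annihilates \<open>g\<close>.\<close>

lemma short_exact_if_normal_epi:
  assumes "normal_epi C e" "is_kernel C k e"
  shows "short_exact C k e"
proof -
  obtain g where g: "is_cokernel C e g"
    using assms(1) by (auto simp: normal_epi_def)
  have gA: "g \<in> Arr C" "e \<in> Arr C" "Dom C e = Cod C g" "is_zero_arrow C (e \<cdot> g)"
    using g by (auto simp: is_cokernel_def)
  have kA: "k \<in> Arr C" "Cod C k = Dom C e" "is_zero_arrow C (e \<cdot> k)"
    using assms(2) by (auto simp: is_kernel_def)
  obtain u where u: "u \<in> Hom C (Dom C g) (Dom C k)" "k \<cdot> u = g"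
    using assms(2) gA unfolding is_kernel_def by metis
  have "\<exists>!v. v \<in> Hom C (Cod C e) (Cod C h) \<and> v \<cdot> e = h"
    if h: "h \<in> Arr C" "Dom C h = Cod C k" "is_zero_arrow C (h \<cdot> k)" for h
  proof -
    have "h \<cdot> g = (h \<cdot> k) \<cdot> u"
      using u h kA by (auto simp: Hom_def comp_assoc)
    then have "is_zero_arrow C (h \<cdot> g)"
      using comp_zero[OF h(3), of u] u h kA by (auto simp: Hom_def)
    then show ?thesis
      using g h kA gA unfolding is_cokernel_def by metis
  qed
  then have "is_cokernel C e k"
    using gA kA unfolding is_cokernel_def by (intro conjI ballI impI) simp_all
  then show ?thesis
    using assms(2) by (simp add: short_exact_def)
qed

text \<open>An arrow into the pullback that is annihilated by \<open>s\<close> is given by its other component alone, and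
  that component is annihilated by \<open>e\<close>. So \<open>e\<close> and \<open>s\<close> have the same kernel object.\<close>

lemma pullback_kernel:
  assumes "pointed C" "is_pullback C e w r s" "is_kernel C k e"
  shows "\<exists>k'. is_kernel C k' s \<and> Dom C k' = Dom C k \<and> r \<cdot> k' = k"
proof -
  have A: "e \<in> Arr C" "w \<in> Arr C" "r \<in> Arr C" "s \<in> Arr C" "Cod C e = Cod C w"
    "Dom C r = Dom C s" "Cod C r = Dom C e" "Cod C s = Dom C w" "e \<cdot> r = w \<cdot> s"
    using assms(2) by (auto simp: is_pullback_def)
  have univ: "\<exists>!u. u \<in> Hom C x (Dom C r) \<and> r \<cdot> u = a \<and> s \<cdot> u = b"
    if "x \<in> Obj C" "a \<in> Hom C x (Dom C e)" "b \<in> Hom C x (Dom C w)" "e \<cdot> a = w \<cdot> b" for x a b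
    using assms(2) that unfolding is_pullback_def by metis
  have k: "k \<in> Arr C" "Cod C k = Dom C e" "is_zero_arrow C (e \<cdot> k)"
    using assms(3) by (auto simp: is_kernel_def)
  obtain o' where o: "o' \<in> Hom C (Dom C k) (Dom C w)" "is_zero_arrow C o'"
    using ex_zero_arrow[OF assms(1), of "Dom C k" "Dom C w"] k A by auto
  have oA: "o' \<in> Arr C" "Dom C o' = Dom C k" "Cod C o' = Dom C w"
    using o by (auto simp: Hom_def)
  have "e \<cdot> k = w \<cdot> o'"
    using zero_arrow_unique[OF k(3) zero_comp[OF o(2), of w]] k A oA by auto
  then obtain u where u: "u \<in> Hom C (Dom C k) (Dom C r)" "r \<cdot> u = k" "s \<cdot> u = o'"
    using univ[of "Dom C k" k o'] k A oA by (auto simp: Hom_def)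
  have uA: "u \<in> Arr C" "Dom C u = Dom C k" "Cod C u = Dom C r"
    using u by (auto simp: Hom_def)
  have "\<exists>!v. v \<in> Hom C (Dom C h) (Dom C u) \<and> u \<cdot> v = h"
    if h: "h \<in> Arr C" "Cod C h = Dom C s" "is_zero_arrow C (s \<cdot> h)" for h
  proof -
    have "e \<cdot> (r \<cdot> h) = w \<cdot> (s \<cdot> h)"
      using h A comp_assoc by metis
    then have "is_zero_arrow C (e \<cdot> (r \<cdot> h))"
      using zero_comp[OF h(3), of w] h A by simp
    then obtain v where v: "v \<in> Hom C (Dom C h) (Dom C k)" "k \<cdot> v = r \<cdot> h"
      using assms(3) h A unfolding is_kernel_def by (metis comp_simps)
    have vA: "v \<in> Arr C" "Dom C v = Dom C h" "Cod C v = Dom C k"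
      using v by (auto simp: Hom_def)
    have r_eq: "r \<cdot> (u \<cdot> v) = r \<cdot> h"
      using u(2) v(2) comp_assoc[of v u r] vA uA A by simp
    have "s \<cdot> (u \<cdot> v) = o' \<cdot> v"
      using u(3) comp_assoc[of v u s] vA uA A by simp
    then have s_eq: "s \<cdot> (u \<cdot> v) = s \<cdot> h"
      using zero_arrow_unique[OF comp_zero[OF o(2), of v] h(3)] vA oA h A by simp
    have "e \<cdot> (r \<cdot> h) = w \<cdot> (s \<cdot> h)" "r \<cdot> h \<in> Hom C (Dom C h) (Dom C e)"
      "s \<cdot> h \<in> Hom C (Dom C h) (Dom C w)"
      using comp_assoc[of h r e] comp_assoc[of h s w] h A by (auto simp: Hom_def)
    from univ[OF _ this(2,3,1)]
    have "\<exists>!x. x \<in> Hom C (Dom C h) (Dom C r) \<and> r \<cdot> x = r \<cdot> h \<and> s \<cdot> x = s \<cdot> h"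
      using h by simp
    moreover have "u \<cdot> v \<in> Hom C (Dom C h) (Dom C r)" "h \<in> Hom C (Dom C h) (Dom C r)"
      using h A uA vA by (auto simp: Hom_def)
    ultimately have hv: "u \<cdot> v = h"
      using r_eq s_eq by blast
    have un: "v' = v" if "v' \<in> Hom C (Dom C h) (Dom C u)" "u \<cdot> v' = h" for v'
    proof -
      have v': "v' \<in> Arr C" "Dom C v' = Dom C h" "Cod C v' = Dom C k"
        using that(1) uA by (auto simp: Hom_def)
      have "k \<cdot> v' = k \<cdot> v"
        using comp_assoc[of v' u r] that(2) u(2) v(2) v' uA A by simp
      then show ?thesis
        using kernel_cancel[OF assms(3)] v' vA by simp
    qed
    show ?thesis
    proof (rule ex1I[of _ v])
      show "v \<in> Hom C (Dom C h) (Dom C u) \<and> u \<cdot> v = h"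
        using v(1) uA(2) hv by simp
    qed (use un in blast)
  qed
  moreover have "is_zero_arrow C (s \<cdot> u)"
    using o u by simp
  ultimately have "is_kernel C u s"
    using uA A unfolding is_kernel_def by (intro conjI ballI impI) simp_all
  then show ?thesis
    using u uA by blast
qed

lemma normal_mono_ide:
  assumes "pointed C" "x \<in> Obj C"
  shows "normal_mono C (Ide C x)"
proof -
  obtain f where f: "f \<in> Hom C x x" "is_zero_arrow C f"
    using ex_zero_arrow[OF assms assms(2)] by blast
  then have "is_kernel C (Ide C x) f"
    using assms unfolding is_kernel_def Hom_def by (auto intro!: ex1I)
  then show ?thesis
    by (auto simp: normal_mono_def)
qed

end

section \<open>Splicing with a fixed short exact sequence\<close>

lemma Ext_category_simps:
  "Obj (Ext_category C n Q K) = {f. exact_sequence C n Q K f}"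
  by (simp add: Ext_category_def)

lemma exact_sequenceD:
  assumes "exact_sequence C n Q K f"
  shows "f \<in> {1..n+1} \<rightarrow>\<^sub>E Arr C" "Dom C (f (n+1)) = K" "Cod C (f 1) = Q"
    and "\<And>i. i \<in> {1..n} \<Longrightarrow> Cod C (f (i+1)) = Dom C (f i)"
    and "\<And>i. i \<in> {1..n+1} \<Longrightarrow> f i \<in> Arr C"
proof -
  show "f \<in> {1..n+1} \<rightarrow>\<^sub>E Arr C" "Dom C (f (n+1)) = K" "Cod C (f 1) = Q"
    using assms unfolding exact_sequence_def by blast+
  then show "f i \<in> Arr C" if "i \<in> {1..n+1}" for i
    using that by auto
  show "Cod C (f (i+1)) = Dom C (f i)" if "i \<in> {1..n}" for i
  proof -
    have "\<forall>i \<in> {1..n}. Cod C (f (i+1)) = Dom C (f i)"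
      using assms unfolding exact_sequence_def by (elim conjE) assumption
    then show ?thesis
      using that by blast
  qed
qed

lemma exact_sequenceI:
  assumes "f \<in> {1..n+1} \<rightarrow>\<^sub>E Arr C" "Dom C (f (n+1)) = K" "Cod C (f 1) = Q"
    and "\<And>i. i \<in> {1..n} \<Longrightarrow> Cod C (f (i+1)) = Dom C (f i)"
    and "\<And>i. i \<in> {1..n+1} \<Longrightarrow> normal_epi C (e i) \<and> normal_mono C (m i) \<and>
      Cod C (e i) = Dom C (m i) \<and> f i = m i \<cdot>\<^bsub>C\<^esub> e i"
    and "e (n+1) = Ide C K" "m 1 = Ide C Q"
    and "\<And>i. i \<in> {1..n} \<Longrightarrow> short_exact C (m (i+1)) (e i)"
  shows "exact_sequence C n Q K f"
proof -
  have "\<forall>i \<in> {1..n+1}. normal_epi C (e i) \<and> normal_mono C (m i) \<and>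
      Cod C (e i) = Dom C (m i) \<and> f i = m i \<cdot>\<^bsub>C\<^esub> e i"
    by (rule ballI) (rule assms(5))
  moreover have "\<forall>i \<in> {1..n}. short_exact C (m (i+1)) (e i)"
    by (rule ballI) (rule assms(8))
  moreover have "\<forall>i \<in> {1..n}. Cod C (f (i+1)) = Dom C (f i)"
    by (rule ballI) (rule assms(4))
  ultimately show ?thesis
    unfolding exact_sequence_def using assms(1-3,6,7) by (intro conjI exI[of _ m] exI[of _ e])
qed

definition joined :: "('o, 'a) category \<Rightarrow> nat \<Rightarrow> 'o \<Rightarrow> 'o \<Rightarrow> (nat \<Rightarrow> 'a) rel" where
  "joined C n Q K = {(f, g). exact_sequence C n Q K f \<and> exact_sequence C n Q K g \<and>
     (\<exists>\<alpha>. exact_sequence_morphism C n f g \<alpha>)}"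

lemma Ext_eq:
  "Ext C n Q K = {f. exact_sequence C n Q K f} // (joined C n Q K \<union> (joined C n Q K)\<inverse>)\<^sup>*"
proof -
  have "{(Dom (Ext_category C n Q K) a, Cod (Ext_category C n Q K) a) | a.
          a \<in> Arr (Ext_category C n Q K)} = joined C n Q K"
    by (force simp: Ext_category_def joined_def)
  then show ?thesis
    by (simp only: Ext_def pi0_def Let_def Ext_category_simps)
qed

abbreviation connected :: "('o, 'a) category \<Rightarrow> nat \<Rightarrow> 'o \<Rightarrow> 'o \<Rightarrow> (nat \<Rightarrow> 'a) rel" where
  "connected C n Q K \<equiv> (joined C n Q K \<union> (joined C n Q K)\<inverse>)\<^sup>*"

lemma equiv_connected: "equiv UNIV (connected C n Q K)"
proof (rule equivI)
  show "sym (connected C n Q K)"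
    by (intro sym_rtrancl sym_Un_converse)
qed (auto intro: refl_rtrancl trans_rtrancl)

text \<open>A choice of one sequence for each value of the invariant \<open>\<phi>\<close> presents the components as an image
  of the values.\<close>

lemma (in universe) small_Ext_if_invariant:
  assumes "small mem X" "\<And>f. exact_sequence C n Q K f \<Longrightarrow> \<phi> f \<in> X"
    and sep: "\<And>f g. exact_sequence C n Q K f \<Longrightarrow> exact_sequence C n Q K g \<Longrightarrow> \<phi> f = \<phi> g \<Longrightarrow>
      (f, g) \<in> connected C n Q K"
  shows "small mem (Ext C n Q K)"
proof -
  let ?O = "{f. exact_sequence C n Q K f}"
  let ?c = "\<lambda>f. connected C n Q K `` {f}"
  have same: "?c f = ?c g" if "f \<in> ?O" "g \<in> ?O" "\<phi> f = \<phi> g" for f g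
    by (rule equiv_class_eq[OF equiv_connected sep]) (use that in auto)
  have "?c f = ?c (inv_into ?O \<phi> (\<phi> f))" if "f \<in> ?O" for f
  proof (rule same)
    have "\<phi> f \<in> \<phi> ` ?O"
      using that by blast
    then show "inv_into ?O \<phi> (\<phi> f) \<in> ?O" "\<phi> f = \<phi> (inv_into ?O \<phi> (\<phi> f))"
      by (rule inv_into_into, simp only: f_inv_into_f)
  qed (rule that)
  then have "Ext C n Q K \<subseteq> (\<lambda>x. ?c (inv_into ?O \<phi> x)) ` X"
    using assms(2) unfolding Ext_eq by (auto elim!: quotientE)
  then show ?thesis
    by (rule small_subset[OF _ small_image[OF assms(1)]])
qed

text \<open>Positions are counted from the end \<open>Q\<close>: the arrow \<open>p\<close> takes position 1 and the arrows of \<open>f\<close>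
  move up by one, the one that ends in \<open>\<Omega>\<close> being continued along \<open>i\<close>.\<close>

definition yoneda_splice :: "('o, 'a) category \<Rightarrow> nat \<Rightarrow> 'a \<Rightarrow> 'a \<Rightarrow> (nat \<Rightarrow> 'a) \<Rightarrow> nat \<Rightarrow> 'a" where
  "yoneda_splice C n i p f = (\<lambda>j \<in> {1..n+2}. if j = 1 then p else if j = 2 then i \<cdot>\<^bsub>C\<^esub> f 1 else f (j - 1))"

context cat
begin

lemma yoneda_splice_exact:
  assumes "pointed C" "n \<ge> 1" "exact_sequence C n \<Omega> K f" "short_exact C i p"
    "Dom C i = \<Omega>" "Cod C p = Q"
  shows "exact_sequence C (Suc n) Q K (yoneda_splice C n i p f)"
proof -
  obtain m e where me:
    "\<And>j. j \<in> {1..n+1} \<Longrightarrow> normal_epi C (e j) \<and> normal_mono C (m j) \<and> Cod C (e j) = Dom C (m j) \<and>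
       f j = m j \<cdot> e j"
    "e (n+1) = Ide C K" "m 1 = Ide C \<Omega>" "\<And>j. j \<in> {1..n} \<Longrightarrow> short_exact C (m (j+1)) (e j)"
    using assms(3) unfolding exact_sequence_def by blast
  have f: "f \<in> {1..n+1} \<rightarrow>\<^sub>E Arr C" "Dom C (f (n+1)) = K" "Cod C (f 1) = \<Omega>"
    "\<And>j. j \<in> {1..n} \<Longrightarrow> Cod C (f (j+1)) = Dom C (f j)"
    using exact_sequenceD[OF assms(3)] by simp_all
  note fA = exact_sequenceD(5)[OF assms(3)]
  have ip: "i \<in> Arr C" "p \<in> Arr C" "Cod C i = Dom C p" "normal_mono C i" "normal_epi C p"
    using assms(4) by (auto simp: short_exact_def is_kernel_def normal_mono_def normal_epi_def)
  have Q: "Q \<in> Obj C" "\<Omega> \<in> Obj C"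
    using ip assms(5,6) by auto
  let ?F = "yoneda_splice C n i p f"
  define m' where "m' j = (if j = 1 then Ide C Q else if j = 2 then i else m (j - 1))" for j
  define e' where "e' j = (if j = 1 then p else e (j - 1))" for j
  have e1: "e 1 \<in> Arr C" "f 1 = e 1"
  proof -
    show "e 1 \<in> Arr C"
      using me(1)[of 1] by (auto simp: normal_epi_def is_cokernel_def)
    then show "f 1 = e 1"
      using me(1)[of 1] me(3) Q by auto
  qed
  have facts: "normal_epi C (e' j) \<and> normal_mono C (m' j) \<and> Cod C (e' j) = Dom C (m' j) \<and>
      ?F j = m' j \<cdot> e' j" if jn: "j \<in> {1..n+2}" for j
  proof -
    consider "j = 1" | "j = 2" | "j \<ge> 3"
      using jn unfolding atLeastAtMost_iff by linarith
    then show ?thesis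
    proof cases
      case 1
      then show ?thesis
        using ip assms(6) Q normal_mono_ide[OF assms(1)] by (simp add: m'_def e'_def yoneda_splice_def)
    next
      case 2
      then show ?thesis
        using ip me(1)[of 1] me(3) e1 assms(5) Q f(3) by (simp add: m'_def e'_def yoneda_splice_def)
    next
      case 3
      then have "j - 1 \<in> {1..n+1}"
        using that by auto
      then show ?thesis
        using me(1)[of "j - 1"] 3 that by (simp add: m'_def e'_def yoneda_splice_def)
    qed
  qed
  have exact: "short_exact C (m' (j+1)) (e' j)" if jn: "j \<in> {1..n+1}" for j
  proof (cases "j = 1")
    case True
    then show ?thesis
      using assms(4) by (simp add: m'_def e'_def)
  next
    case False
    then obtain k where "j = Suc k" "k \<in> {1..n}"
      using jn by (cases j) auto
    then show ?thesis
      using me(4)[of k] by (simp add: m'_def e'_def)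
  qed
  have cod: "Cod C (?F (j+1)) = Dom C (?F j)" if jn: "j \<in> {1..n+1}" for j
  proof -
    consider "j = 1" | "j = 2" | "j \<ge> 3"
      using jn unfolding atLeastAtMost_iff by linarith
    then show ?thesis
    proof cases
      case 1
      then show ?thesis
        using ip f(3) fA[of 1] assms by (simp add: yoneda_splice_def)
    next
      case 2
      then show ?thesis
        using ip f(3) f(4)[of 1] fA[of 1] assms jn by (simp add: yoneda_splice_def numeral_2_eq_2)
    next
      case 3
      then obtain k where "j = Suc k" "k \<in> {2..n}"
        using jn by (cases j) auto
      then show ?thesis
        using f(4)[of k] by (simp add: yoneda_splice_def)
    qed
  qed
  have "f (j - 1) \<in> Arr C" if "j \<in> {1..n+2}" "j \<noteq> 1" for j
    by (rule fA) (use that in auto)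
  then have arr: "?F \<in> {1..n+2} \<rightarrow>\<^sub>E Arr C"
    using ip f(3) fA assms(5) by (auto simp: yoneda_splice_def)
  have ends: "Dom C (?F (n+2)) = K" "Cod C (?F 1) = Q"
    using f(2) assms(2,6) by (auto simp: yoneda_splice_def)
  have "e' (n+2) = Ide C K" "m' 1 = Ide C Q"
    using me(2) by (auto simp: e'_def m'_def)
  then show ?thesis
    using facts exact cod arr ends by (intro exact_sequenceI[where m = m' and e = e']) auto
qed

text \<open>A morphism of sequences is extended by the identity on the new object.\<close>

lemma yoneda_splice_joined:
  assumes "pointed C" "n \<ge> 1" "(f, g) \<in> joined C n \<Omega> K" "short_exact C i p"
    "Dom C i = \<Omega>" "Cod C p = Q"
  shows "(yoneda_splice C n i p f, yoneda_splice C n i p g) \<in> joined C (Suc n) Q K"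
proof -
  obtain \<alpha> where ex: "exact_sequence C n \<Omega> K f" "exact_sequence C n \<Omega> K g"
    and \<alpha>: "exact_sequence_morphism C n f g \<alpha>"
    using assms(3) by (auto simp: joined_def)
  have f: "f j \<in> Arr C" "g j \<in> Arr C" if "j \<in> {1..n+1}" for j
    using exact_sequenceD(5)[OF ex(1)] exact_sequenceD(5)[OF ex(2)] that by simp_all
  have f1: "Cod C (f 1) = \<Omega>" "Cod C (g 1) = \<Omega>"
    using exact_sequenceD(3)[OF ex(1)] exact_sequenceD(3)[OF ex(2)] by simp_all
  have \<alpha>A: "\<alpha> j \<in> Arr C" "Dom C (\<alpha> j) = Dom C (f j)" "Cod C (\<alpha> j) = Dom C (g j)" if "j \<in> {1..n}" for j
    using \<alpha> that unfolding exact_sequence_morphism_def Hom_def by auto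
  have \<alpha>c: "\<alpha> n \<cdot> f (n+1) = g (n+1)" "g 1 \<cdot> \<alpha> 1 = f 1"
    "\<And>j. j \<in> {1..<n} \<Longrightarrow> \<alpha> j \<cdot> f (j+1) = g (j+1) \<cdot> \<alpha> (j+1)"
    using \<alpha> unfolding exact_sequence_morphism_def by auto
  have ip: "i \<in> Arr C" "p \<in> Arr C" "Cod C i = Dom C p"
    using assms(4) by (auto simp: short_exact_def is_kernel_def)
  let ?F = "yoneda_splice C n i p f" and ?G = "yoneda_splice C n i p g"
  define \<beta> where "\<beta> = (\<lambda>j \<in> {1..n+1}. if j = 1 then Ide C (Dom C p) else \<alpha> (j - 1))"
  have "\<beta> j \<in> Hom C (Dom C (?F j)) (Dom C (?G j))" if jn: "j \<in> {1..n+1}" for j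
  proof -
    consider "j = 1" | "j = 2" | "j \<ge> 3"
      using jn unfolding atLeastAtMost_iff by linarith
    then show ?thesis
    proof cases
      case 3
      then obtain k where "j = Suc k" "k \<in> {2..n}"
        using jn by (cases j) auto
      then show ?thesis
        using \<alpha>A[of k] by (simp add: \<beta>_def yoneda_splice_def Hom_def)
    qed (use jn ip f[of 1] f1 \<alpha>A[of 1] assms in \<open>simp_all add: \<beta>_def yoneda_splice_def Hom_def\<close>)
  qed
  moreover have "\<beta> j \<cdot> ?F (j+1) = ?G (j+1) \<cdot> \<beta> (j+1)" if jn: "j \<in> {1..<n+1}" for j
  proof (cases "j = 1")
    case True
    then show ?thesis
      using jn ip f[of 1] f1 \<alpha>A[of 1] \<alpha>c(2) assms by (simp add: \<beta>_def yoneda_splice_def comp_assoc)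
  next
    case False
    then obtain k where "j = Suc k" "k \<in> {1..<n}"
      using jn by (cases j) auto
    then show ?thesis
      using \<alpha>c(3)[of k] by (simp add: \<beta>_def yoneda_splice_def)
  qed
  ultimately have "exact_sequence_morphism C (Suc n) ?F ?G \<beta>"
    unfolding exact_sequence_morphism_def using \<alpha>c(1) ip assms(2)
    by (auto simp: \<beta>_def yoneda_splice_def restrict_PiE_iff PiE_iff)
  then show ?thesis
    using yoneda_splice_exact[OF assms(1,2) _ assms(4-6)] ex by (auto simp: joined_def)
qed

lemma yoneda_splice_connected:
  assumes "pointed C" "n \<ge> 1" "short_exact C i p" "Dom C i = \<Omega>" "Cod C p = Q"
    "(f, g) \<in> connected C n \<Omega> K"
  shows "(yoneda_splice C n i p f, yoneda_splice C n i p g) \<in> connected C (Suc n) Q K"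
  using assms(6)
proof (induction rule: rtrancl_induct)
  case base
  show ?case by simp
next
  case (step g h)
  then have "(yoneda_splice C n i p g, yoneda_splice C n i p h) \<in> joined C (Suc n) Q K \<union> (joined C (Suc n) Q K)\<inverse>"
    using yoneda_splice_joined[OF assms(1,2) _ assms(3-5)] by auto
  with step.IH show ?case
    by (rule rtrancl_into_rtrancl)
qed

text \<open>A normal-projective cover \<open>p : P \<rightarrow> Q\<close> lifts through the last arrow of a
  given sequence; the lift restricts to an arrow \<open>\<omega>\<close> from the kernel of \<open>p\<close> to the first syzygy of
  the sequence. Pulling the rest of the sequence back along \<open>\<omega>\<close> replaces the object in position 2
  and keeps those in later positions. The result is spliced with \<open>p\<close>, and the lift, the
  projection of the pullback and identities form the morphism to the given sequence.\<close>

lemma joined_with_splice: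
  assumes "pointed C" "pullback_stable_normal_epis C" "n \<ge> 1"
    and g: "exact_sequence C (Suc n) Q K g"
    and p: "normal_projective C P" "p \<in> Hom C P Q" "short_exact C i p"
  shows "\<exists>f. exact_sequence C n (Dom C i) K f \<and> (yoneda_splice C n i p f, g) \<in> joined C (Suc n) Q K"
proof -
  obtain m e where me0:
    "\<And>j. j \<in> {1..Suc n+1} \<Longrightarrow> normal_epi C (e j) \<and> normal_mono C (m j) \<and> Cod C (e j) = Dom C (m j) \<and>
       g j = m j \<cdot> e j"
    "e (Suc n+1) = Ide C K" "m 1 = Ide C Q" "\<And>j. j \<in> {1..Suc n} \<Longrightarrow> short_exact C (m (j+1)) (e j)"
    using g unfolding exact_sequence_def by blast
  then have me:
    "\<And>j. j \<in> {1..n+2} \<Longrightarrow> normal_epi C (e j) \<and> normal_mono C (m j) \<and> Cod C (e j) = Dom C (m j) \<and>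
       g j = m j \<cdot> e j"
    "e (n+2) = Ide C K" "m 1 = Ide C Q" "\<And>j. j \<in> {1..n+1} \<Longrightarrow> short_exact C (m (j+1)) (e j)"
    by simp_all
  have gA: "g \<in> {1..n+2} \<rightarrow>\<^sub>E Arr C" "Dom C (g (n+2)) = K" "Cod C (g 1) = Q"
    "\<And>j. j \<in> {1..n+1} \<Longrightarrow> Cod C (g (j+1)) = Dom C (g j)"
    using exact_sequenceD[OF g] by simp_all
  have gArr: "g j \<in> Arr C" if "j \<in> {1..n+2}" for j
    using exact_sequenceD(5)[OF g] that by simp
  have eA: "e j \<in> Arr C" "m j \<in> Arr C" "Cod C (e j) = Dom C (m j)" "g j = m j \<cdot> e j"
    "Dom C (g j) = Dom C (e j)" "Cod C (g j) = Cod C (m j)" if "j \<in> {1..n+2}" for j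
  proof -
    show 1: "e j \<in> Arr C" "m j \<in> Arr C" "Cod C (e j) = Dom C (m j)" "g j = m j \<cdot> e j"
      using me(1)[OF that]
      by (auto simp: normal_epi_def is_cokernel_def normal_mono_def is_kernel_def)
    show "Dom C (g j) = Dom C (e j)" "Cod C (g j) = Cod C (m j)"
      using 1 by simp_all
  qed
  have ip: "i \<in> Arr C" "p \<in> Arr C" "Cod C i = Dom C p" "Dom C p = P" "Cod C p = Q"
    "is_zero_arrow C (p \<cdot> i)"
    using p by (auto simp: short_exact_def is_kernel_def Hom_def)
  have Q: "Q \<in> Obj C" "K \<in> Obj C"
    using ip gA(2) gArr[of "n+2"] by auto
  have g1: "g 1 = e 1" "Cod C (e 1) = Q"
    using eA[of 1] me(3) Q by auto
  have k2: "is_kernel C (m 2) (e 1)" and k3: "is_kernel C (m 3) (e 2)"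
    using me(4)[of 1] me(4)[of 2] assms(3) by (auto simp: short_exact_def numeral_2_eq_2 numeral_3_eq_3)
  have m2: "Cod C (m 2) = Dom C (e 1)" and m3: "Cod C (m 3) = Dom C (e 2)"
    using k2 k3 by (auto simp: is_kernel_def)
  \<comment> \<open>the lift of \<open>p\<close> and its restriction to kernels\<close>
  obtain a where a: "a \<in> Hom C P (Dom C (e 1))" "e 1 \<cdot> a = p"
  proof -
    have "normal_epi C (e 1)" "p \<in> Hom C P (Cod C (e 1))"
      using me(1)[of 1] g1(2) p(2) by simp_all
    then show ?thesis
      using p(1) that unfolding normal_projective_def by blast
  qed
  have aA: "a \<in> Arr C" "Dom C a = P" "Cod C a = Dom C (e 1)"
    using a by (auto simp: Hom_def)
  have "is_zero_arrow C (e 1 \<cdot> (a \<cdot> i))"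
    using comp_assoc[of i a "e 1"] a(2) aA ip eA[of 1] by simp
  then obtain \<omega> where \<omega>: "\<omega> \<in> Hom C (Dom C i) (Dom C (m 2))" "m 2 \<cdot> \<omega> = a \<cdot> i"
    using k2 aA ip unfolding is_kernel_def by (metis comp_simps)
  have \<omega>A: "\<omega> \<in> Arr C" "Dom C \<omega> = Dom C i" "Cod C \<omega> = Cod C (e 2)"
    using \<omega> eA[of 2] by (auto simp: Hom_def)
  have e2: "normal_epi C (e 2)"
    using me(1)[of 2] by simp
  \<comment> \<open>the pulled back sequence, with \<open>s\<close> as its last arrow and \<open>k\<close> as the kernel of \<open>s\<close>\<close>
  obtain r s where rs: "is_pullback C (e 2) \<omega> r s"
    using assms(2) e2 \<omega>A unfolding pullback_stable_normal_epis_def by metis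
  have s_epi: "normal_epi C s"
    using assms(2) e2 \<omega>A rs unfolding pullback_stable_normal_epis_def by metis
  have rsA: "r \<in> Arr C" "s \<in> Arr C" "Dom C r = Dom C s" "Cod C r = Dom C (e 2)" "Cod C s = Dom C i"
    "e 2 \<cdot> r = \<omega> \<cdot> s"
    using rs \<omega>A by (auto simp: is_pullback_def)
  obtain k where k: "is_kernel C k s" "Dom C k = Dom C (m 3)" "r \<cdot> k = m 3"
    using pullback_kernel[OF assms(1) rs k3] by blast
  have kA: "k \<in> Arr C" "Cod C k = Dom C s"
    using k(1) by (auto simp: is_kernel_def)
  define f where "f = (\<lambda>j \<in> {1..n+1}. if j = 1 then s else if j = 2 then k \<cdot> e 3 else g (j + 1))"
  define m' where "m' j = (if j = 1 then Ide C (Dom C i) else if j = 2 then k else m (j + 1))" for j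
  define e' where "e' j = (if j = 1 then s else e (j + 1))" for j
  have e3: "e 3 \<in> Arr C" "Cod C (e 3) = Dom C k" "g 3 = m 3 \<cdot> e 3" "Dom C (g 3) = Dom C (e 3)"
    using eA[of 3] assms(3) k(2) by auto
  have f_exact: "exact_sequence C n (Dom C i) K f"
  proof (rule exact_sequenceI[where m = m' and e = e'])
    show "f \<in> {1..n+1} \<rightarrow>\<^sub>E Arr C"
      using rsA kA e3 gArr by (auto simp: f_def)
    show "Dom C (f (n+1)) = K"
      using assms(3) gA(2) kA e3 by (auto simp: f_def numeral_3_eq_3 numeral_2_eq_2)
    show "Cod C (f 1) = Dom C i"
      using rsA by (simp add: f_def)
    show "Cod C (f (j+1)) = Dom C (f j)" if jn: "j \<in> {1..n}" for j
    proof -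
      consider "j = 1" | "j = 2" | "j \<ge> 3"
        using jn unfolding atLeastAtMost_iff by linarith
      then show ?thesis
        by cases (use jn rsA kA e3 gA(4)[of "j+1"] in \<open>auto simp: f_def\<close>)
    qed
    show "normal_epi C (e' j) \<and> normal_mono C (m' j) \<and> Cod C (e' j) = Dom C (m' j) \<and> f j = m' j \<cdot> e' j"
      if jn: "j \<in> {1..n+1}" for j
    proof -
      consider "j = 1" | "j = 2" | "j \<ge> 3"
        using jn unfolding atLeastAtMost_iff by linarith
      then show ?thesis
      proof cases
        case 1
        then show ?thesis
          using rsA s_epi normal_mono_ide[OF assms(1)] ip by (simp add: m'_def e'_def f_def)
      next
        case 2
        have "normal_mono C k"
          using k(1) by (auto simp: normal_mono_def)
        with 2 show ?thesis
          using me(1)[of 3] e3 jn by (simp add: m'_def e'_def f_def)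
      next
        case 3
        then show ?thesis
          using me(1)[of "j + 1"] jn by (simp add: m'_def e'_def f_def)
      qed
    qed
    show "e' (n+1) = Ide C K" "m' 1 = Ide C (Dom C i)"
      using me(2) assms(3) by (auto simp: e'_def m'_def)
    show "short_exact C (m' (j+1)) (e' j)" if jn: "j \<in> {1..n}" for j
    proof (cases "j = 1")
      case True
      then show ?thesis
        using short_exact_if_normal_epi[OF s_epi k(1)] by (simp add: m'_def e'_def)
    next
      case False
      then show ?thesis
        using jn me(4)[of "j + 1"] by (auto simp: m'_def e'_def)
    qed
  qed
  let ?F = "yoneda_splice C n i p f"
  define \<beta> where "\<beta> = (\<lambda>j \<in> {1..n+1}. if j = 1 then a else if j = 2 then r else Ide C (Dom C (g j)))"
  have "\<beta> j \<in> Hom C (Dom C (?F j)) (Dom C (g j))" if jn: "j \<in> {1..n+1}" for j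
  proof -
    consider "j = 1" | "j = 2" | "j = 3" | "j \<ge> 4"
      using jn unfolding atLeastAtMost_iff by linarith
    then show ?thesis
    proof cases
      case 4
      then obtain l where "j = Suc l" "l \<in> {3..n}"
        using jn by (cases j) auto
      then show ?thesis
        using gArr[of j] by (simp add: \<beta>_def yoneda_splice_def f_def Hom_def)
    qed (use jn aA ip rsA kA e3 eA[of 1] eA[of 2] gArr[of 3]
        in \<open>simp_all add: \<beta>_def yoneda_splice_def f_def Hom_def\<close>)
  qed
  moreover have "\<beta> j \<cdot> ?F (j+1) = g (j+1) \<cdot> \<beta> (j+1)" if jn: "j \<in> {1..<n+1}" for j
  proof -
    consider "j = 1" | "j = 2" | "j \<ge> 3"
      using jn unfolding atLeastLessThan_iff by linarith
    then show ?thesis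
    proof cases
      case 1
      have "a \<cdot> (i \<cdot> s) = (m 2 \<cdot> e 2) \<cdot> r"
        using comp_assoc[of s i a] comp_assoc[of s \<omega> "m 2"] comp_assoc[of r "e 2" "m 2"]
          aA ip rsA \<omega>A \<omega>(2) eA[of 2] by simp
      with 1 show ?thesis
        using eA(4)[of 2] assms(3) by (simp add: \<beta>_def yoneda_splice_def f_def numeral_2_eq_2)
    next
      case 2
      have "r \<cdot> (k \<cdot> e 3) = g 3"
        using comp_assoc[of "e 3" k r] k(3) e3 kA rsA by simp
      with 2 show ?thesis
        using jn gArr[of 3] by (simp add: \<beta>_def yoneda_splice_def f_def)
    next
      case 3
      then show ?thesis
        using jn gArr[of "j+1"] gA(4)[of j] by (simp add: \<beta>_def yoneda_splice_def f_def)
    qed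
  qed
  moreover have "\<beta> (n+1) \<cdot> ?F (n+2) = g (n+2)"
  proof (cases "n = 1")
    case True
    have "r \<cdot> (k \<cdot> e 3) = g 3"
      using comp_assoc[of "e 3" k r] k(3) e3 kA rsA by simp
    with True show ?thesis
      by (simp add: \<beta>_def yoneda_splice_def f_def numeral_3_eq_3 numeral_2_eq_2)
  next
    case False
    then show ?thesis
      using assms(3) gArr[of "n+2"] gA(4)[of "n+1"] by (simp add: \<beta>_def yoneda_splice_def f_def)
  qed
  moreover have "g 1 \<cdot> \<beta> 1 = ?F 1"
    using a(2) g1 by (simp add: \<beta>_def yoneda_splice_def)
  ultimately have "exact_sequence_morphism C (Suc n) ?F g \<beta>"
    unfolding exact_sequence_morphism_def by (auto simp: \<beta>_def restrict_PiE_iff PiE_iff)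
  then show ?thesis
    using f_exact yoneda_splice_exact[OF assms(1,3) f_exact p(3) refl ip(5)] g by (auto simp: joined_def)
qed

end

text \<open>The invariant of a sequence is the component of a shorter sequence whose splice maps to it. It
  separates the components because splicing respects them.\<close>

lemma (in universe) small_Ext_Suc:
  assumes "is_category C" "with_kernels_and_cokernels C" "pullback_stable_normal_epis C"
    "enough_normal_projectives C" "n \<ge> 1" "Q \<in> Obj C"
    and small: "\<And>\<Omega>. \<Omega> \<in> Obj C \<Longrightarrow> small mem (Ext C n \<Omega> K)"
  shows "small mem (Ext C (Suc n) Q K)"
proof -
  interpret cat C
    by unfold_locales (rule assms(1))
  have pt: "pointed C"
    using assms(2) by (simp add: with_kernels_and_cokernels_def)
  obtain P p where p: "p \<in> Hom C P Q" "normal_projective C P" "normal_epi C p"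
    using assms(4,6) unfolding enough_normal_projectives_def by metis
  obtain i where "is_kernel C i p"
    using assms(2) p(1) unfolding with_kernels_and_cokernels_def Hom_def by auto
  then have i: "short_exact C i p" "Dom C i \<in> Obj C"
    using short_exact_if_normal_epi[OF p(3)] by (auto simp: is_kernel_def)
  have Q: "Cod C p = Q"
    using p(1) by (simp add: Hom_def)
  have "\<forall>g. \<exists>f. exact_sequence C (Suc n) Q K g \<longrightarrow>
    exact_sequence C n (Dom C i) K f \<and> (yoneda_splice C n i p f, g) \<in> joined C (Suc n) Q K"
    using joined_with_splice[OF pt assms(3,5) _ p(2,1) i(1)] by blast
  then obtain F where F: "\<And>g. exact_sequence C (Suc n) Q K g \<Longrightarrow>
    exact_sequence C n (Dom C i) K (F g) \<and> (yoneda_splice C n i p (F g), g) \<in> joined C (Suc n) Q K"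
    by metis
  let ?c = "\<lambda>f. connected C n (Dom C i) K `` {f}"
  show ?thesis
  proof (rule small_Ext_if_invariant[where \<phi> = "\<lambda>g. ?c (F g)"])
    show "small mem (Ext C n (Dom C i) K)"
      by (rule small[OF i(2)])
    show "?c (F g) \<in> Ext C n (Dom C i) K" if "exact_sequence C (Suc n) Q K g" for g
      unfolding Ext_eq by (rule quotientI) (use F[OF that] in simp)
    show "(g, h) \<in> connected C (Suc n) Q K"
      if g: "exact_sequence C (Suc n) Q K g" and h: "exact_sequence C (Suc n) Q K h"
        and eq: "?c (F g) = ?c (F h)" for g h
    proof -
      let ?j = "joined C (Suc n) Q K" and ?s = "yoneda_splice C n i p"
      have "(F g, F h) \<in> connected C n (Dom C i) K"
        using eq by auto
      then have "(?s (F g), ?s (F h)) \<in> (?j \<union> ?j\<inverse>)\<^sup>*"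
        by (rule yoneda_splice_connected[OF pt assms(5) i(1) refl Q])
      moreover have "(g, ?s (F g)) \<in> (?j \<union> ?j\<inverse>)\<^sup>*" "(?s (F h), h) \<in> (?j \<union> ?j\<inverse>)\<^sup>*"
        using F[OF g] F[OF h] by auto
      ultimately show ?thesis
        by (meson rtrancl_trans)
    qed
  qed
qed

lemma (in universe) small_Ext:
  assumes "is_category C" "with_kernels_and_cokernels C" "pullback_stable_normal_epis C"
    "enough_normal_projectives C"
    and "\<And>Q K. Q \<in> Obj C \<Longrightarrow> K \<in> Obj C \<Longrightarrow> small mem (Ext C 1 Q K)"
    and "n \<ge> 1" "Q \<in> Obj C" "K \<in> Obj C"
  shows "small mem (Ext C n Q K)"
  using assms(6,7)
proof (induction n arbitrary: Q rule: dec_induct)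
  case base
  show ?case
    using assms(5,8) base by simp
next
  case (step n)
  show ?case
    by (rule small_Ext_Suc[OF assms(1-4)]) (use step in auto)
qed

section \<open>Terms and homomorphisms over arbitrary carriers\<close>

text \<open>The structures from which algebras are built, such as terms or sets of pairs, have elements
  outside the universe and need not satisfy the equations. So closure and preservation of
  operations are formulated for carriers of any type.\<close>

definition closed :: "'f signature \<Rightarrow> 'b set \<Rightarrow> ('f \<Rightarrow> 'b list \<Rightarrow> 'b) \<Rightarrow> bool" where
  "closed S X op \<longleftrightarrow>
     (\<forall>f \<in> ops S. \<forall>xs. length xs = arity S f \<longrightarrow> set xs \<subseteq> X \<longrightarrow> op f xs \<in> X)"

definition preserving :: "'f signature \<Rightarrow> 'b set \<Rightarrow> ('f \<Rightarrow> 'b list \<Rightarrow> 'b) \<Rightarrow>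
    'c set \<Rightarrow> ('f \<Rightarrow> 'c list \<Rightarrow> 'c) \<Rightarrow> ('b \<Rightarrow> 'c) \<Rightarrow> bool" where
  "preserving S X op Y op' h \<longleftrightarrow> h ` X \<subseteq> Y \<and>
     (\<forall>f \<in> ops S. \<forall>xs. length xs = arity S f \<longrightarrow> set xs \<subseteq> X \<longrightarrow> h (op f xs) = op' f (map h xs))"

lemma closedD: "closed S X op \<Longrightarrow> f \<in> ops S \<Longrightarrow> length xs = arity S f \<Longrightarrow> set xs \<subseteq> X \<Longrightarrow> op f xs \<in> X"
  by (simp add: closed_def)

lemma preservingD:
  assumes "preserving S X op Y op' h"
  shows "x \<in> X \<Longrightarrow> h x \<in> Y"
    and "f \<in> ops S \<Longrightarrow> length xs = arity S f \<Longrightarrow> set xs \<subseteq> X \<Longrightarrow> h (op f xs) = op' f (map h xs)"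
  using assms by (auto simp: preserving_def)

lemma preserving_comp:
  assumes "preserving S X op Y op' h" "preserving S Y op' Z op'' k"
  shows "preserving S X op Z op'' (\<lambda>x. k (h x))"
  unfolding preserving_def
proof (intro conjI ballI allI impI)
  show "(\<lambda>x. k (h x)) ` X \<subseteq> Z"
    using preservingD(1)[OF assms(1)] preservingD(1)[OF assms(2)] by blast
  fix f xs assume f: "f \<in> ops S" "length xs = arity S f" "set xs \<subseteq> X"
  have "set (map h xs) \<subseteq> Y"
    using f(3) preservingD(1)[OF assms(1)] by auto
  then have "k (op' f (map h xs)) = op'' f (map k (map h xs))"
    using f by (intro preservingD(2)[OF assms(2)]) auto
  then show "k (h (op f xs)) = op'' f (map (\<lambda>x. k (h x)) xs)"
    using preservingD(2)[OF assms(1) f] by (simp add: o_def)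
qed

lemma closed_equalizer:
  assumes "closed S X op" "preserving S X op Y op' h" "preserving S X op Y op' k"
  shows "closed S {x \<in> X. h x = k x} op"
  unfolding closed_def
proof (intro ballI allI impI)
  fix f xs assume f: "f \<in> ops S" "length xs = arity S f" "set xs \<subseteq> {x \<in> X. h x = k x}"
  then have X: "set xs \<subseteq> X" and eq: "map h xs = map k xs"
    by auto
  have "h (op f xs) = k (op f xs)"
    using preservingD(2)[OF assms(2) f(1,2) X] preservingD(2)[OF assms(3) f(1,2) X]
    unfolding eq by simp
  then show "op f xs \<in> {x \<in> X. h x = k x}"
    using closedD[OF assms(1) f(1,2) X] by simp
qed

lemma closed_preimage:
  assumes "closed S X op" "preserving S X op Y op' h" "closed S M op'"
  shows "closed S {x \<in> X. h x \<in> M} op"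
  unfolding closed_def
proof (intro ballI allI impI)
  fix f xs assume f: "f \<in> ops S" "length xs = arity S f" "set xs \<subseteq> {x \<in> X. h x \<in> M}"
  then have X: "set xs \<subseteq> X" and "set (map h xs) \<subseteq> M"
    by auto
  then have "op' f (map h xs) \<in> M"
    using f by (intro closedD[OF assms(3)]) auto
  then show "op f xs \<in> {x \<in> X. h x \<in> M}"
    using closedD[OF assms(1) f(1,2) X] preservingD(2)[OF assms(2) f(1,2) X] by simp
qed

lemma closed_image:
  assumes "closed S X op" "preserving S X op Y op' h"
  shows "closed S (h ` X) op'"
  unfolding closed_def
proof (intro ballI allI impI)
  fix f ys assume f: "f \<in> ops S" "length ys = arity S f" "set ys \<subseteq> h ` X"
  let ?xs = "map (inv_into X h) ys"
  have xs: "set ?xs \<subseteq> X" "length ?xs = arity S f"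
    using f by (auto intro: inv_into_into)
  have "map h ?xs = ys"
    using f(3) by (auto intro!: map_idI simp: f_inv_into_f subset_iff)
  then have "op' f ys = h (op f ?xs)"
    using preservingD(2)[OF assms(2) f(1) xs(2,1)] by simp
  then show "op' f ys \<in> h ` X"
    using closedD[OF assms(1) f(1) xs(2,1)] by blast
qed

text \<open>The variables of equations are numbered by natural numbers. Free algebras need terms over any set
  of generators.\<close>

datatype ('f, 'x) gterm = Gen 'x | Op 'f "('f, 'x) gterm list"

fun gterm_eval :: "('f \<Rightarrow> 'b list \<Rightarrow> 'b) \<Rightarrow> ('x \<Rightarrow> 'b) \<Rightarrow> ('f, 'x) gterm \<Rightarrow> 'b" where
  "gterm_eval op \<rho> (Gen x) = \<rho> x"
| "gterm_eval op \<rho> (Op f ts) = op f (map (gterm_eval op \<rho>) ts)"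

inductive_set gterms :: "'f signature \<Rightarrow> 'x set \<Rightarrow> ('f, 'x) gterm set"
  for S :: "'f signature" and G :: "'x set" where
  Gen: "x \<in> G \<Longrightarrow> Gen x \<in> gterms S G"
| Op: "f \<in> ops S \<Longrightarrow> length ts = arity S f \<Longrightarrow> \<forall>t \<in> set ts. t \<in> gterms S G \<Longrightarrow> Op f ts \<in> gterms S G"

lemma closed_gterms: "closed S (gterms S G) Op"
  by (auto simp: closed_def intro!: gterms.Op)

lemma gterm_eval_closed:
  assumes "t \<in> gterms S G" "closed S X op" "\<rho> ` G \<subseteq> X"
  shows "gterm_eval op \<rho> t \<in> X"
  using assms(1)
proof (induction rule: gterms.induct)
  case (Gen x)
  then show ?case using assms(3) by auto
next
  case (Op f ts)
  then have "set (map (gterm_eval op \<rho>) ts) \<subseteq> X"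
    by auto
  with Op show ?case
    using closedD[OF assms(2) Op(1)] by simp
qed

lemma preserving_gterm_eval:
  assumes "closed S X op" "\<rho> ` G \<subseteq> X"
  shows "preserving S (gterms S G) Op X op (gterm_eval op \<rho>)"
  using gterm_eval_closed[OF _ assms] by (auto simp: preserving_def)

text \<open>Replaces calculation with evaluations: two operation preserving maps out of the terms, often
  composites with evaluations, only have to be compared on generators.\<close>

lemma preserving_gterms_eq:
  assumes "t \<in> gterms S G" "preserving S (gterms S G) Op X op h" "preserving S (gterms S G) Op X op k"
    and "\<And>x. x \<in> G \<Longrightarrow> h (Gen x) = k (Gen x)"
  shows "h t = k t"
  using assms(1)
proof (induction rule: gterms.induct)
  case (Gen x)
  then show ?case using assms(4) by auto
next
  case (Op f ts)
  then have ts: "set ts \<subseteq> gterms S G" and eq: "map h ts = map k ts"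
    by auto
  show ?case
    using preservingD(2)[OF assms(2) Op(1,2) ts] preservingD(2)[OF assms(3) Op(1,2) ts]
    unfolding eq by simp
qed

fun gterm_of :: "'f trm \<Rightarrow> ('f, nat) gterm" where
  "gterm_of (Var x) = Gen x"
| "gterm_of (App f ts) = Op f (map gterm_of ts)"

lemma gterm_of_in_gterms: "wf_trm S t \<Longrightarrow> gterm_of t \<in> gterms S UNIV"
  by (induction t) (auto intro!: gterms.intros)

lemma eval_eq_gterm_eval: "eval A \<rho> t = gterm_eval (oper A) \<rho> (gterm_of t)"
  by (induction t) (auto cong: map_cong)

context universe
begin

text \<open>The terms are exhausted by countably many stages, each made of the generators and of the
  operations applied to lists from the stage before.\<close>

lemma small_gterms:
  fixes S :: "'f signature" and G :: "'x set"
  assumes "small mem (ops S)" "small mem G"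
  shows "small mem (gterms S G)"
proof -
  define step :: "('f, 'x) gterm set \<Rightarrow> ('f, 'x) gterm set" where
    "step T = Gen ` G \<union> (\<lambda>(f, ts). Op f ts) ` (ops S \<times> {ts. set ts \<subseteq> T})" for T
  define T where "T n = (step ^^ n) {}" for n
  have T_Suc: "T (Suc n) = step (T n)" for n
    by (simp add: T_def)
  have step_mono: "step A \<subseteq> step B" if "A \<subseteq> B" for A B
    unfolding step_def using that by (intro Un_mono order_refl image_mono Sigma_mono) auto
  have "T n \<subseteq> T (Suc n)" for n
  proof (induction n)
    case 0
    show ?case by (simp add: T_def)
  next
    case (Suc n)
    then show ?case using step_mono by (simp only: T_Suc)
  qed
  then have T_mono: "T m \<subseteq> T n" if "m \<le> n" for m n
    using that by (rule lift_Suc_mono_le)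
  have small_step: "small mem (step A)" if "small mem A" for A
    unfolding step_def
    by (intro small_Un small_image small_Sigma assms small_lists that)
  have "small mem (T n)" for n
  proof (induction n)
    case 0
    show ?case
      by (rule small_subset[OF _ small_singleton]) (simp add: T_def)
  next
    case (Suc n)
    then show ?case
      using small_step by (simp only: T_Suc)
  qed
  then have small_T: "small mem (\<Union>n \<in> UNIV. T n)"
    by (intro small_UN small_nat)
  have in_T: "t \<in> (\<Union>n \<in> UNIV. T n)" if "t \<in> gterms S G" for t
    using that
  proof (induction rule: gterms.induct)
    case (Gen x)
    then have "Gen x \<in> T (Suc 0)"
      by (simp add: T_Suc step_def)
    then show ?case by blast
  next
    case (Op f ts)
    then have "\<forall>t \<in> set ts. \<exists>n. t \<in> T n"
      by auto
    then obtain d where d: "\<And>t. t \<in> set ts \<Longrightarrow> t \<in> T (d t)"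
      by metis
    have "d t \<le> Max (d ` set ts)" if "t \<in> set ts" for t
      using that by simp
    then have "set ts \<subseteq> T (Max (d ` set ts))"
      using d T_mono by blast
    then have "Op f ts \<in> T (Suc (Max (d ` set ts)))"
      using Op.hyps by (auto simp: T_Suc step_def)
    then show ?case by blast
  qed
  show ?thesis
    by (rule small_subset[OF subsetI small_T]) (rule in_T)
qed

end

section \<open>Algebras presented by separating homomorphisms\<close>

locale algebra_variety = universe mem for mem :: "'u \<Rightarrow> 'u \<Rightarrow> bool" +
  fixes S :: "'f signature" and E :: "('f trm \<times> 'f trm) set"
  assumes variety: "variety mem S E"
begin

abbreviation "V \<equiv> variety_category mem S E"
abbreviation "carrier A \<equiv> elems mem (underlying A)"
abbreviation "hom A B h \<equiv> homomorphism mem S A B h"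
abbreviation "hom_on X op B h \<equiv> preserving S X op (carrier B) (oper B) h"

lemma Obj_V: "A \<in> Obj V \<longleftrightarrow> is_algebra mem S A \<and> satisfies mem A E"
  by (simp add: variety_category_def)

lemma Arr_V: "(A, h, B) \<in> Arr V \<longleftrightarrow> A \<in> Obj V \<and> B \<in> Obj V \<and> hom A B h"
  by (simp add: variety_category_def)

lemma V_simps [simp]:
  "Dom V (A, h, B) = A" "Cod V (A, h, B) = B"
  "Ide V A = (A, \<lambda>x \<in> carrier A. x, A)"
  "(B, k, D) \<cdot>\<^bsub>V\<^esub> (A, h, B') = (A, compose (carrier A) k h, D)"
  by (simp_all add: variety_category_def)

lemma Arr_VE:
  assumes "f \<in> Arr V"
  obtains A h B where "f = (A, h, B)" "A \<in> Obj V" "B \<in> Obj V" "hom A B h"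
  using assms by (cases f) (auto simp: Arr_V)

lemma Hom_V: "f \<in> Hom V A B \<longleftrightarrow> (\<exists>h. f = (A, h, B) \<and> A \<in> Obj V \<and> B \<in> Obj V \<and> hom A B h)"
  by (cases f) (auto simp: Hom_def Arr_V)

lemma closed_carrier: "A \<in> Obj V \<Longrightarrow> closed S (carrier A) (oper A)"
  unfolding Obj_V is_algebra_def closed_def by meson

lemma hom_iff: "hom A B h \<longleftrightarrow> h \<in> extensional (carrier A) \<and> hom_on (carrier A) (oper A) B h"
  by (auto simp: homomorphism_def preserving_def PiE_iff)

lemma hom_hom_on: "hom A B h \<Longrightarrow> hom_on (carrier A) (oper A) B h"
  by (simp add: hom_iff)

lemma hom_in: "hom A B h \<Longrightarrow> x \<in> carrier A \<Longrightarrow> h x \<in> carrier B"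
  by (auto simp: homomorphism_def)

lemma hom_restrict:
  assumes "A \<in> Obj V" "hom_on (carrier A) (oper A) B h"
  shows "hom A B (restrict h (carrier A))"
  unfolding hom_iff preserving_def
proof (intro conjI ballI allI impI)
  fix f xs assume f: "f \<in> ops S" "length xs = arity S f" "set xs \<subseteq> carrier A"
  then have eq: "map (restrict h (carrier A)) xs = map h xs"
    by auto
  show "restrict h (carrier A) (oper A f xs) = oper B f (map (restrict h (carrier A)) xs)"
    using closedD[OF closed_carrier[OF assms(1)] f] preservingD(2)[OF assms(2) f]
    unfolding eq by simp
qed (use assms in \<open>auto simp: preserving_def\<close>)

lemma hom_compose:
  assumes "A \<in> Obj V" "hom A B h" "hom B D k"
  shows "hom A D (compose (carrier A) k h)"
  unfolding compose_def
  by (rule hom_restrict[OF assms(1) preserving_comp]) (rule assms(2,3)[THEN hom_hom_on])+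

lemma hom_ext:
  assumes "hom A B h" "hom A B k" "\<And>x. x \<in> carrier A \<Longrightarrow> h x = k x"
  shows "h = k"
  using assms by (intro extensionalityI) (auto simp: hom_iff)

lemma comp_eq_iff:
  assumes "hom A D l"
  shows "(B, k, D) \<cdot>\<^bsub>V\<^esub> (A, h, B) = (A, l, D) \<longleftrightarrow> (\<forall>x \<in> carrier A. k (h x) = l x)"
  using assms by (auto simp: hom_iff compose_def fun_eq_iff extensional_def)

text \<open>The one construction of algebras needed here. A small structure \<open>X\<close>, in which the equations
  may fail, is divided by the relation of not being separated by a given collection \<open>H\<close> of
  homomorphisms to algebras of the variety. The equations hold in the quotient because each member
  of \<open>H\<close> sees them as true. Subalgebras, algebras of pairs, cokernels and free algebras
  are all of this form.\<close>

lemma separated_quotient: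
  fixes X :: "'b set"
  assumes "small mem X" "closed S X op"
    and H: "\<And>h B. (h, B) \<in> H \<Longrightarrow> B \<in> Obj V \<and> hom_on X op B h"
  obtains A \<kappa> where "A \<in> Obj V" "hom_on X op A \<kappa>" "\<kappa> ` X = carrier A"
    "\<And>x y. x \<in> X \<Longrightarrow> y \<in> X \<Longrightarrow> \<kappa> x = \<kappa> y \<longleftrightarrow> (\<forall>(h, B) \<in> H. h x = h y)"
proof -
  define c where "c x = {y \<in> X. \<forall>(h, B) \<in> H. h x = h y}" for x
  obtain u \<psi> where \<psi>: "bij_betw \<psi> (c ` X) (elems mem u)"
    using small_image[OF assms(1)] unfolding small_def by blast
  define \<kappa> where "\<kappa> x = \<psi> (c x)" for x
  have surj: "\<kappa> ` X = elems mem u"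
    using \<psi> by (simp add: \<kappa>_def bij_betw_def image_image[symmetric])
  have sep: "\<kappa> x = \<kappa> y \<longleftrightarrow> (\<forall>(h, B) \<in> H. h x = h y)" if "x \<in> X" "y \<in> X" for x y
  proof -
    have "\<kappa> x = \<kappa> y \<longleftrightarrow> c x = c y"
      using \<psi> that by (auto simp: \<kappa>_def bij_betw_def inj_on_def)
    also have "\<dots> \<longleftrightarrow> (\<forall>(h, B) \<in> H. h x = h y)"
    proof
      assume "c x = c y"
      moreover have "y \<in> c y"
        using that by (auto simp: c_def)
      ultimately have "y \<in> c x"
        by (simp only:)
      then show "\<forall>(h, B) \<in> H. h x = h y"
        by (simp add: c_def)
    next
      assume "\<forall>(h, B) \<in> H. h x = h y"
      then have "(\<forall>(h, B) \<in> H. h x = h z) \<longleftrightarrow> (\<forall>(h, B) \<in> H. h y = h z)" for z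
        by fastforce
      then show "c x = c y"
        by (simp add: c_def)
    qed
    finally show ?thesis .
  qed
  \<comment> \<open>the operations of the quotient are computed on representatives\<close>
  define r where "r = inv_into X \<kappa>"
  have r: "r y \<in> X" "\<kappa> (r y) = y" if "y \<in> elems mem u" for y
    using that unfolding r_def surj[symmetric] by (auto intro: inv_into_into f_inv_into_f)
  have \<kappa>_in: "\<kappa> x \<in> elems mem u" if "x \<in> X" for x
    using that surj by blast
  define A where "A = \<lparr>underlying = u, oper = (\<lambda>f ys.
    if f \<in> ops S \<and> length ys = arity S f \<and> set ys \<subseteq> elems mem u
    then \<kappa> (op f (map r ys)) else undefined)\<rparr>"
  have car: "carrier A = elems mem u"
    by (simp add: A_def)
  have alg: "is_algebra mem S A"
    unfolding is_algebra_def
  proof (intro allI)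
    fix f ys
    have "op f (map r ys) \<in> X" if "f \<in> ops S" "length ys = arity S f" "set ys \<subseteq> elems mem u"
      using that r(1) by (intro closedD[OF assms(2)]) auto
    then show "if f \<in> ops S \<and> length ys = arity S f \<and> set ys \<subseteq> carrier A
      then oper A f ys \<in> carrier A else oper A f ys = undefined"
      using \<kappa>_in by (simp add: A_def)
  qed
  have hom: "hom_on X op A \<kappa>"
    unfolding preserving_def
  proof (intro conjI ballI allI impI)
    show "\<kappa> ` X \<subseteq> carrier A"
      using surj car by simp
    fix f xs assume f: "f \<in> ops S" "length xs = arity S f" "set xs \<subseteq> X"
    let ?ys = "map (\<lambda>x. r (\<kappa> x)) xs"
    have ys: "set ?ys \<subseteq> X"
      using f(3) r(1) \<kappa>_in by auto
    have "h (op f xs) = h (op f ?ys)" if "(h, B) \<in> H" for h B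
    proof -
      have h: "hom_on X op B h"
        using H[OF that] by blast
      have "h x = h (r (\<kappa> x))" if "x \<in> X" for x
        using sep[OF that, of "r (\<kappa> x)"] r[OF \<kappa>_in[OF that]] \<open>(h, B) \<in> H\<close> by auto
      then have eq: "map h xs = map h ?ys"
        using f(3) by auto
      have len: "length ?ys = arity S f"
        using f(2) by simp
      show ?thesis
        using preservingD(2)[OF h f] preservingD(2)[OF h f(1) len ys] unfolding eq by simp
    qed
    moreover have "op f xs \<in> X" "op f ?ys \<in> X"
      using f ys by (auto intro!: closedD[OF assms(2)])
    ultimately have "\<kappa> (op f xs) = \<kappa> (op f ?ys)"
      using sep by blast
    moreover have "set (map \<kappa> xs) \<subseteq> elems mem u"
      using f(3) \<kappa>_in by auto
    ultimately show "\<kappa> (op f xs) = oper A f (map \<kappa> xs)"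
      using f by (simp add: A_def o_def)
  qed
  have "satisfies mem A E"
    unfolding satisfies_def
  proof (clarify)
    fix s t and \<rho> :: "nat \<Rightarrow> 'u" assume st: "(s, t) \<in> E" and \<rho>: "range \<rho> \<subseteq> carrier A"
    let ?s = "gterm_of s" and ?t = "gterm_of t" and ?\<sigma> = "\<lambda>n :: nat. r (\<rho> n)"
    have wf: "?s \<in> gterms S UNIV" "?t \<in> gterms S UNIV"
      using variety st by (auto simp: variety_def intro!: gterm_of_in_gterms)
    have \<sigma>: "range ?\<sigma> \<subseteq> X"
      using \<rho> r(1) car by auto
    have "h (gterm_eval op ?\<sigma> ?s) = h (gterm_eval op ?\<sigma> ?t)" if "(h, B) \<in> H" for h B
    proof -
      have B: "B \<in> Obj V" and h: "hom_on X op B h"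
        using H[OF that] by auto
      have range: "range (\<lambda>n. h (?\<sigma> n)) \<subseteq> carrier B"
        using \<sigma> preservingD(1)[OF h] by auto
      have eq: "h (gterm_eval op ?\<sigma> q) = gterm_eval (oper B) (\<lambda>n. h (?\<sigma> n)) q"
        if "q \<in> gterms S UNIV" for q
        by (rule preserving_gterms_eq[OF that
              preserving_comp[OF preserving_gterm_eval[OF assms(2) \<sigma>] h]
              preserving_gterm_eval[OF closed_carrier[OF B] range]]) simp
      have "eval B (\<lambda>n. h (?\<sigma> n)) s = eval B (\<lambda>n. h (?\<sigma> n)) t"
        using B st range unfolding Obj_V satisfies_def by blast
      then show ?thesis
        using eq wf by (simp add: eval_eq_gterm_eval)
    qed
    moreover have "gterm_eval op ?\<sigma> ?s \<in> X" "gterm_eval op ?\<sigma> ?t \<in> X"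
      using gterm_eval_closed[OF _ assms(2) \<sigma>] wf by auto
    ultimately have "\<kappa> (gterm_eval op ?\<sigma> ?s) = \<kappa> (gterm_eval op ?\<sigma> ?t)"
      using sep by blast
    moreover have "\<kappa> (gterm_eval op ?\<sigma> q) = gterm_eval (oper A) \<rho> q" if "q \<in> gterms S UNIV" for q
    proof (rule preserving_gterms_eq[OF that])
      show "hom_on (gterms S UNIV) Op A (\<lambda>q. \<kappa> (gterm_eval op ?\<sigma> q))"
        by (rule preserving_comp[OF preserving_gterm_eval[OF assms(2) \<sigma>] hom])
      have "closed S (carrier A) (oper A)"
        using alg unfolding is_algebra_def closed_def by meson
      then show "hom_on (gterms S UNIV) Op A (gterm_eval (oper A) \<rho>)"
        by (rule preserving_gterm_eval) (rule \<rho>)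
    qed (use r(2) \<rho> car in auto)
    ultimately show "eval A \<rho> s = eval A \<rho> t"
      using wf by (simp add: eval_eq_gterm_eval)
  qed
  then have "A \<in> Obj V"
    using alg by (simp add: Obj_V)
  moreover have "\<kappa> ` X = carrier A"
    using surj car by simp
  ultimately show ?thesis
    using hom sep by (intro that) blast+
qed

text \<open>The factorization picks preimages under \<open>\<kappa>\<close>; by compatibility the choice does not matter.\<close>

lemma hom_factor:
  assumes "closed S X op" "hom_on X op A \<kappa>" "\<kappa> ` X = carrier A" "A \<in> Obj V" "hom_on X op B h"
    and compat: "\<And>x y. x \<in> X \<Longrightarrow> y \<in> X \<Longrightarrow> \<kappa> x = \<kappa> y \<Longrightarrow> h x = h y"
  shows "\<exists>h'. hom A B h' \<and> (\<forall>x \<in> X. h' (\<kappa> x) = h x)"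
proof -
  define r where "r = inv_into X \<kappa>"
  have r: "r y \<in> X" "\<kappa> (r y) = y" if "y \<in> carrier A" for y
    using that unfolding r_def assms(3)[symmetric] by (auto intro: inv_into_into f_inv_into_f)
  have hr: "h (r (\<kappa> x)) = h x" if "x \<in> X" for x
    using that r[of "\<kappa> x"] preservingD(1)[OF assms(2) that] compat by blast
  have "hom_on (carrier A) (oper A) B (\<lambda>y. h (r y))"
    unfolding preserving_def
  proof (intro conjI ballI allI impI)
    show "(\<lambda>y. h (r y)) ` carrier A \<subseteq> carrier B"
      using r(1) preservingD(1)[OF assms(5)] by auto
    fix f ys assume f: "f \<in> ops S" "length ys = arity S f" "set ys \<subseteq> carrier A"
    have X: "set (map r ys) \<subseteq> X"
      using f(3) r(1) by auto
    have "map \<kappa> (map r ys) = ys"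
      using f(3) r(2) by (auto intro!: map_idI)
    then have "oper A f ys = \<kappa> (op f (map r ys))"
      using preservingD(2)[OF assms(2) f(1) _ X] f(2) by simp
    then have "h (r (oper A f ys)) = h (op f (map r ys))"
      using hr closedD[OF assms(1) f(1) _ X] f(2) by simp
    then show "h (r (oper A f ys)) = oper B f (map (\<lambda>y. h (r y)) ys)"
      using preservingD(2)[OF assms(5) f(1) _ X] f(2) by (simp add: o_def)
  qed
  from hom_restrict[OF assms(4) this] show ?thesis
    using hr preservingD(1)[OF assms(2)] by (intro exI[of _ "restrict (\<lambda>y. h (r y)) (carrier A)"]) auto
qed

lemma factor_through_surjective:
  assumes "X \<in> Obj V" "A \<in> Obj V" "B \<in> Obj V" "hom X A e" "e ` carrier X = carrier A" "hom X B h"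
    and "\<And>x y. x \<in> carrier X \<Longrightarrow> y \<in> carrier X \<Longrightarrow> e x = e y \<Longrightarrow> h x = h y"
  shows "\<exists>!u. u \<in> Hom V A B \<and> u \<cdot>\<^bsub>V\<^esub> (X, e, A) = (X, h, B)"
proof -
  obtain h' where h': "hom A B h'" "\<And>x. x \<in> carrier X \<Longrightarrow> h' (e x) = h x"
    using hom_factor[OF closed_carrier[OF assms(1)] hom_hom_on[OF assms(4)] assms(5,2)
        hom_hom_on[OF assms(6)] assms(7)] by blast
  show ?thesis
  proof (rule ex1I[of _ "(A, h', B)"])
    show "(A, h', B) \<in> Hom V A B \<and> (A, h', B) \<cdot>\<^bsub>V\<^esub> (X, e, A) = (X, h, B)"
      using h' assms(2,3) comp_eq_iff[OF assms(6), of A h' e] by (auto simp only: Hom_V)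
    fix u assume u: "u \<in> Hom V A B \<and> u \<cdot>\<^bsub>V\<^esub> (X, e, A) = (X, h, B)"
    then obtain k where k: "u = (A, k, B)" "hom A B k"
      by (auto simp: Hom_V)
    then have "\<forall>x \<in> carrier X. k (e x) = h x"
      using u comp_eq_iff[OF assms(6)] by blast
    then have "k y = h' y" if "y \<in> carrier A" for y
      using that h'(2) unfolding assms(5)[symmetric] by auto
    then show "u = (A, h', B)"
      using hom_ext[OF k(2) h'(1)] k(1) by simp
  qed
qed

lemma lift_through_injective:
  assumes "N \<in> Obj V" "A \<in> Obj V" "D \<in> Obj V" "hom N A \<iota>" "inj_on \<iota> (carrier N)" "hom D A g"
    and "g ` carrier D \<subseteq> \<iota> ` carrier N"
  shows "\<exists>!u. u \<in> Hom V D N \<and> (N, \<iota>, A) \<cdot>\<^bsub>V\<^esub> u = (D, g, A)"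
proof -
  define u where "u d = inv_into (carrier N) \<iota> (g d)" for d
  have u: "u d \<in> carrier N" "\<iota> (u d) = g d" if "d \<in> carrier D" for d
  proof -
    have "g d \<in> \<iota> ` carrier N"
      using that assms(7) by blast
    then show "u d \<in> carrier N" "\<iota> (u d) = g d"
      unfolding u_def by (rule inv_into_into, rule f_inv_into_f)
  qed
  have "hom_on (carrier D) (oper D) N u"
    unfolding preserving_def
  proof (intro conjI ballI allI impI)
    show "u ` carrier D \<subseteq> carrier N"
      using u by auto
    fix f xs assume f: "f \<in> ops S" "length xs = arity S f" "set xs \<subseteq> carrier D"
    have N: "set (map u xs) \<subseteq> carrier N"
      using f(3) u by auto
    have D: "oper D f xs \<in> carrier D"
      by (rule closedD[OF closed_carrier[OF assms(3)] f])
    have eq: "map \<iota> (map u xs) = map g xs"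
      using f(3) u by auto
    have len: "length (map u xs) = arity S f"
      using f(2) by simp
    have "\<iota> (oper N f (map u xs)) = g (oper D f xs)"
      using preservingD(2)[OF hom_hom_on[OF assms(4)] f(1) len N]
        preservingD(2)[OF hom_hom_on[OF assms(6)] f] unfolding eq by simp
    then have "\<iota> (oper N f (map u xs)) = \<iota> (u (oper D f xs))"
      using u(2)[OF D] by simp
    then show "u (oper D f xs) = oper N f (map u xs)"
      using assms(5) u(1)[OF D] closedD[OF closed_carrier[OF assms(1)] f(1) _ N] f(2)
      by (simp add: inj_on_eq_iff)
  qed
  then have hom_u: "hom D N (restrict u (carrier D))"
    by (rule hom_restrict[OF assms(3)])
  show ?thesis
  proof (rule ex1I[of _ "(D, restrict u (carrier D), N)"])
    show "(D, restrict u (carrier D), N) \<in> Hom V D N \<and>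
      (N, \<iota>, A) \<cdot>\<^bsub>V\<^esub> (D, restrict u (carrier D), N) = (D, g, A)"
      using hom_u u(2) assms(1,3) comp_eq_iff[OF assms(6), of N \<iota> "restrict u (carrier D)"]
      by (auto simp only: Hom_V restrict_apply' simp_thms)
    fix w assume w: "w \<in> Hom V D N \<and> (N, \<iota>, A) \<cdot>\<^bsub>V\<^esub> w = (D, g, A)"
    then obtain k where k: "w = (D, k, N)" "hom D N k"
      by (auto simp: Hom_V)
    then have "\<forall>x \<in> carrier D. \<iota> (k x) = g x"
      using w comp_eq_iff[OF assms(6)] by blast
    then have "k x = restrict u (carrier D) x" if "x \<in> carrier D" for x
      using that u[OF that] hom_in[OF k(2) that] assms(5) by (auto simp: inj_on_def)
    then show "w = (D, restrict u (carrier D), N)"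
      using hom_ext[OF k(2) hom_u] k(1) by simp
  qed
qed

text \<open>The inclusion of \<open>M\<close> separates its elements, so nothing is identified in the separated
  quotient. The argument for pairs is the same, with the two projections.\<close>

lemma subalgebra:
  assumes "A \<in> Obj V" "M \<subseteq> carrier A" "closed S M (oper A)"
  obtains N \<iota> where "N \<in> Obj V" "hom N A \<iota>" "inj_on \<iota> (carrier N)" "\<iota> ` carrier N = M"
proof -
  have incl: "hom_on M (oper A) A (\<lambda>x. x)"
    using assms(2) by (simp add: preserving_def)
  obtain N \<kappa> where N: "N \<in> Obj V" "hom_on M (oper A) N \<kappa>" "\<kappa> ` M = carrier N"
    and sep: "\<And>x y. x \<in> M \<Longrightarrow> y \<in> M \<Longrightarrow> \<kappa> x = \<kappa> y \<longleftrightarrow> (\<forall>(h, B) \<in> {(\<lambda>x. x, A)}. h x = h y)"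
    using separated_quotient[OF small_subset[OF assms(2) small_elems] assms(3), of "{(\<lambda>x. x, A)}"]
      incl assms(1) by blast
  then obtain \<iota> where \<iota>: "hom N A \<iota>" "\<And>x. x \<in> M \<Longrightarrow> \<iota> (\<kappa> x) = x"
    using hom_factor[OF assms(3) N(2,3,1) incl] by auto
  show ?thesis
  proof (rule that[OF N(1) \<iota>(1)])
    show "inj_on \<iota> (carrier N)" "\<iota> ` carrier N = M"
      unfolding N(3)[symmetric] using \<iota>(2) by (auto simp: inj_on_def image_image)
  qed
qed

abbreviation "pair_oper A B \<equiv> \<lambda>f ps. (oper A f (map fst ps), oper B f (map snd ps))"

lemma relation_algebra:
  assumes "A \<in> Obj V" "B \<in> Obj V" "R \<subseteq> carrier A \<times> carrier B" "closed S R (pair_oper A B)"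
  obtains P p q where "P \<in> Obj V" "hom P A p" "hom P B q" "(\<lambda>x. (p x, q x)) ` carrier P = R"
    "\<And>D a b. D \<in> Obj V \<Longrightarrow> hom D A a \<Longrightarrow> hom D B b \<Longrightarrow> (\<And>x. x \<in> carrier D \<Longrightarrow> (a x, b x) \<in> R) \<Longrightarrow>
       \<exists>u. hom D P u \<and> (\<forall>x \<in> carrier D. p (u x) = a x \<and> q (u x) = b x)"
proof -
  have fst: "hom_on R (pair_oper A B) A fst" and snd: "hom_on R (pair_oper A B) B snd"
    using assms(3) by (auto simp: preserving_def)
  have small: "small mem R"
    by (rule small_subset[OF assms(3)]) (intro small_Sigma small_elems)
  let ?G = "{(fst, A), (snd, B)}"
  have G: "B' \<in> Obj V \<and> hom_on R (pair_oper A B) B' h" if "(h, B') \<in> ?G" for h B'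
    using that fst snd assms(1,2) by auto
  obtain P \<kappa> where P: "P \<in> Obj V" "hom_on R (pair_oper A B) P \<kappa>" "\<kappa> ` R = carrier P"
    and sep: "\<And>x y. x \<in> R \<Longrightarrow> y \<in> R \<Longrightarrow> \<kappa> x = \<kappa> y \<longleftrightarrow> (\<forall>(h, B) \<in> ?G. h x = h y)"
    using separated_quotient[OF small assms(4), of ?G] G by blast
  have inj: "x = y" if "x \<in> R" "y \<in> R" "\<kappa> x = \<kappa> y" for x y
    using sep[OF that(1,2)] that(3) by (simp add: prod_eq_iff)
  obtain p where p: "hom P A p" "\<And>x. x \<in> R \<Longrightarrow> p (\<kappa> x) = fst x"
    using hom_factor[OF assms(4) P(2,3,1) fst] inj by blast
  obtain q where q: "hom P B q" "\<And>x. x \<in> R \<Longrightarrow> q (\<kappa> x) = snd x"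
    using hom_factor[OF assms(4) P(2,3,1) snd] inj by blast
  show ?thesis
  proof (rule that[OF P(1) p(1) q(1)])
    show "(\<lambda>x. (p x, q x)) ` carrier P = R"
      unfolding P(3)[symmetric] using p(2) q(2) by (force simp: image_image)
    fix D a b
    assume D: "D \<in> Obj V" "hom D A a" "hom D B b" and R: "\<And>x. x \<in> carrier D \<Longrightarrow> (a x, b x) \<in> R"
    have "hom_on (carrier D) (oper D) P (\<lambda>x. \<kappa> (a x, b x))"
    proof (rule preserving_comp[OF _ P(2)])
      show "preserving S (carrier D) (oper D) R (pair_oper A B) (\<lambda>x. (a x, b x))"
        using R hom_hom_on[OF D(2)] hom_hom_on[OF D(3)] by (auto simp: preserving_def o_def)
    qed
    from hom_restrict[OF D(1) this]
    show "\<exists>u. hom D P u \<and> (\<forall>x \<in> carrier D. p (u x) = a x \<and> q (u x) = b x)"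
      using R p(2) q(2) by (intro exI[of _ "\<lambda>x \<in> carrier D. \<kappa> (a x, b x)"]) auto
  qed
qed

lemma fibre_product:
  assumes "A \<in> Obj V" "B \<in> Obj V" "hom A Y g" "hom B Y h"
  obtains P p q where "P \<in> Obj V" "hom P A p" "hom P B q"
    "(\<lambda>x. (p x, q x)) ` carrier P = {(a, b). a \<in> carrier A \<and> b \<in> carrier B \<and> g a = h b}"
    "\<forall>D a b. D \<in> Obj V \<longrightarrow> hom D A a \<longrightarrow> hom D B b \<longrightarrow> (\<forall>x \<in> carrier D. g (a x) = h (b x)) \<longrightarrow>
       (\<exists>u. hom D P u \<and> (\<forall>x \<in> carrier D. p (u x) = a x \<and> q (u x) = b x))"
proof -
  let ?R = "{(a, b). a \<in> carrier A \<and> b \<in> carrier B \<and> g a = h b}"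
  have "closed S ?R (pair_oper A B)"
    unfolding closed_def
  proof (intro ballI allI impI)
    fix f ps assume f: "f \<in> ops S" "length ps = arity S f" "set ps \<subseteq> ?R"
    have A: "set (map fst ps) \<subseteq> carrier A" and B: "set (map snd ps) \<subseteq> carrier B"
      and eq: "map g (map fst ps) = map h (map snd ps)"
      using f(3) by auto
    have len: "length (map fst ps) = arity S f" "length (map snd ps) = arity S f"
      using f(2) by auto
    have "g (oper A f (map fst ps)) = h (oper B f (map snd ps))"
      using preservingD(2)[OF hom_hom_on[OF assms(3)] f(1) len(1) A]
        preservingD(2)[OF hom_hom_on[OF assms(4)] f(1) len(2) B] unfolding eq by simp
    then show "pair_oper A B f ps \<in> ?R"
      using closedD[OF closed_carrier[OF assms(1)] f(1) len(1) A]
        closedD[OF closed_carrier[OF assms(2)] f(1) len(2) B] by simp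
  qed
  from relation_algebra[OF assms(1,2) _ this] obtain P p q where
    P: "P \<in> Obj V" "hom P A p" "hom P B q" "(\<lambda>x. (p x, q x)) ` carrier P = ?R"
    and univ: "\<And>D a b. D \<in> Obj V \<Longrightarrow> hom D A a \<Longrightarrow> hom D B b \<Longrightarrow> (\<And>x. x \<in> carrier D \<Longrightarrow> (a x, b x) \<in> ?R) \<Longrightarrow>
       \<exists>u. hom D P u \<and> (\<forall>x \<in> carrier D. p (u x) = a x \<and> q (u x) = b x)"
    by blast
  show ?thesis
  proof (rule that[OF P], intro allI impI)
    fix D a b
    assume D: "D \<in> Obj V" "hom D A a" "hom D B b" and eq: "\<forall>x \<in> carrier D. g (a x) = h (b x)"
    show "\<exists>u. hom D P u \<and> (\<forall>x \<in> carrier D. p (u x) = a x \<and> q (u x) = b x)"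
      by (rule univ[OF D]) (use eq hom_in[OF D(2)] hom_in[OF D(3)] in blast)
  qed
qed

end

section \<open>Zero elements, kernels and the short five lemma\<close>

lemma protomodularD:
  assumes "protomodular C" "v \<in> Arr C" "point_over C (Cod C v) p s" "point_over C (Cod C v) p' s'"
    "f \<in> Hom C (Dom C p) (Dom C p')" "p' \<cdot>\<^bsub>C\<^esub> f = p" "f \<cdot>\<^bsub>C\<^esub> s = s'"
    "is_pullback C v p a b" "is_pullback C v p' a' b'"
    "g \<in> Hom C (Dom C a) (Dom C a')" "a' \<cdot>\<^bsub>C\<^esub> g = a" "b' \<cdot>\<^bsub>C\<^esub> g = f \<cdot>\<^bsub>C\<^esub> b" "is_iso C g"
  shows "is_iso C f"
proof -
  have "\<forall>v \<in> Arr C. \<forall>p s p' s' f a b a' b' g.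
        point_over C (Cod C v) p s \<longrightarrow> point_over C (Cod C v) p' s' \<longrightarrow>
        f \<in> Hom C (Dom C p) (Dom C p') \<longrightarrow> p' \<cdot>\<^bsub>C\<^esub> f = p \<longrightarrow> f \<cdot>\<^bsub>C\<^esub> s = s' \<longrightarrow>
        is_pullback C v p a b \<longrightarrow> is_pullback C v p' a' b' \<longrightarrow>
        g \<in> Hom C (Dom C a) (Dom C a') \<longrightarrow> a' \<cdot>\<^bsub>C\<^esub> g = a \<longrightarrow> b' \<cdot>\<^bsub>C\<^esub> g = f \<cdot>\<^bsub>C\<^esub> b \<longrightarrow>
        is_iso C g \<longrightarrow> is_iso C f"
    using assms(1) unfolding protomodular_def by (elim conjE) assumption
  from bspec[OF this assms(2), rule_format, OF assms(3-13)] show ?thesis .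
qed

lemma (in cat) is_iso_Ide: "x \<in> Obj C \<Longrightarrow> is_iso C (Ide C x)"
  unfolding is_iso_def Hom_def by simp

locale semiabelian_variety = algebra_variety mem S E
  for mem :: "'u \<Rightarrow> 'u \<Rightarrow> bool" and S :: "'f signature" and E :: "('f trm \<times> 'f trm) set" +
  assumes semi_abelian: "semi_abelian (variety_category mem S E)"

sublocale semiabelian_variety \<subseteq> cat "variety_category mem S E"
  using semi_abelian by unfold_locales (simp add: semi_abelian_def)

context semiabelian_variety
begin

lemma pointed: "pointed V"
  using semi_abelian by (simp add: semi_abelian_def)

text \<open>The identity of a zero object factors through a one-element algebra. Since the zero object is
  initial, its element has an image in every algebra, the zero of that algebra, and no algebra
  is empty.\<close>

lemma zero_object_singleton:
  assumes "is_zero_object V Z"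
  shows "\<exists>c. carrier Z = {c}"
proof -
  have Z: "Z \<in> Obj V" "\<And>A. A \<in> Obj V \<Longrightarrow> \<exists>!f. f \<in> Hom V A Z" "\<And>A. A \<in> Obj V \<Longrightarrow> \<exists>!f. f \<in> Hom V Z A"
    using assms unfolding is_zero_object_def is_initial_def is_terminal_def by simp_all
  obtain T :: "('f, 'u) algebra" and \<kappa> where T: "T \<in> Obj V" "\<kappa> ` {()} = carrier T"
    by (rule separated_quotient[of "{()}" "\<lambda>_ _. ()" "{}"])
      (auto simp: small_singleton closed_def)
  obtain t where t: "hom T Z t"
    using Z(2)[OF T(1)] by (auto simp: Hom_V)
  obtain s where s: "hom Z T s"
    using Z(3)[OF T(1)] by (auto simp: Hom_V)
  have "(Z, compose (carrier Z) t s, Z) \<in> Hom V Z Z"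
    using hom_compose[OF Z(1) s t] Z(1) by (simp add: Hom_V)
  moreover have "Ide V Z \<in> Hom V Z Z"
    unfolding Hom_def using Z(1) by (simp only: mem_Collect_eq ide_simps simp_thms)
  ultimately have "(Z, compose (carrier Z) t s, Z) = Ide V Z"
    using Z(2)[OF Z(1)] by blast
  then have eq: "t (s x) = x" if "x \<in> carrier Z" for x
    using that by (auto simp: compose_def fun_eq_iff split: if_splits dest: spec[of _ x])
  have "\<kappa> () \<in> carrier T"
    using T(2) by auto
  have "carrier Z = {t (\<kappa> ())}"
  proof (intro equalityI subsetI)
    fix x assume x: "x \<in> carrier Z"
    then have "s x = \<kappa> ()"
      using hom_in[OF s x] T(2) by auto
    then show "x \<in> {t (\<kappa> ())}"
      using eq[OF x] by simp
  qed (use hom_in[OF t \<open>\<kappa> () \<in> carrier T\<close>] in simp)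
  then show ?thesis
    by blast
qed

lemma ex_zero:
  "\<exists>z. (\<forall>A \<in> Obj V. z A \<in> carrier A \<and> closed S {z A} (oper A)) \<and>
     (\<forall>A B h. A \<in> Obj V \<longrightarrow> B \<in> Obj V \<longrightarrow> hom A B h \<longrightarrow> h (z A) = z B) \<and>
     (\<forall>Z. is_zero_object V Z \<longrightarrow> carrier Z = {z Z})"
proof -
  obtain Z where Z: "is_zero_object V Z"
    using pointed by (auto simp: pointed_def)
  then obtain c where c: "carrier Z = {c}"
    using zero_object_singleton by blast
  have Z_Obj: "Z \<in> Obj V" and init: "\<And>A. A \<in> Obj V \<Longrightarrow> \<exists>!f. f \<in> Hom V Z A"
    using Z unfolding is_zero_object_def is_initial_def by auto
  have "\<exists>i. hom Z A i" if "A \<in> Obj V" for A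
    using init[OF that] by (auto simp: Hom_V)
  then obtain i where i: "\<And>A. A \<in> Obj V \<Longrightarrow> hom Z A (i A)"
    by metis
  show ?thesis
  proof (intro exI[of _ "\<lambda>A. i A c"] conjI ballI allI impI)
    fix A assume A: "A \<in> Obj V"
    show "i A c \<in> carrier A"
      by (rule hom_in[OF i[OF A]]) (simp add: c)
    show "closed S {i A c} (oper A)"
      using closed_image[OF closed_carrier[OF Z_Obj] hom_hom_on[OF i[OF A]]] by (simp add: c)
  next
    fix A B h assume A: "A \<in> Obj V" "B \<in> Obj V" "hom A B h"
    have "(Z, compose (carrier Z) h (i A), B) \<in> Hom V Z B" "(Z, i B, B) \<in> Hom V Z B"
      using hom_compose[OF Z_Obj i[OF A(1)] A(3)] i[OF A(2)] A Z_Obj by (auto simp: Hom_V)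
    then have "compose (carrier Z) h (i A) = i B"
      using init[OF A(2)] by blast
    then have "compose (carrier Z) h (i A) c = i B c"
      by simp
    then show "h (i A c) = i B c"
      by (simp add: c compose_def)
  next
    fix Z' assume Z': "is_zero_object V Z'"
    then have "Z' \<in> Obj V"
      by (simp add: is_zero_object_def is_initial_def)
    then have "i Z' c \<in> carrier Z'"
      using hom_in[OF i] c by blast
    then show "carrier Z' = {i Z' c}"
      using zero_object_singleton[OF Z'] by auto
  qed
qed

definition zero :: "('f, 'u) algebra \<Rightarrow> 'u" where
  "zero = (SOME z. (\<forall>A \<in> Obj V. z A \<in> carrier A \<and> closed S {z A} (oper A)) \<and>
     (\<forall>A B h. A \<in> Obj V \<longrightarrow> B \<in> Obj V \<longrightarrow> hom A B h \<longrightarrow> h (z A) = z B) \<and>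
     (\<forall>Z. is_zero_object V Z \<longrightarrow> carrier Z = {z Z}))"

lemma zero_in: "A \<in> Obj V \<Longrightarrow> zero A \<in> carrier A"
  and zero_closed: "A \<in> Obj V \<Longrightarrow> closed S {zero A} (oper A)"
  and hom_zero: "A \<in> Obj V \<Longrightarrow> B \<in> Obj V \<Longrightarrow> hom A B h \<Longrightarrow> h (zero A) = zero B"
  and zero_object_carrier: "is_zero_object V Z \<Longrightarrow> carrier Z = {zero Z}"
  using someI_ex[OF ex_zero] unfolding zero_def[symmetric] by blast+

lemma zero_arrow_iff:
  "is_zero_arrow V (A, h, B) \<longleftrightarrow> (A, h, B) \<in> Arr V \<and> (\<forall>x \<in> carrier A. h x = zero B)"
proof
  assume "is_zero_arrow V (A, h, B)"
  then obtain Z g k where Z: "is_zero_object V Z" and g: "(A, g, Z) \<in> Arr V" and k: "(Z, k, B) \<in> Arr V"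
    and eq: "(Z, k, B) \<cdot>\<^bsub>V\<^esub> (A, g, Z) = (A, h, B)" and h: "(A, h, B) \<in> Arr V"
    unfolding is_zero_arrow_def by (auto simp: Hom_V Arr_V)
  have homs: "hom A B h" "hom A Z g" "hom Z B k" "Z \<in> Obj V" "B \<in> Obj V"
    using g h k by (auto simp: Arr_V)
  have "h x = zero B" if "x \<in> carrier A" for x
  proof -
    have "g x = zero Z"
      using zero_object_carrier[OF Z] hom_in[OF homs(2) that] by simp
    moreover have "k (g x) = h x"
      using eq comp_eq_iff[OF homs(1)] that by blast
    ultimately show ?thesis
      using hom_zero[OF homs(4,5,3)] by simp
  qed
  with h show "(A, h, B) \<in> Arr V \<and> (\<forall>x \<in> carrier A. h x = zero B)"
    by blast
next
  assume h: "(A, h, B) \<in> Arr V \<and> (\<forall>x \<in> carrier A. h x = zero B)"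
  then have A: "A \<in> Obj V" "B \<in> Obj V" "hom A B h"
    by (auto simp: Arr_V)
  obtain Z where Z: "is_zero_object V Z"
    using pointed by (auto simp: pointed_def)
  obtain g k where g: "(A, g, Z) \<in> Hom V A Z" and k: "(Z, k, B) \<in> Hom V Z B"
    using Z A unfolding is_zero_object_def is_initial_def is_terminal_def by (metis Hom_V)
  have "k (g x) = h x" if "x \<in> carrier A" for x
  proof -
    have "g x = zero Z"
      using zero_object_carrier[OF Z] g hom_in[OF _ that] by (auto simp: Hom_V)
    then show ?thesis
      using h that k hom_zero by (auto simp: Hom_V)
  qed
  then have "(Z, k, B) \<cdot>\<^bsub>V\<^esub> (A, g, Z) = (A, h, B)"
    using comp_eq_iff[OF A(3)] by blast
  then show "is_zero_arrow V (A, h, B)"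
    using zero_arrowI[OF Z g k] by simp
qed

lemma zero_comp_iff:
  assumes "A \<in> Obj V" "B \<in> Obj V" "D \<in> Obj V" "hom A B h" "hom B D k"
  shows "is_zero_arrow V ((B, k, D) \<cdot>\<^bsub>V\<^esub> (A, h, B)) \<longleftrightarrow> (\<forall>x \<in> carrier A. k (h x) = zero D)"
  using assms hom_compose[OF assms(1,4,5)] by (simp add: zero_arrow_iff Arr_V compose_def)

abbreviation "ker A B h \<equiv> {x \<in> carrier A. h x = zero B}"

lemma closed_ker:
  assumes "A \<in> Obj V" "B \<in> Obj V" "hom A B h"
  shows "closed S (ker A B h) (oper A)"
  using closed_preimage[OF closed_carrier[OF assms(1)] hom_hom_on[OF assms(3)] zero_closed[OF assms(2)]]
  by simp

lemma kernelI:
  assumes "N \<in> Obj V" "A \<in> Obj V" "B \<in> Obj V" "hom N A \<iota>" "inj_on \<iota> (carrier N)" "hom A B h"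
    and "\<iota> ` carrier N = ker A B h"
  shows "is_kernel V (N, \<iota>, A) (A, h, B)"
  unfolding is_kernel_def
proof (intro conjI ballI impI)
  show "(N, \<iota>, A) \<in> Arr V" "(A, h, B) \<in> Arr V" "Cod V (N, \<iota>, A) = Dom V (A, h, B)"
    using assms by (auto simp: Arr_V)
  show "is_zero_arrow V ((A, h, B) \<cdot>\<^bsub>V\<^esub> (N, \<iota>, A))"
    using assms(7) by (subst zero_comp_iff[OF assms(1-4,6)]) blast
  fix g assume g: "g \<in> Arr V" "Cod V g = Dom V (A, h, B)" "is_zero_arrow V ((A, h, B) \<cdot>\<^bsub>V\<^esub> g)"
  then obtain D g' where D: "g = (D, g', A)" "D \<in> Obj V" "hom D A g'"
    by (auto elim!: Arr_VE)
  then have "\<forall>x \<in> carrier D. h (g' x) = zero B"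
    using g(3) zero_comp_iff[OF D(2) assms(2,3) D(3) assms(6)] by simp
  then have "g' ` carrier D \<subseteq> \<iota> ` carrier N"
    using hom_in[OF D(3)] assms(7) by auto
  from lift_through_injective[OF assms(1,2) D(2) assms(4,5) D(3) this]
  show "\<exists>!u. u \<in> Hom V (Dom V g) (Dom V (N, \<iota>, A)) \<and> (N, \<iota>, A) \<cdot>\<^bsub>V\<^esub> u = g"
    unfolding D(1) by (simp only: V_simps)
qed

lemma ex_kernel:
  assumes "A \<in> Obj V" "B \<in> Obj V" "hom A B h"
  obtains N \<iota> where "N \<in> Obj V" "hom N A \<iota>" "inj_on \<iota> (carrier N)" "\<iota> ` carrier N = ker A B h"
    "is_kernel V (N, \<iota>, A) (A, h, B)"
proof -
  obtain N \<iota> where N: "N \<in> Obj V" "hom N A \<iota>" "inj_on \<iota> (carrier N)" "\<iota> ` carrier N = ker A B h"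
    using subalgebra[OF assms(1) _ closed_ker[OF assms]] by blast
  show ?thesis
    by (rule that[OF N kernelI[OF N(1) assms(1,2) N(2,3) assms(3) N(4)]])
qed

text \<open>The subalgebra \<open>ker A B h\<close> is also a kernel, so its inclusion factors through \<open>k\<close>.\<close>

lemma ker_subset_image:
  assumes "is_kernel V (N, k, A) (A, h, B)"
  shows "ker A B h \<subseteq> k ` carrier N"
proof -
  have Arr: "(N, k, A) \<in> Arr V" "(A, h, B) \<in> Arr V"
    using assms by (auto simp: is_kernel_def)
  then have A: "A \<in> Obj V" "B \<in> Obj V" "hom A B h"
    by (auto simp: Arr_V)
  obtain N' \<iota> where N': "N' \<in> Obj V" "hom N' A \<iota>" "inj_on \<iota> (carrier N')"
    "\<iota> ` carrier N' = ker A B h" "is_kernel V (N', \<iota>, A) (A, h, B)"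
    by (rule ex_kernel[OF A])
  have zero: "(N', \<iota>, A) \<in> Arr V" "is_zero_arrow V ((A, h, B) \<cdot>\<^bsub>V\<^esub> (N', \<iota>, A))"
    using N'(5) unfolding is_kernel_def by blast+
  have "\<forall>g \<in> Arr V. Cod V g = Dom V (A, h, B) \<longrightarrow> is_zero_arrow V ((A, h, B) \<cdot>\<^bsub>V\<^esub> g) \<longrightarrow>
      (\<exists>!u. u \<in> Hom V (Dom V g) (Dom V (N, k, A)) \<and> (N, k, A) \<cdot>\<^bsub>V\<^esub> u = g)"
    using assms unfolding is_kernel_def by (elim conjE) assumption
  from bspec[OF this zero(1)] have "\<exists>!u. u \<in> Hom V N' N \<and> (N, k, A) \<cdot>\<^bsub>V\<^esub> u = (N', \<iota>, A)"
    using zero(2) by (simp only: V_simps(1,2) simp_thms)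
  then obtain u where u: "u \<in> Hom V N' N" "(N, k, A) \<cdot>\<^bsub>V\<^esub> u = (N', \<iota>, A)"
    by blast
  then obtain u' where u': "u = (N', u', N)" "hom N' N u'"
    by (auto simp: Hom_V)
  then have "\<forall>x \<in> carrier N'. k (u' x) = \<iota> x"
    using u(2) comp_eq_iff[OF N'(2)] by blast
  then show ?thesis
    unfolding N'(4)[symmetric] using hom_in[OF u'(2)] by force
qed

text \<open>Protomodularity will be applied to the change of base along the arrow from a zero object, which
  takes a point to its kernel.\<close>

lemma kernel_pullback:
  assumes "is_zero_object V Z" "P \<in> Obj V" "N \<in> Obj V" "L \<in> Obj V"
    and "hom Z N v" "hom P N p" "hom L Z a" "hom L P b" "inj_on b (carrier L)" "b ` carrier L = ker P N p"
  shows "is_pullback V (Z, v, N) (P, p, N) (L, a, Z) (L, b, P)"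
proof -
  have Z: "Z \<in> Obj V"
    using assms(1) by (simp add: is_zero_object_def is_initial_def)
  have v: "v x = zero N" if "x \<in> carrier Z" for x
    using that zero_object_carrier[OF assms(1)] hom_zero[OF Z assms(3,5)] by simp
  have comm: "(Z, v, N) \<cdot>\<^bsub>V\<^esub> (L, a, Z) = (P, p, N) \<cdot>\<^bsub>V\<^esub> (L, b, P)"
  proof -
    have "v (a x) = p (b x)" if "x \<in> carrier L" for x
    proof -
      have "b x \<in> ker P N p"
        using that assms(10) by blast
      then show ?thesis
        using v[OF hom_in[OF assms(7) that]] by simp
    qed
    then show ?thesis
      by (auto simp: compose_def)
  qed
  have univ: "\<exists>!u. u \<in> Hom V D L \<and> (L, a, Z) \<cdot>\<^bsub>V\<^esub> u = \<alpha> \<and> (L, b, P) \<cdot>\<^bsub>V\<^esub> u = \<beta>"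
    if D: "D \<in> Obj V" and \<alpha>: "\<alpha> \<in> Hom V D Z" and \<beta>: "\<beta> \<in> Hom V D P"
      and eq: "(Z, v, N) \<cdot>\<^bsub>V\<^esub> \<alpha> = (P, p, N) \<cdot>\<^bsub>V\<^esub> \<beta>" for D \<alpha> \<beta>
  proof -
    obtain \<alpha>' where \<alpha>': "\<alpha> = (D, \<alpha>', Z)" "hom D Z \<alpha>'"
      using \<alpha> by (auto simp: Hom_V)
    obtain \<beta>' where \<beta>': "\<beta> = (D, \<beta>', P)" "hom D P \<beta>'"
      using \<beta> by (auto simp: Hom_V)
    have "\<beta>' x \<in> b ` carrier L" if "x \<in> carrier D" for x
    proof -
      have "compose (carrier D) v \<alpha>' x = compose (carrier D) p \<beta>' x"
        using eq \<alpha>'(1) \<beta>'(1) by simp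
      then have "p (\<beta>' x) = zero N"
        using that v[OF hom_in[OF \<alpha>'(2) that]] by (simp add: compose_def)
      then show ?thesis
        using assms(10) hom_in[OF \<beta>'(2) that] by simp
    qed
    then have ex: "\<exists>!u. u \<in> Hom V D L \<and> (L, b, P) \<cdot>\<^bsub>V\<^esub> u = \<beta>"
      unfolding \<beta>'(1)
      by (intro lift_through_injective[OF assms(4,2) D assms(8,9) \<beta>'(2)]) auto
    have "(L, a, Z) \<cdot>\<^bsub>V\<^esub> u = \<alpha>" if "u \<in> Hom V D L" for u
    proof -
      obtain u' where u': "u = (D, u', L)" "hom D L u'"
        using \<open>u \<in> Hom V D L\<close> by (auto simp: Hom_V)
      have "a (u' x) = \<alpha>' x" if "x \<in> carrier D" for x
        using hom_in[OF assms(7) hom_in[OF u'(2) that]] hom_in[OF \<alpha>'(2) that]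
          zero_object_carrier[OF assms(1)] by simp
      then show ?thesis
        unfolding u'(1) \<alpha>'(1) using comp_eq_iff[OF \<alpha>'(2)] by blast
    qed
    with ex show ?thesis
      by blast
  qed
  have arrows: "(Z, v, N) \<in> Arr V" "(P, p, N) \<in> Arr V" "(L, a, Z) \<in> Arr V" "(L, b, P) \<in> Arr V"
    using Z assms(2-8) by (simp_all add: Arr_V)
  show ?thesis
    by (simp only: is_pullback_def V_simps(1,2) arrows comm simp_thms) (intro ballI impI univ)
qed

lemma iso_surjective:
  assumes "is_iso V (A, h, B)"
  shows "h ` carrier A = carrier B"
proof -
  have h: "hom A B h" "B \<in> Obj V"
    using assms by (auto simp: is_iso_def Arr_V)
  obtain g where g: "hom B A g" "(A, h, B) \<cdot>\<^bsub>V\<^esub> (B, g, A) = Ide V B"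
    using assms unfolding is_iso_def by (auto simp only: Hom_V V_simps(1,2))
  have "y \<in> h ` carrier A" if y: "y \<in> carrier B" for y
  proof -
    have "compose (carrier B) h g y = restrict (\<lambda>x. x) (carrier B) y"
      using g(2) by simp
    then have "h (g y) = y"
      using y by (simp add: compose_def)
    then show ?thesis
      using hom_in[OF g(1) y] by (metis imageI)
  qed
  then show ?thesis
    using hom_in[OF h(1)] by auto
qed

text \<open>Protomodularity enters through this form of the short five lemma. The fibre product \<open>P\<close> of
  \<open>q\<close> restricted to \<open>M\<close> and \<open>q\<close> is a point over \<open>M\<close>, split by the diagonal, and its elements \<open>(m, x)\<close>
  with \<open>x \<in> M\<close> form a point over \<open>M\<close> as well. The two have the same kernel, because \<open>m = 0\<close> puts \<open>x\<close>
  in the kernel of \<open>q\<close>, which is part of \<open>M\<close>. So they coincide, and every \<open>x\<close> in \<open>X\<close> occurs in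
  some pair.\<close>

lemma short_five:
  assumes X: "X \<in> Obj V" and Y: "Y \<in> Obj V" and q: "hom X Y q"
    and M: "M \<subseteq> carrier X" "closed S M (oper X)"
    and ker: "ker X Y q \<subseteq> M" and onto: "\<And>x. x \<in> carrier X \<Longrightarrow> \<exists>m \<in> M. q m = q x"
  shows "M = carrier X"
proof -
  obtain N \<iota> where N: "N \<in> Obj V" "hom N X \<iota>" "inj_on \<iota> (carrier N)" "\<iota> ` carrier N = M"
    using subalgebra[OF X M] by blast
  obtain P p c where P: "P \<in> Obj V" "hom P N p" "hom P X c"
    and P_pairs: "(\<lambda>r. (p r, c r)) ` carrier P =
      {(n, x). n \<in> carrier N \<and> x \<in> carrier X \<and> compose (carrier N) q \<iota> n = q x}"
    and P_univ: "\<forall>D a b. D \<in> Obj V \<longrightarrow> hom D N a \<longrightarrow> hom D X b \<longrightarrow>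
      (\<forall>x \<in> carrier D. compose (carrier N) q \<iota> (a x) = q (b x)) \<longrightarrow>
      (\<exists>u. hom D P u \<and> (\<forall>x \<in> carrier D. p (u x) = a x \<and> c (u x) = b x))"
    by (rule fibre_product[OF N(1) X hom_compose[OF N(1,2) q] q])
  have fibre: "q (\<iota> (p r)) = q (c r)" if "r \<in> carrier P" for r
  proof -
    have "(p r, c r) \<in> {(n, x). n \<in> carrier N \<and> x \<in> carrier X \<and> compose (carrier N) q \<iota> n = q x}"
      using that unfolding P_pairs[symmetric] by blast
    then show ?thesis
      by (auto simp: compose_def)
  qed
  have Ide_N: "hom N N (\<lambda>x \<in> carrier N. x)"
    by (rule hom_restrict[OF N(1)]) (simp add: preserving_def)
  have "\<forall>n \<in> carrier N. compose (carrier N) q \<iota> ((\<lambda>x \<in> carrier N. x) n) = q (\<iota> n)"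
    by (simp add: compose_def)
  from P_univ[rule_format, OF N(1) Ide_N N(2) bspec[OF this]] obtain s where s: "hom N P s" "\<And>n. n \<in> carrier N \<Longrightarrow> p (s n) = n" "\<And>n. n \<in> carrier N \<Longrightarrow> c (s n) = \<iota> n"
    by auto
  let ?M' = "{r \<in> carrier P. c r \<in> M}"
  obtain P' f where P': "P' \<in> Obj V" "hom P' P f" "inj_on f (carrier P')" "f ` carrier P' = ?M'"
    using subalgebra[OF P(1) _ closed_preimage[OF closed_carrier[OF P(1)] hom_hom_on[OF P(3)] M(2)]]
    by blast
  define p' where "p' = compose (carrier P') p f"
  have p': "hom P' N p'" "\<And>x. x \<in> carrier P' \<Longrightarrow> p' x = p (f x)"
    using hom_compose[OF P'(1,2) P(2)] by (auto simp: p'_def compose_def)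
  have "s ` carrier N \<subseteq> f ` carrier P'"
    unfolding P'(4) using hom_in[OF s(1)] s(3) N(4) by auto
  then obtain s' where s': "hom N P' s'" "(P', f, P) \<cdot>\<^bsub>V\<^esub> (N, s', P') = (N, s, P)"
    using lift_through_injective[OF P'(1) P(1) N(1) P'(2,3) s(1)] by (auto simp only: Hom_V)
  have fs': "f (s' n) = s n" if "n \<in> carrier N" for n
    using s'(2) comp_eq_iff[OF s(1)] that by blast
  \<comment> \<open>the common kernel of the two points, as a pullback along the arrow from a zero object\<close>
  obtain L b' where L: "L \<in> Obj V" "hom L P' b'" "inj_on b' (carrier L)" "b' ` carrier L = ker P' N p'"
    "is_kernel V (L, b', P') (P', p', N)"
    by (rule ex_kernel[OF P'(1) N(1) p'(1)])
  define b where "b = compose (carrier L) f b'"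
  have b: "hom L P b" "\<And>x. x \<in> carrier L \<Longrightarrow> b x = f (b' x)"
    using hom_compose[OF L(1,2) P'(2)] by (auto simp: b_def compose_def)
  have b_inj: "inj_on b (carrier L)"
    using L(3) P'(3) hom_in[OF L(2)] b(2) by (auto simp: inj_on_def)
  have b_ker: "b ` carrier L = ker P N p"
  proof (intro equalityI subsetI)
    fix r assume "r \<in> b ` carrier L"
    then obtain l where l: "l \<in> carrier L" "r = f (b' l)"
      using b(2) by auto
    have "b' l \<in> ker P' N p'"
      using l(1) L(4) by blast
    then show "r \<in> ker P N p"
      using p'(2) hom_in[OF P'(2)] l(2) by auto
  next
    fix r assume r: "r \<in> ker P N p"
    then have "q (c r) = q (\<iota> (zero N))"
      using fibre[of r] by simp
    also have "\<dots> = zero Y"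
      using hom_zero[OF N(1) X N(2)] hom_zero[OF X Y q] by simp
    finally have "c r \<in> M"
      using ker hom_in[OF P(3)] r by auto
    then have "r \<in> f ` carrier P'"
      unfolding P'(4) using r by simp
    then obtain r' where r': "r' \<in> carrier P'" "f r' = r"
      by auto
    then have "r' \<in> b' ` carrier L"
      unfolding L(4) using r p'(2) by simp
    then show "r \<in> b ` carrier L"
      using r'(2) b(2) by force
  qed
  obtain Z where Z: "is_zero_object V Z"
    using pointed by (auto simp: pointed_def)
  have Z_Obj: "Z \<in> Obj V"
    using Z by (simp add: is_zero_object_def is_initial_def)
  obtain v where v: "hom Z N v"
    using Z N(1) unfolding is_zero_object_def is_initial_def by (auto simp: Hom_V)
  obtain a where a: "hom L Z a"
    using Z L(1) unfolding is_zero_object_def is_terminal_def by (auto simp: Hom_V)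
  have pb: "is_pullback V (Z, v, N) (P, p, N) (L, a, Z) (L, b, P)"
    by (rule kernel_pullback[OF Z P(1) N(1) L(1) v P(2) a b(1) b_inj b_ker])
  have pb': "is_pullback V (Z, v, N) (P', p', N) (L, a, Z) (L, b', P')"
    by (rule kernel_pullback[OF Z P'(1) N(1) L(1) v p'(1) a L(2,3,4)])
  have Ide_L: "hom L L (\<lambda>x \<in> carrier L. x)"
    by (rule hom_restrict[OF L(1)]) (simp add: preserving_def)
  have point: "point_over V N (P, p, N) (N, s, P)"
    unfolding point_over_def using P(1,2) N(1) s(1,2) comp_eq_iff[OF Ide_N, of P p s]
    by (simp add: Arr_V Hom_V del: V_simps(4))
  have point': "point_over V N (P', p', N) (N, s', P')"
    unfolding point_over_def
    using P'(1) p' N(1) s' fs' s(2) hom_in[OF s'(1)] comp_eq_iff[OF Ide_N, of P' p' s']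
    by (simp add: Arr_V Hom_V del: V_simps(4))
  have f_Hom: "(P', f, P) \<in> Hom V (Dom V (P', p', N)) (Dom V (P, p, N))"
    using P'(1,2) P(1) by (simp add: Hom_V)
  have pf: "(P, p, N) \<cdot>\<^bsub>V\<^esub> (P', f, P) = (P', p', N)"
    using comp_eq_iff[OF p'(1)] p'(2) by simp
  have g_Hom: "Ide V L \<in> Hom V (Dom V (L, a, Z)) (Dom V (L, a, Z))"
    using Ide_L L(1) by (simp add: Hom_V)
  have ag: "(L, a, Z) \<cdot>\<^bsub>V\<^esub> Ide V L = (L, a, Z)"
    using L(1) Z_Obj a by (intro comp_ide) (auto simp: Arr_V)
  have bg: "(L, b, P) \<cdot>\<^bsub>V\<^esub> Ide V L = (P', f, P) \<cdot>\<^bsub>V\<^esub> (L, b', P')"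
  proof -
    have "(L, b, P) \<cdot>\<^bsub>V\<^esub> Ide V L = (L, b, P)"
      using L(1) P(1) b(1) by (intro comp_ide) (auto simp: Arr_V)
    then show ?thesis
      by (simp add: b_def)
  qed
  have g_iso: "is_iso V (Ide V L)"
    by (rule is_iso_Ide[OF L(1)])
  have "protomodular V"
    using semi_abelian by (simp add: semi_abelian_def)
  moreover have "(Z, v, N) \<in> Arr V"
    using v Z_Obj N(1) by (simp add: Arr_V)
  moreover have "point_over V (Cod V (Z, v, N)) (P, p, N) (N, s, P)"
    "point_over V (Cod V (Z, v, N)) (P', p', N) (N, s', P')"
    using point point' by simp_all
  ultimately have "is_iso V (P', f, P)"
    using protomodularD[OF _ _ _ _ f_Hom pf s'(2) pb' pb g_Hom ag bg g_iso] by blast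
  then have f_onto: "?M' = carrier P"
    using iso_surjective P'(4) by simp
  have "x \<in> M" if x: "x \<in> carrier X" for x
  proof -
    obtain n where n: "n \<in> carrier N" "q (\<iota> n) = q x"
      using onto[OF x] N(4) by blast
    then have "(n, x) \<in> (\<lambda>r. (p r, c r)) ` carrier P"
      unfolding P_pairs using x by (simp add: compose_def)
    then show ?thesis
      using f_onto by auto
  qed
  then show ?thesis
    using M(1) by blast
qed

end

context semiabelian_variety
begin

section \<open>Normal epimorphisms are the surjective homomorphisms\<close>

text \<open>In the kernel pair of \<open>q\<close>, the pairs on whose components \<open>h\<close> agrees form a subalgebra. It contains
  the diagonal and the kernel of the map to \<open>Y\<close>, so \<open>short_five\<close> makes it the whole kernel pair.\<close>

lemma constant_on_fibres:
  assumes "X \<in> Obj V" "Y \<in> Obj V" "Z \<in> Obj V" "hom X Y q" "hom X Z h"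
    and vanish: "\<And>x. x \<in> ker X Y q \<Longrightarrow> h x = zero Z"
    and xy: "x \<in> carrier X" "y \<in> carrier X" "q x = q y"
  shows "h x = h y"
proof -
  obtain P p1 p2 where P: "P \<in> Obj V" "hom P X p1" "hom P X p2"
    and pairs: "(\<lambda>r. (p1 r, p2 r)) ` carrier P = {(a, b). a \<in> carrier X \<and> b \<in> carrier X \<and> q a = q b}"
    and "\<forall>D a b. D \<in> Obj V \<longrightarrow> hom D X a \<longrightarrow> hom D X b \<longrightarrow> (\<forall>x \<in> carrier D. q (a x) = q (b x)) \<longrightarrow>
       (\<exists>u. hom D P u \<and> (\<forall>x \<in> carrier D. p1 (u x) = a x \<and> p2 (u x) = b x))"
    by (rule fibre_product[OF assms(1,1,4,4)])
  let ?M = "{r \<in> carrier P. h (p1 r) = h (p2 r)}"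
  have in_pairs: "p1 r \<in> carrier X" "p2 r \<in> carrier X" "q (p1 r) = q (p2 r)" if "r \<in> carrier P" for r
  proof -
    have "(p1 r, p2 r) \<in> {(a, b). a \<in> carrier X \<and> b \<in> carrier X \<and> q a = q b}"
      using that unfolding pairs[symmetric] by blast
    then show "p1 r \<in> carrier X" "p2 r \<in> carrier X" "q (p1 r) = q (p2 r)"
      by auto
  qed
  have ex_pair: "\<exists>r \<in> carrier P. p1 r = a \<and> p2 r = b"
    if "a \<in> carrier X" "b \<in> carrier X" "q a = q b" for a b
  proof -
    have "(a, b) \<in> (\<lambda>r. (p1 r, p2 r)) ` carrier P"
      unfolding pairs using that by simp
    then show ?thesis
      by auto
  qed
  have "?M = carrier P"
  proof (rule short_five[OF P(1) assms(2) hom_compose[OF P(1,2) assms(4)]])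
    show "closed S ?M (oper P)"
      by (rule closed_equalizer[OF closed_carrier[OF P(1)]
            preserving_comp[OF hom_hom_on[OF P(2)] hom_hom_on[OF assms(5)]]
            preserving_comp[OF hom_hom_on[OF P(3)] hom_hom_on[OF assms(5)]]])
    show "ker P Y (compose (carrier P) q p1) \<subseteq> ?M"
    proof
      fix r assume "r \<in> ker P Y (compose (carrier P) q p1)"
      then have r: "r \<in> carrier P" "q (p1 r) = zero Y"
        by (auto simp: compose_def)
      then have "p1 r \<in> ker X Y q" "p2 r \<in> ker X Y q"
        using in_pairs[OF r(1)] by auto
      then show "r \<in> ?M"
        using vanish r(1) by simp
    qed
    fix r assume r: "r \<in> carrier P"
    obtain m where "m \<in> carrier P" "p1 m = p1 r" "p2 m = p1 r"
      using ex_pair[OF in_pairs(1)[OF r] in_pairs(1)[OF r] refl] by blast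
    then show "\<exists>m \<in> ?M. compose (carrier P) q p1 m = compose (carrier P) q p1 r"
      using r by (intro bexI[of _ m]) (auto simp: compose_def)
  qed auto
  then show ?thesis
    using ex_pair[OF xy] by blast
qed

lemma cokernelI:
  assumes "A \<in> Obj V" "B \<in> Obj V" "Q \<in> Obj V" "hom A B h" "hom B Q e" "e ` carrier B = carrier Q"
    and zero: "\<And>a. a \<in> carrier A \<Longrightarrow> e (h a) = zero Q"
    and compat: "\<And>D g x y. D \<in> Obj V \<Longrightarrow> hom B D g \<Longrightarrow> \<forall>a \<in> carrier A. g (h a) = zero D \<Longrightarrow>
      x \<in> carrier B \<Longrightarrow> y \<in> carrier B \<Longrightarrow> e x = e y \<Longrightarrow> g x = g y"
  shows "is_cokernel V (B, e, Q) (A, h, B)"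
  unfolding is_cokernel_def
proof (intro conjI ballI impI)
  show "(B, e, Q) \<in> Arr V" "(A, h, B) \<in> Arr V" "Dom V (B, e, Q) = Cod V (A, h, B)"
    using assms(1-5) by (simp_all add: Arr_V)
  show "is_zero_arrow V ((B, e, Q) \<cdot>\<^bsub>V\<^esub> (A, h, B))"
    using zero by (subst zero_comp_iff[OF assms(1-5)]) blast
  fix g assume g: "g \<in> Arr V" "Dom V g = Cod V (A, h, B)" "is_zero_arrow V (g \<cdot>\<^bsub>V\<^esub> (A, h, B))"
  then obtain D g' where D: "g = (B, g', D)" "D \<in> Obj V" "hom B D g'"
    by (auto elim!: Arr_VE)
  then have vanish: "\<forall>a \<in> carrier A. g' (h a) = zero D"
    using g(3) zero_comp_iff[OF assms(1,2) D(2) assms(4) D(3)] by simp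
  show "\<exists>!u. u \<in> Hom V (Cod V (B, e, Q)) (Cod V g) \<and> u \<cdot>\<^bsub>V\<^esub> (B, e, Q) = g"
    unfolding D(1) V_simps(2)
    by (rule factor_through_surjective[OF assms(2,3) D(2) assms(5,6) D(3)])
      (rule compat[OF D(2,3) vanish])
qed

text \<open>Elements of \<open>B\<close> are identified when no homomorphism that annihilates \<open>h\<close> distinguishes them.\<close>

lemma ex_cokernel:
  assumes "A \<in> Obj V" "B \<in> Obj V" "hom A B h"
  shows "\<exists>q. is_cokernel V q (A, h, B)"
proof -
  define H where "H = {(g, D). D \<in> Obj V \<and> hom B D g \<and> (\<forall>a \<in> carrier A. g (h a) = zero D)}"
  have H: "D \<in> Obj V \<and> hom_on (carrier B) (oper B) D g" if "(g, D) \<in> H" for g D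
    using that by (auto simp: H_def hom_iff)
  obtain Q \<kappa> where Q: "Q \<in> Obj V" "hom_on (carrier B) (oper B) Q \<kappa>" "\<kappa> ` carrier B = carrier Q"
    and sep: "\<And>x y. x \<in> carrier B \<Longrightarrow> y \<in> carrier B \<Longrightarrow> \<kappa> x = \<kappa> y \<longleftrightarrow> (\<forall>(h, B) \<in> H. h x = h y)"
    using separated_quotient[OF small_elems closed_carrier[OF assms(2)] H] by blast
  let ?e = "restrict \<kappa> (carrier B)"
  have e: "hom B Q ?e" "?e ` carrier B = carrier Q"
    using hom_restrict[OF assms(2) Q(2)] Q(3) by auto
  have "is_cokernel V (B, ?e, Q) (A, h, B)"
  proof (rule cokernelI[OF assms(1,2) Q(1) assms(3) e])
    fix a assume a: "a \<in> carrier A"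
    have "g (h a) = g (zero B)" if "(g, D) \<in> H" for g D
      using that a hom_zero[OF assms(2)] by (auto simp: H_def)
    then have "\<kappa> (h a) = \<kappa> (zero B)"
      using sep hom_in[OF assms(3) a] zero_in[OF assms(2)] by blast
    then show "?e (h a) = zero Q"
      using hom_zero[OF assms(2) Q(1) e(1)] hom_in[OF assms(3) a] zero_in[OF assms(2)] by simp
  next
    fix D g x y
    assume g: "D \<in> Obj V" "hom B D g" "\<forall>a \<in> carrier A. g (h a) = zero D"
      and xy: "x \<in> carrier B" "y \<in> carrier B" "?e x = ?e y"
    have "(g, D) \<in> H"
      using g by (simp add: H_def)
    moreover have "\<kappa> x = \<kappa> y"
      using xy by simp
    ultimately show "g x = g y"
      using sep[OF xy(1,2)] by blast
  qed
  then show ?thesis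
    by blast
qed

lemma kernels_and_cokernels: "with_kernels_and_cokernels V"
  unfolding with_kernels_and_cokernels_def
proof (intro conjI ballI)
  fix f assume "f \<in> Arr V"
  then obtain A h B where f: "f = (A, h, B)" "A \<in> Obj V" "B \<in> Obj V" "hom A B h"
    by (rule Arr_VE)
  show "\<exists>k. is_kernel V k f"
    unfolding f(1) by (rule ex_kernel[OF f(2-4)]) blast
  show "\<exists>q. is_cokernel V q f"
    unfolding f(1) by (rule ex_cokernel[OF f(2-4)])
qed (rule pointed)

text \<open>The corestriction of a cokernel to its image still annihilates the given arrow, so the
  inclusion of the image has a section.\<close>

lemma surjective_if_normal_epi:
  assumes "normal_epi V (X, e, Y)"
  shows "e ` carrier X = carrier Y"
proof -
  obtain g where coker: "is_cokernel V (X, e, Y) g"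
    using assms by (auto simp: normal_epi_def)
  then have Arr: "(X, e, Y) \<in> Arr V" "g \<in> Arr V" "Cod V g = X"
    by (auto simp: is_cokernel_def)
  then have e: "X \<in> Obj V" "Y \<in> Obj V" "hom X Y e"
    by (auto simp: Arr_V)
  obtain A g' where g: "g = (A, g', X)" "A \<in> Obj V" "hom A X g'"
    using Arr(2,3) by (auto elim!: Arr_VE)
  have zero: "e (g' a) = zero Y" if "a \<in> carrier A" for a
    using coker that zero_comp_iff[OF g(2) e(1,2) g(3) e(3)] unfolding is_cokernel_def g(1) by blast
  have univ: "\<exists>!u. u \<in> Hom V Y D \<and> u \<cdot>\<^bsub>V\<^esub> (X, e, Y) = (X, h, D)"
    if "D \<in> Obj V" "hom X D h" "\<forall>a \<in> carrier A. h (g' a) = zero D" for D h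
  proof -
    have "(X, h, D) \<in> Arr V" "is_zero_arrow V ((X, h, D) \<cdot>\<^bsub>V\<^esub> g)"
      unfolding g(1) zero_comp_iff[OF g(2) e(1) that(1) g(3) that(2)] using that e by (auto simp: Arr_V)
    note h = this
    have "\<forall>h \<in> Arr V. Dom V h = Cod V g \<longrightarrow> is_zero_arrow V (h \<cdot>\<^bsub>V\<^esub> g) \<longrightarrow>
        (\<exists>!u. u \<in> Hom V (Cod V (X, e, Y)) (Cod V h) \<and> u \<cdot>\<^bsub>V\<^esub> (X, e, Y) = h)"
      using coker unfolding is_cokernel_def by (elim conjE) assumption
    from bspec[OF this h(1)] show ?thesis
      using Arr(3) h(2) by (simp only: V_simps(1,2) simp_thms)
  qed
  obtain I \<iota> where I: "I \<in> Obj V" "hom I Y \<iota>" "inj_on \<iota> (carrier I)" "\<iota> ` carrier I = e ` carrier X"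
  proof (rule subalgebra[OF e(2)])
    show "e ` carrier X \<subseteq> carrier Y"
      using hom_in[OF e(3)] by auto
    show "closed S (e ` carrier X) (oper Y)"
      by (rule closed_image[OF closed_carrier[OF e(1)] hom_hom_on[OF e(3)]])
  qed
  obtain e' where e': "hom X I e'" "(I, \<iota>, Y) \<cdot>\<^bsub>V\<^esub> (X, e', I) = (X, e, Y)"
    using lift_through_injective[OF I(1) e(2,1) I(2,3) e(3)] I(4) by (auto simp only: Hom_V)
  have \<iota>e': "\<iota> (e' x) = e x" if "x \<in> carrier X" for x
    using e'(2) comp_eq_iff[OF e(3)] that by blast
  have "e' (g' a) = zero I" if a: "a \<in> carrier A" for a
  proof (rule inj_onD[OF I(3)])
    show "\<iota> (e' (g' a)) = \<iota> (zero I)"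
      using \<iota>e'[OF hom_in[OF g(3) a]] zero[OF a] hom_zero[OF I(1) e(2) I(2)] by simp
  qed (use hom_in[OF e'(1) hom_in[OF g(3) a]] zero_in[OF I(1)] in auto)
  from univ[OF I(1) e'(1)] this obtain u
    where u: "hom Y I u" "(Y, u, I) \<cdot>\<^bsub>V\<^esub> (X, e, Y) = (X, e', I)"
    by (auto simp only: Hom_V)
  have ue: "u (e x) = e' x" if "x \<in> carrier X" for x
    using u(2) comp_eq_iff[OF e'(1)] that by blast
  have id: "hom Y Y (\<lambda>y \<in> carrier Y. y)"
    by (rule hom_restrict[OF e(2)]) (simp add: preserving_def)
  have \<iota>u: "hom Y Y (compose (carrier Y) \<iota> u)"
    by (rule hom_compose[OF e(2) u(1) I(2)])
  have eq: "(Y, compose (carrier Y) \<iota> u, Y) \<cdot>\<^bsub>V\<^esub> (X, e, Y) = (X, e, Y)"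
    unfolding comp_eq_iff[OF e(3)] using ue \<iota>e' hom_in[OF e(3)] by (simp add: compose_def)
  have eq': "(Y, \<lambda>y \<in> carrier Y. y, Y) \<cdot>\<^bsub>V\<^esub> (X, e, Y) = (X, e, Y)"
    unfolding comp_eq_iff[OF e(3)] using hom_in[OF e(3)] by simp
  have "(Y, compose (carrier Y) \<iota> u, Y) = (Y, \<lambda>y \<in> carrier Y. y, Y)"
    using univ[OF e(2,3)] zero id \<iota>u eq eq' e(2) by (auto simp only: Hom_V)
  then have eq_id: "compose (carrier Y) \<iota> u = (\<lambda>y \<in> carrier Y. y)"
    by simp
  have "\<iota> (u y) = y" if "y \<in> carrier Y" for y
    using fun_cong[OF eq_id, of y] that by (simp add: compose_def)
  then have "y \<in> \<iota> ` carrier I" if "y \<in> carrier Y" for y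
    using that hom_in[OF u(1)] by (metis imageI)
  then show ?thesis
    using I(4) hom_in[OF e(3)] by auto
qed

lemma normal_epi_iff_surjective:
  assumes "X \<in> Obj V" "Y \<in> Obj V" "hom X Y e"
  shows "normal_epi V (X, e, Y) \<longleftrightarrow> e ` carrier X = carrier Y"
proof
  assume surj: "e ` carrier X = carrier Y"
  obtain N k where N: "N \<in> Obj V" "hom N X k" "inj_on k (carrier N)" "k ` carrier N = ker X Y e"
    "is_kernel V (N, k, X) (X, e, Y)"
    by (rule ex_kernel[OF assms])
  have "is_cokernel V (X, e, Y) (N, k, X)"
  proof (rule cokernelI[OF N(1) assms(1,2) N(2) assms(3) surj])
    show "e (k a) = zero Y" if "a \<in> carrier N" for a
      using that N(4) by blast
    fix D g x y
    assume g: "D \<in> Obj V" "hom X D g" "\<forall>a \<in> carrier N. g (k a) = zero D"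
      and xy: "x \<in> carrier X" "y \<in> carrier X" "e x = e y"
    have "g z = zero D" if "z \<in> ker X Y e" for z
      using that g(3) unfolding N(4)[symmetric] by auto
    then show "g x = g y"
      by (rule constant_on_fibres[OF assms(1,2) g(1) assms(3) g(2) _ xy])
  qed
  then show "normal_epi V (X, e, Y)"
    by (auto simp: normal_epi_def)
qed (rule surjective_if_normal_epi)

text \<open>The algebra of pairs maps into any given pullback, and its projection is surjective because \<open>e\<close>
  is; so the projection of the given pullback is surjective too.\<close>

lemma normal_epis_pullback_stable: "pullback_stable_normal_epis V"
  unfolding pullback_stable_normal_epis_def
proof (intro allI impI conjI)
  fix e g assume e: "normal_epi V e" and g: "g \<in> Arr V" "Cod V g = Cod V e"
  have e_Arr: "e \<in> Arr V"
    using e by (auto simp: normal_epi_def is_cokernel_def)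
  have "has_pullbacks V"
    using semi_abelian by (simp add: semi_abelian_def protomodular_def)
  then show "\<exists>p q. is_pullback V e g p q"
    using e_Arr g by (simp add: has_pullbacks_def)
  fix p q assume pb: "is_pullback V e g p q"
  obtain X e' Y where e': "e = (X, e', Y)" "X \<in> Obj V" "Y \<in> Obj V" "hom X Y e'"
    using e_Arr by (rule Arr_VE)
  obtain W g' where g': "g = (W, g', Y)" "W \<in> Obj V" "hom W Y g'"
    using g e'(1) by (auto elim!: Arr_VE)
  have pq: "p \<in> Arr V" "q \<in> Arr V" "Dom V p = Dom V q" "Cod V p = X" "Cod V q = W"
    using pb e'(1) g'(1) by (auto simp: is_pullback_def)
  obtain P p' where p': "p = (P, p', X)" "P \<in> Obj V" "hom P X p'"
    using pq(1,4) by (auto elim!: Arr_VE)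
  obtain q' where q': "q = (P, q', W)" "hom P W q'"
    using pq(2,3,5) p'(1) by (auto elim!: Arr_VE)
  have "w \<in> q' ` carrier P" if w: "w \<in> carrier W" for w
  proof -
    obtain R r1 r2 where R: "R \<in> Obj V" "hom R X r1" "hom R W r2"
      and pairs: "(\<lambda>r. (r1 r, r2 r)) ` carrier R = {(a, b). a \<in> carrier X \<and> b \<in> carrier W \<and> e' a = g' b}"
      and "\<forall>D a b. D \<in> Obj V \<longrightarrow> hom D X a \<longrightarrow> hom D W b \<longrightarrow> (\<forall>x \<in> carrier D. e' (a x) = g' (b x)) \<longrightarrow>
        (\<exists>u. hom D R u \<and> (\<forall>x \<in> carrier D. r1 (u x) = a x \<and> r2 (u x) = b x))"
      by (rule fibre_product[OF e'(2) g'(2) e'(4) g'(3)])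
    have "e' (r1 r) = g' (r2 r)" if "r \<in> carrier R" for r
    proof -
      have "(r1 r, r2 r) \<in> {(a, b). a \<in> carrier X \<and> b \<in> carrier W \<and> e' a = g' b}"
        using that unfolding pairs[symmetric] by blast
      then show ?thesis
        by simp
    qed
    then have comm: "(X, e', Y) \<cdot>\<^bsub>V\<^esub> (R, r1, X) = (W, g', Y) \<cdot>\<^bsub>V\<^esub> (R, r2, W)"
      by (auto simp: compose_def)
    have "\<forall>x \<in> Obj V. \<forall>a \<in> Hom V x X. \<forall>b \<in> Hom V x W. (X, e', Y) \<cdot>\<^bsub>V\<^esub> a = (W, g', Y) \<cdot>\<^bsub>V\<^esub> b \<longrightarrow>
        (\<exists>!u. u \<in> Hom V x P \<and> (P, p', X) \<cdot>\<^bsub>V\<^esub> u = a \<and> (P, q', W) \<cdot>\<^bsub>V\<^esub> u = b)"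
      using pb unfolding is_pullback_def e'(1) g'(1) p'(1) q'(1) V_simps(1,2) by (elim conjE) assumption
    moreover have "(R, r1, X) \<in> Hom V R X" "(R, r2, W) \<in> Hom V R W"
      using R e'(2) g'(2) by (auto simp: Hom_V)
    ultimately obtain u where u: "u \<in> Hom V R P" "(P, q', W) \<cdot>\<^bsub>V\<^esub> u = (R, r2, W)"
      using R(1) comm by blast
    then obtain u' where u': "u = (R, u', P)" "hom R P u'"
      by (auto simp: Hom_V)
    then have q'u': "q' (u' r) = r2 r" if "r \<in> carrier R" for r
      using u(2) comp_eq_iff[OF R(3)] that by blast
    have "g' w \<in> e' ` carrier X"
      using surjective_if_normal_epi e hom_in[OF g'(3) w] unfolding e'(1) by blast
    then obtain x where "x \<in> carrier X" "e' x = g' w"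
      by auto
    then have "(x, w) \<in> (\<lambda>r. (r1 r, r2 r)) ` carrier R"
      unfolding pairs using w by simp
    then obtain r where "r \<in> carrier R" "r2 r = w"
      by auto
    then show ?thesis
      using q'u' hom_in[OF u'(2)] by (metis imageI)
  qed
  then have "q' ` carrier P = carrier W"
    using hom_in[OF q'(2)] by auto
  then show "normal_epi V q"
    unfolding q'(1) normal_epi_iff_surjective[OF p'(2) g'(2) q'(2)] .
qed

section \<open>Free algebras are normal-projective\<close>

text \<open>The free algebra on the elements of \<open>Q\<close> consists of the terms modulo equality of values under all
  valuations in algebras of the variety. A homomorphism out of it lifts through a surjection by
  choosing preimages for the generators.\<close>

lemma enough_projectives: "enough_normal_projectives V"
  unfolding enough_normal_projectives_def
proof
  fix Q assume Q: "Q \<in> Obj V"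
  let ?T = "gterms S (carrier Q)"
  define H where "H = {(gterm_eval (oper A) \<rho>, A) | A \<rho>. A \<in> Obj V \<and> \<rho> ` carrier Q \<subseteq> carrier A}"
  have eval_hom: "hom_on ?T Op A (gterm_eval (oper A) \<rho>)"
    if "A \<in> Obj V" "\<rho> ` carrier Q \<subseteq> carrier A" for A \<rho>
    by (rule preserving_gterm_eval[OF closed_carrier[OF that(1)] that(2)])
  have H: "A \<in> Obj V \<and> hom_on ?T Op A h" if "(h, A) \<in> H" for h A
    using that eval_hom by (auto simp: H_def)
  have small: "small mem ?T"
    using variety by (intro small_gterms small_elems) (simp add: variety_def)
  obtain P \<kappa> where P: "P \<in> Obj V" "hom_on ?T Op P \<kappa>" "\<kappa> ` ?T = carrier P"
    and sep: "\<And>s t. s \<in> ?T \<Longrightarrow> t \<in> ?T \<Longrightarrow> \<kappa> s = \<kappa> t \<longleftrightarrow> (\<forall>(h, A) \<in> H. h s = h t)"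
    using separated_quotient[OF small closed_gterms H] by blast
  \<comment> \<open>the universal property of the free algebra\<close>
  have free: "\<exists>g. hom P A g \<and> (\<forall>t \<in> ?T. g (\<kappa> t) = gterm_eval (oper A) \<rho> t)"
    if "A \<in> Obj V" "\<rho> ` carrier Q \<subseteq> carrier A" for A \<rho>
  proof (rule hom_factor[OF closed_gterms P(2,3,1) eval_hom[OF that]])
    fix s t assume "s \<in> ?T" "t \<in> ?T" "\<kappa> s = \<kappa> t"
    moreover have "(gterm_eval (oper A) \<rho>, A) \<in> H"
      using that by (auto simp: H_def)
    ultimately show "gterm_eval (oper A) \<rho> s = gterm_eval (oper A) \<rho> t"
      using sep by blast
  qed
  have "normal_projective V P"
    unfolding normal_projective_def
  proof (intro conjI allI impI)
    fix e f assume e: "normal_epi V e" and f: "f \<in> Hom V P (Cod V e)"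
    have "e \<in> Arr V"
      using e by (auto simp: normal_epi_def is_cokernel_def)
    then obtain X e' Y where e': "e = (X, e', Y)" "X \<in> Obj V" "Y \<in> Obj V" "hom X Y e'"
      by (rule Arr_VE)
    obtain f' where f': "f = (P, f', Y)" "hom P Y f'"
      using f e'(1) by (auto simp: Hom_V)
    have surj: "e' ` carrier X = carrier Y"
      using surjective_if_normal_epi e e'(1) by blast
    define \<rho> where "\<rho> x = inv_into (carrier X) e' (f' (\<kappa> (Gen x)))" for x
    have \<rho>: "\<rho> x \<in> carrier X" "e' (\<rho> x) = f' (\<kappa> (Gen x))" if "x \<in> carrier Q" for x
    proof -
      have "\<kappa> (Gen x) \<in> carrier P"
        by (rule preservingD(1)[OF P(2) gterms.Gen[OF that]])
      then have "f' (\<kappa> (Gen x)) \<in> e' ` carrier X"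
        using hom_in[OF f'(2)] surj by blast
      then show "\<rho> x \<in> carrier X" "e' (\<rho> x) = f' (\<kappa> (Gen x))"
        unfolding \<rho>_def by (rule inv_into_into, rule f_inv_into_f)
    qed
    then have \<rho>_range: "\<rho> ` carrier Q \<subseteq> carrier X"
      by auto
    obtain g where g: "hom P X g" "\<And>t. t \<in> ?T \<Longrightarrow> g (\<kappa> t) = gterm_eval (oper X) \<rho> t"
      using free[OF e'(2) \<rho>_range] by blast
    have "e' (g y) = f' y" if "y \<in> carrier P" for y
    proof -
      obtain t where t: "t \<in> ?T" "y = \<kappa> t"
        using \<open>y \<in> carrier P\<close> unfolding P(3)[symmetric] by blast
      have "e' (gterm_eval (oper X) \<rho> t) = f' (\<kappa> t)"
      proof (rule preserving_gterms_eq[OF t(1)])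
        show "hom_on ?T Op Y (\<lambda>t. e' (gterm_eval (oper X) \<rho> t))"
          by (rule preserving_comp[OF eval_hom[OF e'(2) \<rho>_range] hom_hom_on[OF e'(4)]])
        show "hom_on ?T Op Y (\<lambda>t. f' (\<kappa> t))"
          by (rule preserving_comp[OF P(2) hom_hom_on[OF f'(2)]])
      qed (simp add: \<rho>(2))
      then show ?thesis
        using g(2)[OF t(1)] t(2) by simp
    qed
    then have "(X, e', Y) \<cdot>\<^bsub>V\<^esub> (P, g, X) = (P, f', Y)"
      using comp_eq_iff[OF f'(2)] by blast
    moreover have "(P, g, X) \<in> Hom V P (Dom V e)"
      using P(1) e'(1,2) g(1) by (simp add: Hom_V)
    ultimately show "\<exists>g \<in> Hom V P (Dom V e). e \<cdot>\<^bsub>V\<^esub> g = f"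
      unfolding e'(1) f'(1) by blast
  qed (rule P(1))
  moreover have "(\<lambda>x. x) ` carrier Q \<subseteq> carrier Q"
    by simp
  from free[OF Q this] obtain e
    where e: "hom P Q e" "\<And>t. t \<in> ?T \<Longrightarrow> e (\<kappa> t) = gterm_eval (oper Q) (\<lambda>x. x) t"
    by blast
  have "x \<in> e ` carrier P" if "x \<in> carrier Q" for x
  proof -
    have Gen: "Gen x \<in> ?T"
      using that by (rule gterms.Gen)
    then have "x = e (\<kappa> (Gen x))"
      using e(2)[of "Gen x"] by simp
    then show ?thesis
      using preservingD(1)[OF P(2) Gen] by (rule image_eqI)
  qed
  then have "e ` carrier P = carrier Q"
    using hom_in[OF e(1)] by auto
  then have "normal_epi V (P, e, Q)"
    using normal_epi_iff_surjective[OF P(1) Q e(1)] by blast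
  moreover have "(P, e, Q) \<in> Hom V P Q"
    using P(1) Q e(1) by (simp add: Hom_V)
  ultimately show "\<exists>P. \<exists>e \<in> Hom V P Q. normal_projective V P \<and> normal_epi V e"
    by blast
qed

end

section \<open>Extensions of algebras are bounded by the terms in their ends\<close>

lemma (in cat) exact_sequence_1:
  assumes "exact_sequence C 1 Q K f"
  shows "short_exact C (f 2) (f 1)" "Dom C (f 2) = K" "Cod C (f 1) = Q"
proof -
  note D = exact_sequenceD[OF assms]
  have f: "f 1 \<in> Arr C" "f 2 \<in> Arr C" "Dom C (f 2) = K" "Cod C (f 1) = Q"
    using D(2,3) D(5)[of 1] D(5)[of 2] by (simp_all add: numeral_2_eq_2)
  show "Dom C (f 2) = K" "Cod C (f 1) = Q"
    by fact+
  have Obj: "K \<in> Obj C" "Q \<in> Obj C"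
    using f by auto
  obtain m e where
    me: "\<And>i. i \<in> {1..1+1} \<Longrightarrow> normal_epi C (e i) \<and> normal_mono C (m i) \<and>
      Cod C (e i) = Dom C (m i) \<and> f i = m i \<cdot> e i"
    and ends: "e (1+1) = Ide C K" "m 1 = Ide C Q"
    and exact: "\<And>i. i \<in> {1..1} \<Longrightarrow> short_exact C (m (i+1)) (e i)"
    using assms unfolding exact_sequence_def by blast
  have e1: "e 1 \<in> Arr C" "Cod C (e 1) = Q" "f 1 = Ide C Q \<cdot> e 1"
    using me[of 1] ends(2) Obj by (auto simp: normal_epi_def is_cokernel_def)
  have m2: "m 2 \<in> Arr C" "Dom C (m 2) = K" "f 2 = m 2 \<cdot> Ide C K"
    using me[of 2] ends(1) Obj by (auto simp: normal_mono_def is_kernel_def numeral_2_eq_2)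
  have "f 1 = e 1" "f 2 = m 2"
    using e1 m2 by simp_all
  then show "short_exact C (f 2) (f 1)"
    using exact[of 1] by (simp add: numeral_2_eq_2)
qed

context semiabelian_variety
begin

abbreviation "generators K Q \<equiv> carrier K <+> carrier Q"

text \<open>On \<open>Q\<close> the valuation is a section of \<open>q\<close> as a map of sets; it is rarely a homomorphism.\<close>

definition valuation :: "('f, 'u) algebra \<Rightarrow> ('u \<Rightarrow> 'u) \<Rightarrow> ('u \<Rightarrow> 'u) \<Rightarrow> 'u + 'u \<Rightarrow> 'u" where
  "valuation X k q = case_sum k (inv_into (carrier X) q)"

text \<open>The values of terms form a subalgebra that contains \<open>K\<close>, hence the kernel of \<open>q\<close>, and one element of
  each fibre of \<open>q\<close>.\<close>

lemma extension_generated: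
  assumes "X \<in> Obj V" "Q \<in> Obj V" "hom K X k" "hom X Q q"
    and ker: "ker X Q q \<subseteq> k ` carrier K" and surj: "q ` carrier X = carrier Q"
  shows "valuation X k q ` generators K Q \<subseteq> carrier X"
    and "gterm_eval (oper X) (valuation X k q) ` gterms S (generators K Q) = carrier X"
proof -
  let ?\<rho> = "valuation X k q" and ?T = "gterms S (generators K Q)"
  have preimage: "inv_into (carrier X) q b \<in> carrier X" "q (inv_into (carrier X) q b) = b"
    if "b \<in> carrier Q" for b
    using that unfolding surj[symmetric] by (rule inv_into_into, rule f_inv_into_f)
  show \<rho>: "?\<rho> ` generators K Q \<subseteq> carrier X"
    using preimage hom_in[OF assms(3)] by (auto simp: valuation_def)
  note eval = preserving_gterm_eval[OF closed_carrier[OF assms(1)] \<rho>]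
  have gen: "?\<rho> x \<in> gterm_eval (oper X) ?\<rho> ` ?T" if "x \<in> generators K Q" for x
    using gterms.Gen[OF that] by (intro image_eqI[of _ _ "Gen x"]) auto
  show "gterm_eval (oper X) ?\<rho> ` ?T = carrier X"
  proof (rule short_five[OF assms(1,2,4)])
    show "gterm_eval (oper X) ?\<rho> ` ?T \<subseteq> carrier X"
      using preservingD(1)[OF eval] by blast
    show "closed S (gterm_eval (oper X) ?\<rho> ` ?T) (oper X)"
      by (rule closed_image[OF closed_gterms eval])
    have "k a \<in> gterm_eval (oper X) ?\<rho> ` ?T" if "a \<in> carrier K" for a
      using gen[OF InlI[OF that]] by (simp add: valuation_def)
    then show "ker X Q q \<subseteq> gterm_eval (oper X) ?\<rho> ` ?T"
      using ker by blast
    fix x assume "x \<in> carrier X"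
    then have "q x \<in> carrier Q"
      by (rule hom_in[OF assms(4)])
    then have "?\<rho> (Inr (q x)) \<in> gterm_eval (oper X) ?\<rho> ` ?T" "q (?\<rho> (Inr (q x))) = q x"
      using gen[OF InrI] preimage(2) by (simp_all add: valuation_def)
    then show "\<exists>m \<in> gterm_eval (oper X) ?\<rho> ` ?T. q m = q x"
      by blast
  qed
qed

text \<open>Since every element of \<open>X\<close> is the value of a term, sending it to the value of the same term in \<open>Y\<close>
  defines a homomorphism. It respects the ends of the extensions because it does so on the
  generators.\<close>

lemma extension_comparison:
  assumes "Q \<in> Obj V"
    and X: "X \<in> Obj V" "hom K X k" "hom X Q q" "ker X Q q \<subseteq> k ` carrier K" "q ` carrier X = carrier Q"
    and Y: "Y \<in> Obj V" "hom K Y k'" "hom Y Q q'" "ker Y Q q' \<subseteq> k' ` carrier K" "q' ` carrier Y = carrier Q"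
    and kq: "\<And>a. a \<in> carrier K \<Longrightarrow> q (k a) = zero Q" "\<And>a. a \<in> carrier K \<Longrightarrow> q' (k' a) = zero Q"
    and compat: "\<And>s t. s \<in> gterms S (generators K Q) \<Longrightarrow> t \<in> gterms S (generators K Q) \<Longrightarrow>
      gterm_eval (oper X) (valuation X k q) s = gterm_eval (oper X) (valuation X k q) t \<Longrightarrow>
      gterm_eval (oper Y) (valuation Y k' q') s = gterm_eval (oper Y) (valuation Y k' q') t"
  shows "\<exists>h. hom X Y h \<and> (\<forall>a \<in> carrier K. h (k a) = k' a) \<and> (\<forall>x \<in> carrier X. q' (h x) = q x)"
proof -
  let ?T = "gterms S (generators K Q)"
  let ?v = "gterm_eval (oper X) (valuation X k q)" and ?w = "gterm_eval (oper Y) (valuation Y k' q')"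
  note genX = extension_generated[OF X(1) assms(1) X(2-5)]
  note genY = extension_generated[OF Y(1) assms(1) Y(2-5)]
  have v: "hom_on ?T Op X ?v"
    by (rule preserving_gterm_eval[OF closed_carrier[OF X(1)] genX(1)])
  have w: "hom_on ?T Op Y ?w"
    by (rule preserving_gterm_eval[OF closed_carrier[OF Y(1)] genY(1)])
  obtain h where h: "hom X Y h" "\<And>t. t \<in> ?T \<Longrightarrow> h (?v t) = ?w t"
    using hom_factor[OF closed_gterms v genX(2) X(1) w compat] by blast
  have "h (k a) = k' a" if "a \<in> carrier K" for a
    using h(2)[OF gterms.Gen[OF InlI[OF that]]] by (simp add: valuation_def)
  moreover have "q' (h x) = q x" if "x \<in> carrier X" for x
  proof -
    obtain t where t: "t \<in> ?T" "x = ?v t"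
      using \<open>x \<in> carrier X\<close> unfolding genX(2)[symmetric] by blast
    have "q' (?w t) = q (?v t)"
    proof (rule preserving_gterms_eq[OF t(1)])
      show "hom_on ?T Op Q (\<lambda>t. q' (?w t))"
        by (rule preserving_comp[OF w hom_hom_on[OF Y(3)]])
      show "hom_on ?T Op Q (\<lambda>t. q (?v t))"
        by (rule preserving_comp[OF v hom_hom_on[OF X(3)]])
      fix x assume x: "x \<in> generators K Q"
      have "q (inv_into (carrier X) q b) = b" "q' (inv_into (carrier Y) q' b) = b" if "b \<in> carrier Q" for b
        using f_inv_into_f[of b q "carrier X"] f_inv_into_f[of b q' "carrier Y"] that X(5) Y(5) by simp_all
      then show "q' (?w (Gen x)) = q (?v (Gen x))"
        using x kq by (auto simp: valuation_def)
    qed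
    then show ?thesis
      using h(2)[OF t(1)] t(2) by simp
  qed
  ultimately show ?thesis
    using h(1) by blast
qed

lemma exact_sequence_1_algebras:
  assumes "exact_sequence V 1 Q K f"
  obtains X k q where "f 2 = (K, k, X)" "f 1 = (X, q, Q)" "X \<in> Obj V" "hom K X k" "hom X Q q"
    "ker X Q q \<subseteq> k ` carrier K" "q ` carrier X = carrier Q" "\<forall>a \<in> carrier K. q (k a) = zero Q"
proof -
  have exact: "is_kernel V (f 2) (f 1)" "is_cokernel V (f 1) (f 2)"
    and ends: "Dom V (f 2) = K" "Cod V (f 1) = Q"
    using exact_sequence_1[OF assms] by (auto simp: short_exact_def)
  have f1: "f 1 \<in> Arr V" and f2: "f 2 \<in> Arr V" and mid: "Cod V (f 2) = Dom V (f 1)"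
    using exact(1) by (auto simp: is_kernel_def)
  obtain X q where q: "f 1 = (X, q, Q)" "X \<in> Obj V" "Q \<in> Obj V" "hom X Q q"
    using f1 ends(2) by (auto elim!: Arr_VE)
  obtain k where k: "f 2 = (K, k, X)" "K \<in> Obj V" "hom K X k"
    using f2 ends(1) mid q(1) by (auto elim!: Arr_VE)
  show ?thesis
  proof (rule that[OF k(1) q(1,2) k(3) q(4)])
    show "ker X Q q \<subseteq> k ` carrier K"
      by (rule ker_subset_image) (use exact(1) k(1) q(1) in simp)
    show "q ` carrier X = carrier Q"
      by (rule surjective_if_normal_epi) (use exact(2)[unfolded q(1)] in \<open>unfold normal_epi_def, blast\<close>)
    have "is_zero_arrow V ((X, q, Q) \<cdot>\<^bsub>V\<^esub> (K, k, X))"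
      using exact(1) k(1) q(1) by (simp only: is_kernel_def)
    then show "\<forall>a \<in> carrier K. q (k a) = zero Q"
      using zero_comp_iff[OF k(2) q(2,3) k(3) q(4)] by blast
  qed
qed

text \<open>The congruence that an extension induces on terms is a sufficient invariant.\<close>

lemma small_Ext_1:
  assumes "Q \<in> Obj V" "K \<in> Obj V"
  shows "small mem (Ext V 1 Q K)"
proof -
  let ?T = "gterms S (generators K Q)"
  define eval_in where "eval_in f = gterm_eval (oper (Dom V (f 1)))
    (valuation (Dom V (f 1)) (fst (snd (f 2))) (fst (snd (f 1))))"
    for f :: "nat \<Rightarrow> ('f, 'u) algebra \<times> ('u \<Rightarrow> 'u) \<times> ('f, 'u) algebra"
  define \<phi> where "\<phi> f = {(s, t). s \<in> ?T \<and> t \<in> ?T \<and> eval_in f s = eval_in f t}" for f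
  show ?thesis
  proof (rule small_Ext_if_invariant[where \<phi> = \<phi>])
    have "small mem (generators K Q)"
      unfolding Plus_def by (intro small_Un small_image small_elems)
    then have "small mem ?T"
      using variety by (intro small_gterms) (simp_all add: variety_def)
    then show "small mem (Pow (?T \<times> ?T))"
      by (intro small_Pow small_Sigma)
    show "\<phi> f \<in> Pow (?T \<times> ?T)" for f
      by (auto simp: \<phi>_def)
    fix f g assume f: "exact_sequence V 1 Q K f" and g: "exact_sequence V 1 Q K g" and eq: "\<phi> f = \<phi> g"
    obtain X k q where X: "f 2 = (K, k, X)" "f 1 = (X, q, Q)" "X \<in> Obj V" "hom K X k" "hom X Q q"
      "ker X Q q \<subseteq> k ` carrier K" "q ` carrier X = carrier Q" "\<forall>a \<in> carrier K. q (k a) = zero Q"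
      by (rule exact_sequence_1_algebras[OF f])
    obtain Y k' q' where Y: "g 2 = (K, k', Y)" "g 1 = (Y, q', Q)" "Y \<in> Obj V" "hom K Y k'" "hom Y Q q'"
      "ker Y Q q' \<subseteq> k' ` carrier K" "q' ` carrier Y = carrier Q" "\<forall>a \<in> carrier K. q' (k' a) = zero Q"
      by (rule exact_sequence_1_algebras[OF g])
    have eval_f: "eval_in f = gterm_eval (oper X) (valuation X k q)"
      unfolding eval_in_def X(1,2) by simp
    have eval_g: "eval_in g = gterm_eval (oper Y) (valuation Y k' q')"
      unfolding eval_in_def Y(1,2) by simp
    have "\<exists>h. hom X Y h \<and> (\<forall>a \<in> carrier K. h (k a) = k' a) \<and> (\<forall>x \<in> carrier X. q' (h x) = q x)"
    proof (rule extension_comparison[OF assms(1) X(3-7) Y(3-7) bspec[OF X(8)] bspec[OF Y(8)]])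
      fix s t assume "s \<in> ?T" "t \<in> ?T"
        "gterm_eval (oper X) (valuation X k q) s = gterm_eval (oper X) (valuation X k q) t"
      then have "(s, t) \<in> \<phi> f"
        by (simp add: \<phi>_def eval_f)
      then have "(s, t) \<in> \<phi> g"
        by (simp only: eq)
      then show "gterm_eval (oper Y) (valuation Y k' q') s = gterm_eval (oper Y) (valuation Y k' q') t"
        by (simp add: \<phi>_def eval_g)
    qed
    then obtain h where h: "hom X Y h" "\<forall>a \<in> carrier K. h (k a) = k' a" "\<forall>x \<in> carrier X. q' (h x) = q x"
      by blast
    define \<alpha> where "\<alpha> = (\<lambda>i \<in> {1..1 :: nat}. (X, h, Y))"
    have "exact_sequence_morphism V 1 f g \<alpha>"
      unfolding exact_sequence_morphism_def
    proof (intro conjI ballI)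
      show "\<alpha> \<in> (\<Pi>\<^sub>E i \<in> {1..1}. Hom V (Dom V (f i)) (Dom V (g i)))"
        using X(2,3) Y(2,3) h(1) by (simp add: \<alpha>_def Hom_V)
      have "(X, h, Y) \<cdot>\<^bsub>V\<^esub> (K, k, X) = (K, k', Y)"
        using comp_eq_iff[OF Y(4)] h(2) by blast
      then show "\<alpha> 1 \<cdot>\<^bsub>V\<^esub> f (1 + 1) = g (1 + 1)"
        using X(1) Y(1) by (simp add: \<alpha>_def numeral_2_eq_2)
      have "(Y, q', Q) \<cdot>\<^bsub>V\<^esub> (X, h, Y) = (X, q, Q)"
        using comp_eq_iff[OF X(5)] h(3) by blast
      then show "g 1 \<cdot>\<^bsub>V\<^esub> \<alpha> 1 = f 1"
        using X(2) Y(2) by (simp add: \<alpha>_def)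
    qed simp
    then show "(f, g) \<in> connected V 1 Q K"
      using f g by (auto simp: joined_def)
  qed
qed

section \<open>A variety is a category of the universe\<close>

text \<open>An algebra is encoded by its underlying set and the graph of its operations, the latter being
  a member of a small conglomerate that depends on the underlying set only.\<close>

lemma class_sized_Obj: "class_sized mem (Obj V)"
proof (rule class_sized_inj_on)
  let ?D = "\<lambda>u. ops S \<times> {xs. set xs \<subseteq> elems mem u}"
  define G where "G A = {((f, xs), oper A f xs) | f xs.
    f \<in> ops S \<and> length xs = arity S f \<and> set xs \<subseteq> carrier A}" for A :: "('f, 'u) algebra"
  show "inj_on (\<lambda>A. (underlying A, G A)) (Obj V)"
  proof (rule inj_onI)
    fix A B assume A: "A \<in> Obj V" and B: "B \<in> Obj V"
      and eq: "(underlying A, G A) = (underlying B, G B)"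
    have graph: "G A = G B"
      using eq by simp
    have "oper A f xs = oper B f xs" for f xs
    proof (cases "f \<in> ops S \<and> length xs = arity S f \<and> set xs \<subseteq> carrier A")
      case True
      then have "((f, xs), oper A f xs) \<in> G A"
        by (auto simp: G_def)
      then have "((f, xs), oper A f xs) \<in> G B"
        unfolding graph .
      then show ?thesis
        by (auto simp: G_def)
    next
      case False
      then show ?thesis
        using A B eq unfolding Obj_V is_algebra_def by (metis prod.inject)
    qed
    then show "A = B"
      using eq by (intro algebra.equality) auto
  qed
  show "(\<lambda>A. (underlying A, G A)) ` Obj V \<subseteq> (SIGMA u : UNIV. Pow (?D u \<times> elems mem u))"
    using closedD[OF closed_carrier] by (auto simp: G_def)
  have "small mem (ops S)"
    using variety by (simp add: variety_def)
  then have pow: "small mem (Pow (?D u \<times> elems mem u))" for u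
    by (intro small_Pow small_Sigma small_lists small_elems)
  have "class_sized mem (UNIV :: 'u set)"
    unfolding class_sized_def by (rule exI[of _ id]) simp
  then show "class_sized mem (SIGMA u : UNIV. Pow (?D u \<times> elems mem u))"
    by (rule class_sized_Sigma[OF _ small_imp_class_sized[OF pow]])
qed

lemma category_in_V: "category_in mem V"
  unfolding category_in_def
proof (intro conjI)
  show "class_sized mem (Arr V)"
  proof (rule class_sized_inj_on)
    show "inj_on (\<lambda>(A, h, B). ((A, B), h)) (Arr V)"
      by (auto simp: inj_on_def)
    show "(\<lambda>(A, h, B). ((A, B), h)) ` Arr V \<subseteq>
      (SIGMA p : Obj V \<times> Obj V. carrier (fst p) \<rightarrow>\<^sub>E carrier (snd p))"
      by (auto simp: Arr_V homomorphism_def)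
    show "class_sized mem (SIGMA p : Obj V \<times> Obj V. carrier (fst p) \<rightarrow>\<^sub>E carrier (snd p))"
      by (intro class_sized_Sigma class_sized_Obj small_imp_class_sized small_PiE small_elems)
  qed
qed (rule category, rule class_sized_Obj)

end

theorem theorem5p2:
  fixes mem :: "'u \<Rightarrow> 'u \<Rightarrow> bool"
    and C :: "('o, 'a) category"
    and S :: "'f signature"
    and E :: "('f trm \<times> 'f trm) set"
  assumes "grothendieck_universe mem"
  shows
    "(category_in mem C \<and>
      with_kernels_and_cokernels C \<and>
      pullback_stable_normal_epis C \<and>
      enough_normal_projectives C \<and>
      (\<forall>Q \<in> Obj C. \<forall>K \<in> Obj C. small mem (Ext C 1 Q K))
      \<longrightarrow> (\<forall>n \<ge> 1. \<forall>Q \<in> Obj C. \<forall>K \<in> Obj C. small mem (Ext C n Q K)))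
   \<and> (\<forall>V. semi_abelian_variety mem S E \<and> V = variety_category mem S E \<longrightarrow>
        category_in mem V \<and>
        with_kernels_and_cokernels V \<and>
        pullback_stable_normal_epis V \<and>
        enough_normal_projectives V \<and>
        (\<forall>Q \<in> Obj V. \<forall>K \<in> Obj V. small mem (Ext V 1 Q K)) \<and>
        (\<forall>n \<ge> 1. \<forall>Q \<in> Obj V. \<forall>K \<in> Obj V. small mem (Ext V n Q K)))"
proof -
  interpret universe mem
    by unfold_locales (rule assms)
  show ?thesis
  proof (rule conjI)
    show "category_in mem C \<and> with_kernels_and_cokernels C \<and> pullback_stable_normal_epis C \<and>
        enough_normal_projectives C \<and> (\<forall>Q \<in> Obj C. \<forall>K \<in> Obj C. small mem (Ext C 1 Q K))
        \<longrightarrow> (\<forall>n \<ge> 1. \<forall>Q \<in> Obj C. \<forall>K \<in> Obj C. small mem (Ext C n Q K))"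
    proof (intro impI allI ballI)
      fix n :: nat and Q K
      assume C: "category_in mem C \<and> with_kernels_and_cokernels C \<and> pullback_stable_normal_epis C \<and>
        enough_normal_projectives C \<and> (\<forall>Q \<in> Obj C. \<forall>K \<in> Obj C. small mem (Ext C 1 Q K))"
        and nQK: "n \<ge> 1" "Q \<in> Obj C" "K \<in> Obj C"
      have "is_category C" "with_kernels_and_cokernels C" "pullback_stable_normal_epis C"
        "enough_normal_projectives C"
        using C by (simp_all add: category_in_def)
      from small_Ext[OF this _ nQK] show "small mem (Ext C n Q K)"
        using C by blast
    qed
    show "\<forall>V. semi_abelian_variety mem S E \<and> V = variety_category mem S E \<longrightarrow>
        category_in mem V \<and> with_kernels_and_cokernels V \<and> pullback_stable_normal_epis V \<and>
        enough_normal_projectives V \<and>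
        (\<forall>Q \<in> Obj V. \<forall>K \<in> Obj V. small mem (Ext V 1 Q K)) \<and>
        (\<forall>n \<ge> 1. \<forall>Q \<in> Obj V. \<forall>K \<in> Obj V. small mem (Ext V n Q K))"
    proof (intro allI impI, elim conjE)
      fix W assume V: "semi_abelian_variety mem S E" and W: "W = variety_category mem S E"
      interpret semiabelian_variety mem S E
        using V by unfold_locales (simp_all add: semi_abelian_variety_def)
      note hyps = kernels_and_cokernels normal_epis_pullback_stable enough_projectives
      have Ext_1: "\<forall>Q \<in> Obj V. \<forall>K \<in> Obj V. small mem (Ext V 1 Q K)"
        by (intro ballI small_Ext_1)
      have Ext_n: "\<forall>n \<ge> 1. \<forall>Q \<in> Obj V. \<forall>K \<in> Obj V. small mem (Ext V n Q K)"
        by (intro allI impI ballI small_Ext[OF category hyps small_Ext_1])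
      show "category_in mem W \<and> with_kernels_and_cokernels W \<and> pullback_stable_normal_epis W \<and>
          enough_normal_projectives W \<and>
          (\<forall>Q \<in> Obj W. \<forall>K \<in> Obj W. small mem (Ext W 1 Q K)) \<and>
          (\<forall>n \<ge> 1. \<forall>Q \<in> Obj W. \<forall>K \<in> Obj W. small mem (Ext W n Q K))"
        unfolding W by (intro conjI category_in_V hyps Ext_1 Ext_n)
    qed
  qed
qed

end
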